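(* Let $M$ be a connected, closed, oriented three-dimensional Riemannian manifold with total volume $1$. (1) Every solution $u(t)$ to the vorticity equations for a nonviscous fluid with unit density, $$\dot\omega=(\omega\cdot\nabla)u-(u\cdot\nabla)\omega,\qquad \nabla\cdot u=0,\qquad \omega=\nabla\times u,$$ gives rise to a homotopy $f+X\,dt+V\epsilon+\pi\,dt\,\epsilon$ of $\mathbb{R}[\epsilon]$-collections of homotopy random variables under the identifications $$f=0,\qquad X=u^\flat,\qquad V=-\star dX,\qquad \pi=\tfrac12\delta(X\wedge\star X).$$ (2) Conversely, every homotopy $f+X\,dt+V\epsilon+\pi\,dt\,\epsilon$ of $\mathbb{R}[\epsilon]$-collections of homotopy random variables which satisfies the additional conditions $$f=0,\qquad V=-\star dX,\qquad \pi=\tfrac12\delta(X\wedge\star X)$$ arises from a solution to the vorticity equation with constant unit density and velocity $X^\sharp$.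
   Context: Operators on $M$ ($\dim M=3$): $\flat,\sharp$ are the musical isomorphisms between vector (multivector) fields and forms; $\star$ is the Hodge star, $\alpha\wedge\star\beta=\langle\alpha,\beta\rangle dV$; the codifferential is $\delta=(-1)^{3i+1}\star d\star:\Omega^i(M)\to\Omega^{i-1}(M)$; $\nabla\cdot u=\delta(u^\flat)$; $\nabla\times u=(\star d(u^\flat))^\sharp$. In $(\omega\cdot\nabla)u$ and $(u\cdot\nabla)\omega$, the symbol $\nabla$ is covariant differentiation along the indicated field. A dot or $\partial_t$ denotes the time derivative; time-dependent objects are power series in $t$ with smooth coefficients (time is identified with the homotopy parameter). Homotopies: $\mathbb{R}[\epsilon]$ is the parameter ring with $\epsilon$ of degree $-1$ (so $\epsilon^2=0$) and zero differential. $\mathbb{R}[\epsilon][[t,dt]]$ adjoins $t$ of degree $0$ and $dt$ of degree $-1$ with $d(t)=dt$, $d(dt)=0$. Forms of degree $k$ have degree $k$, and the differential on $\Omega^\bullet(M)\otimes\mathbb{R}[\epsilon][[t,dt]]$, also written $\delta$, is the graded tensor product differential (codifferential plus parameter-ring differential, Koszul signs). A homotopy of $\mathbb{R}[\epsilon]$-collections of homotopy random variables is a degree zero element $\mathcal{X}$ of $\Omega^\bullet(M)\otimes\mathbb{R}[\epsilon][[t,dt]]$ with $\delta(\exp(\mathcal{X}))=0$. Such an element has the form $f(t)+X(t)dt+V(t)\epsilon+\pi(t)dt\,\epsilon$, with $f,X,V,\pi$ power series in $t$ with coefficients functions, one-forms, one-forms and two-forms respectively. Writing $\rho=\exp(f)$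 and $XV$ for $X\wedge V$, the condition $\delta(\exp(\mathcal{X}))=0$ is equivalent to the three equations $$\dot\rho+\delta(\rho X)=0,\qquad \delta(\rho V)=0,\qquad -\partial_t(\rho V)+\delta(\rho\pi-\rho XV)=0.$$ *)

theory Defs
  imports "HOL-Analysis.Analysis" "HOL-Library.Function_Algebras"
begin

section \<open>Smooth functions on open subsets of a normed space\<close>

primrec Ck :: "nat \<Rightarrow> 'a::real_normed_vector set \<Rightarrow> ('a \<Rightarrow> 'b::real_normed_vector) \<Rightarrow> bool" where
  "Ck 0 S f = continuous_on S f"
| "Ck (Suc k) S f = ((\<forall>x\<in>S. f differentiable (at x)) \<and>
     (\<forall>v. Ck k S (\<lambda>x. frechet_derivative f (at x) v)))"

definition smooth_on :: "'a::real_normed_vector set \<Rightarrow> ('a \<Rightarrow> 'b::real_normed_vector) \<Rightarrow> bool" where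
  "smooth_on S f = (\<forall>k. Ck k S f)"

section \<open>Oriented Riemannian three-manifolds\<close>

type_synonym 'a chart = "'a set \<times> ('a \<Rightarrow> real^3)"

text \<open>The metric is given by its Gram matrix in each chart; the argument in \<open>real^3\<close> is the
  coordinate of the point in that chart.\<close>

record 'a riemannian3 =
  mtop :: "'a topology"
  atlas :: "'a chart set"
  metric :: "'a chart \<Rightarrow> real^3 \<Rightarrow> real^3^3"

definition chart_image :: "'a chart \<Rightarrow> (real^3) set" where
  "chart_image c = snd c ` fst c"

definition overlap :: "'a chart \<Rightarrow> 'a chart \<Rightarrow> (real^3) set" where
  "overlap c c' = snd c ` (fst c \<inter> fst c')"

definition transition :: "'a chart \<Rightarrow> 'a chart \<Rightarrow> real^3 \<Rightarrow> real^3" where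
  "transition c c' = snd c' \<circ> inv_into (fst c) (snd c)"

definition jacobian :: "'a chart \<Rightarrow> 'a chart \<Rightarrow> real^3 \<Rightarrow> real^3^3" where
  "jacobian c c' x = matrix (frechet_derivative (transition c c') (at x))"

definition oriented_smooth_atlas :: "'a topology \<Rightarrow> 'a chart set \<Rightarrow> bool" where
  "oriented_smooth_atlas T A \<longleftrightarrow>
     (\<Union>c\<in>A. fst c) = topspace T \<and>
     (\<forall>c\<in>A. openin T (fst c) \<and> open (chart_image c) \<and>
        homeomorphic_map (subtopology T (fst c)) (top_of_set (chart_image c)) (snd c)) \<and>
     (\<forall>c\<in>A. \<forall>c'\<in>A. smooth_on (overlap c c') (transition c c') \<and>
        (\<forall>x\<in>overlap c c'. det (jacobian c c' x) > 0))"

definition riemannian_metric :: "'a chart set \<Rightarrow> ('a chart \<Rightarrow> real^3 \<Rightarrow> real^3^3) \<Rightarrow> bool" where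
  "riemannian_metric A g \<longleftrightarrow>
     (\<forall>c\<in>A. smooth_on (chart_image c) (g c) \<and>
        (\<forall>x\<in>chart_image c. transpose (g c x) = g c x \<and>
           (\<forall>v. v \<noteq> 0 \<longrightarrow> v \<bullet> (g c x *v v) > 0))) \<and>
     (\<forall>c\<in>A. \<forall>c'\<in>A. \<forall>x\<in>overlap c c'.
        g c x = transpose (jacobian c c' x) ** g c' (transition c c' x) ** jacobian c c' x)"

text \<open>Second countability is not listed, since a compact space covered by open sets
  homeomorphic to open subsets of \<open>real^3\<close> is second countable.\<close>

definition connected_closed_oriented_riemannian3 :: "'a riemannian3 \<Rightarrow> bool" where
  "connected_closed_oriented_riemannian3 M \<longleftrightarrow>
     Hausdorff_space (mtop M) \<and> compact_space (mtop M) \<and> connected_space (mtop M) \<and>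
     oriented_smooth_atlas (mtop M) (atlas M) \<and>
     riemannian_metric (atlas M) (metric M)"

text \<open>The Riemannian volume measure is the Borel measure on the manifold whose density with
  respect to Lebesgue measure is \<open>sqrt (det g)\<close> in each chart.\<close>

definition riemannian_volume_measure :: "'a riemannian3 \<Rightarrow> 'a measure \<Rightarrow> bool" where
  "riemannian_volume_measure M \<mu> \<longleftrightarrow>
     space \<mu> = topspace (mtop M) \<and>
     sets \<mu> = sigma_sets (topspace (mtop M)) {U. openin (mtop M) U} \<and>
     (\<forall>c\<in>atlas M. \<forall>B\<in>sets borel. B \<subseteq> chart_image c \<longrightarrow>
        emeasure \<mu> {p \<in> fst c. snd c p \<in> B} =
        (\<integral>\<^sup>+ x. ennreal (sqrt (det (metric M c x))) * indicator B x \<partial>lborel))"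

definition has_total_volume :: "'a riemannian3 \<Rightarrow> ennreal \<Rightarrow> bool" where
  "has_total_volume M v \<longleftrightarrow>
     (\<exists>\<mu>. riemannian_volume_measure M \<mu> \<and> emeasure \<mu> (topspace (mtop M)) = v)"

section \<open>Exterior algebra of the dual of \<open>real^3\<close>\<close>

text \<open>An element of the exterior algebra is a function on lists of vectors; its component of
  degree \<open>k\<close> is its restriction to lists of length \<open>k\<close>.\<close>

type_synonym covec = "(real^3) list \<Rightarrow> real"

definition Alt :: "covec set" where
  "Alt = {\<alpha>. (\<forall>vs. \<forall>i<length vs. linear (\<lambda>w. \<alpha> (vs[i := w]))) \<and>
             (\<forall>vs. \<not> distinct vs \<longrightarrow> \<alpha> vs = 0)}"

definition shuffle_sign :: "nat set \<Rightarrow> nat \<Rightarrow> real" where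
  "shuffle_sign I n = (-1) ^ card {(i, j). i \<in> I \<and> j < i \<and> j \<notin> I \<and> i < n}"

text \<open>The sum runs over shuffles: \<open>I\<close> is the set of argument positions fed to \<open>\<alpha>\<close>.\<close>

definition wedge_at :: "covec \<Rightarrow> covec \<Rightarrow> covec" where
  "wedge_at \<alpha> \<beta> vs = (\<Sum>I\<in>Pow {..<length vs}.
     shuffle_sign I (length vs) * \<alpha> (nths vs I) * \<beta> (nths vs (- I)))"

definition volume_at :: "real^3^3 \<Rightarrow> covec" where
  "volume_at G vs = (if length vs = 3 then sqrt (det G) * det (vector vs :: real^3^3) else 0)"

text \<open>On \<open>k\<close>-covectors this is \<open>1/k! g\<^sup>i\<^sup>j \<dots> g\<^sup>m\<^sup>n \<alpha>\<^sub>i\<^sub>\<dots>\<^sub>m \<beta>\<^sub>j\<^sub>\<dots>\<^sub>n\<close>; different degrees are orthogonal.\<close>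

definition inner_at :: "real^3^3 \<Rightarrow> covec \<Rightarrow> covec \<Rightarrow> real" where
  "inner_at G \<alpha> \<beta> = (\<Sum>k\<le>3. (\<Sum>is | length is = k. \<Sum>js | length js = k.
      (\<Prod>m<k. matrix_inv G $ (is ! m) $ (js ! m)) *
      \<alpha> (map (\<lambda>i. axis i 1) is) * \<beta> (map (\<lambda>i. axis i 1) js)) / fact k)"

text \<open>This is the linear extension to the whole exterior algebra of the Hodge star determined
  by \<open>\<alpha> \<and> \<star>\<beta> = \<langle>\<alpha>,\<beta>\<rangle> dV\<close> for \<open>\<alpha>, \<beta>\<close> of equal degree: if the degrees differ, the degree-three
  component of \<open>\<alpha> \<and> \<star>\<beta>\<close> vanishes, as does \<open>\<langle>\<alpha>,\<beta>\<rangle>\<close>.\<close>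

definition hodge_at :: "real^3^3 \<Rightarrow> covec \<Rightarrow> covec" where
  "hodge_at G \<beta> = (THE \<gamma>. \<gamma> \<in> Alt \<and>
     (\<forall>\<alpha>\<in>Alt. \<forall>vs. length vs = 3 \<longrightarrow> wedge_at \<alpha> \<gamma> vs = inner_at G \<alpha> \<beta> * volume_at G vs))"

section \<open>Vector fields and differential forms\<close>

text \<open>A vector field or (inhomogeneous) differential form is the family of its coordinate
  representations on the chart images, compatible under the transition maps. Representations
  are set to zero outside the chart image, so that equality of fields and forms is \<open>=\<close>.\<close>

type_synonym 'a vfield = "'a chart \<Rightarrow> real^3 \<Rightarrow> real^3"
type_synonym 'a form = "'a chart \<Rightarrow> real^3 \<Rightarrow> covec"

definition in_chart :: "'a riemannian3 \<Rightarrow> 'a chart \<Rightarrow> real^3 \<Rightarrow> bool" where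
  "in_chart M c x \<longleftrightarrow> c \<in> atlas M \<and> x \<in> chart_image c"

definition vector_fields :: "'a riemannian3 \<Rightarrow> 'a vfield set" where
  "vector_fields M = {u.
     (\<forall>c x. \<not> in_chart M c x \<longrightarrow> u c x = 0) \<and>
     (\<forall>c\<in>atlas M. smooth_on (chart_image c) (u c)) \<and>
     (\<forall>c\<in>atlas M. \<forall>c'\<in>atlas M. \<forall>x\<in>overlap c c'.
        u c' (transition c c' x) = jacobian c c' x *v u c x)}"

definition forms :: "'a riemannian3 \<Rightarrow> 'a form set" where
  "forms M = {\<alpha>.
     (\<forall>c x. \<not> in_chart M c x \<longrightarrow> \<alpha> c x = 0) \<and>
     (\<forall>c x. \<alpha> c x \<in> Alt) \<and>
     (\<forall>c\<in>atlas M. \<forall>vs. smooth_on (chart_image c) (\<lambda>x. \<alpha> c x vs)) \<and>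
     (\<forall>c\<in>atlas M. \<forall>c'\<in>atlas M. \<forall>x\<in>overlap c c'. \<forall>vs.
        \<alpha> c x vs = \<alpha> c' (transition c c' x) (map ((*v) (jacobian c c' x)) vs))}"

definition kforms :: "'a riemannian3 \<Rightarrow> nat \<Rightarrow> 'a form set" where
  "kforms M k = {\<alpha>\<in>forms M. \<forall>c x vs. length vs \<noteq> k \<longrightarrow> \<alpha> c x vs = 0}"

definition unit_form :: "'a riemannian3 \<Rightarrow> 'a form" where
  "unit_form M = (\<lambda>c x vs. if in_chart M c x \<and> vs = [] then 1 else 0)"

definition wedge :: "'a form \<Rightarrow> 'a form \<Rightarrow> 'a form" where
  "wedge \<alpha> \<beta> = (\<lambda>c x. wedge_at (\<alpha> c x) (\<beta> c x))"

definition form_scale :: "real \<Rightarrow> 'a form \<Rightarrow> 'a form" where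
  "form_scale r \<alpha> = (\<lambda>c x vs. r * \<alpha> c x vs)"

definition star :: "'a riemannian3 \<Rightarrow> 'a form \<Rightarrow> 'a form" where
  "star M \<alpha> = (\<lambda>c x. if in_chart M c x then hodge_at (metric M c x) (\<alpha> c x) else 0)"

definition ext_d :: "'a riemannian3 \<Rightarrow> 'a form \<Rightarrow> 'a form" where
  "ext_d M \<alpha> = (\<lambda>c x vs. if in_chart M c x then
     (\<Sum>i<length vs. (-1) ^ i *
        frechet_derivative (\<lambda>y. \<alpha> c y (take i vs @ drop (Suc i) vs)) (at x) (vs ! i))
     else 0)"

text \<open>On \<open>i\<close>-forms the codifferential is \<open>(-1)\<^sup>3\<^sup>i\<^sup>+\<^sup>1 \<star> d \<star>\<close>; the output on a list \<open>vs\<close> comes from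
  the component of degree \<open>i = length vs + 1\<close>.\<close>

definition codiff :: "'a riemannian3 \<Rightarrow> 'a form \<Rightarrow> 'a form" where
  "codiff M \<alpha> = (\<lambda>c x vs.
     (-1) ^ (3 * (length vs + 1) + 1) * star M (ext_d M (star M \<alpha>)) c x vs)"

definition flat :: "'a riemannian3 \<Rightarrow> 'a vfield \<Rightarrow> 'a form" where
  "flat M u = (\<lambda>c x vs. if in_chart M c x \<and> length vs = 1
     then u c x \<bullet> (metric M c x *v hd vs) else 0)"

definition sharp :: "'a riemannian3 \<Rightarrow> 'a form \<Rightarrow> 'a vfield" where
  "sharp M \<alpha> = (\<lambda>c x. if in_chart M c x
     then matrix_inv (metric M c x) *v (\<chi> i. \<alpha> c x [axis i 1]) else 0)"

definition divergence :: "'a riemannian3 \<Rightarrow> 'a vfield \<Rightarrow> 'a form" where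
  "divergence M u = codiff M (flat M u)"

definition curl :: "'a riemannian3 \<Rightarrow> 'a vfield \<Rightarrow> 'a vfield" where
  "curl M u = sharp M (star M (ext_d M (flat M u)))"

text \<open>Levi-Civita connection; \<open>christoffel M c x i j k\<close> is \<open>\<Gamma>\<^sup>i\<^sub>j\<^sub>k\<close>.\<close>

definition partial_metric ::
  "'a riemannian3 \<Rightarrow> 'a chart \<Rightarrow> real^3 \<Rightarrow> 3 \<Rightarrow> 3 \<Rightarrow> 3 \<Rightarrow> real" where
  "partial_metric M c x l i j =
     frechet_derivative (\<lambda>y. metric M c y $ i $ j) (at x) (axis l 1)"

definition christoffel ::
  "'a riemannian3 \<Rightarrow> 'a chart \<Rightarrow> real^3 \<Rightarrow> 3 \<Rightarrow> 3 \<Rightarrow> 3 \<Rightarrow> real" where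
  "christoffel M c x i j k = (\<Sum>l\<in>UNIV. matrix_inv (metric M c x) $ i $ l *
     (partial_metric M c x j l k + partial_metric M c x k l j - partial_metric M c x l j k)) / 2"

text \<open>\<open>cov_deriv M w u\<close> is \<open>(w \<cdot> \<nabla>) u\<close>.\<close>

definition cov_deriv :: "'a riemannian3 \<Rightarrow> 'a vfield \<Rightarrow> 'a vfield \<Rightarrow> 'a vfield" where
  "cov_deriv M w u = (\<lambda>c x. if in_chart M c x then
     frechet_derivative (u c) (at x) (w c x) +
     (\<chi> i. \<Sum>j\<in>UNIV. \<Sum>k\<in>UNIV. christoffel M c x i j k * w c x $ j * u c x $ k)
     else 0)"

section \<open>The vorticity equations\<close>

text \<open>Time-dependent objects are formal power series in \<open>t\<close>, represented by their coefficient
  sequences; bilinear operations are extended by the Cauchy product.\<close>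

definition time_deriv_vf :: "(nat \<Rightarrow> 'a vfield) \<Rightarrow> nat \<Rightarrow> 'a vfield" where
  "time_deriv_vf u n = (\<lambda>c x. real (Suc n) *\<^sub>R u (Suc n) c x)"

definition cov_deriv_ser ::
  "'a riemannian3 \<Rightarrow> (nat \<Rightarrow> 'a vfield) \<Rightarrow> (nat \<Rightarrow> 'a vfield) \<Rightarrow> nat \<Rightarrow> 'a vfield" where
  "cov_deriv_ser M w u n = (\<Sum>k\<le>n. cov_deriv M (w k) (u (n - k)))"

definition wedge_ser :: "(nat \<Rightarrow> 'a form) \<Rightarrow> (nat \<Rightarrow> 'a form) \<Rightarrow> nat \<Rightarrow> 'a form" where
  "wedge_ser \<alpha> \<beta> n = (\<Sum>k\<le>n. wedge (\<alpha> k) (\<beta> (n - k)))"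

definition vorticity_solution ::
  "'a riemannian3 \<Rightarrow> (nat \<Rightarrow> 'a vfield) \<Rightarrow> (nat \<Rightarrow> 'a vfield) \<Rightarrow> bool" where
  "vorticity_solution M u \<omega> \<longleftrightarrow>
     (\<forall>n. u n \<in> vector_fields M \<and> \<omega> n \<in> vector_fields M) \<and>
     (\<forall>n. time_deriv_vf \<omega> n = cov_deriv_ser M \<omega> u n - cov_deriv_ser M u \<omega> n) \<and>
     (\<forall>n. divergence M (u n) = 0) \<and>
     (\<forall>n. \<omega> n = curl M (u n))"

section \<open>Homotopies of collections of homotopy random variables\<close>

text \<open>An element of \<open>\<Omega>(M) \<otimes> \<real>[\<epsilon>][[t,dt]]\<close> is written \<open>\<Sum>\<^sub>S \<Sum>\<^sub>n (A S n) t\<^sup>n \<tau>\<^sub>S\<close>, where the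
  monomials \<open>\<tau>\<^sub>S\<close> are \<open>1\<close>, \<open>dt\<close>, \<open>\<epsilon>\<close>, \<open>dt \<epsilon>\<close> (in this order of the factors) for
  \<open>S = {}, {Dt}, {Eps}, {Dt, Eps}\<close>. As \<open>dt\<close> and \<open>\<epsilon>\<close> have degree \<open>-1\<close>, \<open>\<tau>\<^sub>S\<close> has degree
  \<open>- card S\<close>.\<close>

datatype odd_param = Dt | Eps

type_synonym 'a elt = "odd_param set \<Rightarrow> nat \<Rightarrow> 'a form"

definition param_sign :: "odd_param set \<Rightarrow> odd_param set \<Rightarrow> real" where
  "param_sign S T = (if Eps \<in> S \<and> Dt \<in> T then -1 else 1)"

text \<open>Koszul rule: moving a parameter of degree \<open>m\<close> or \<open>-m\<close> past a form \<open>\<alpha>\<close> multiplies the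
  degree-\<open>k\<close> component of \<open>\<alpha>\<close> by \<open>(-1)\<^sup>m\<^sup>k\<close>.\<close>

definition koszul :: "nat \<Rightarrow> 'a form \<Rightarrow> 'a form" where
  "koszul m \<alpha> = (\<lambda>c x vs. (-1) ^ (m * length vs) * \<alpha> c x vs)"

definition elt_one :: "'a riemannian3 \<Rightarrow> 'a elt" where
  "elt_one M = (\<lambda>S n. if S = {} \<and> n = 0 then unit_form M else 0)"

definition elt_mult :: "'a elt \<Rightarrow> 'a elt \<Rightarrow> 'a elt" where
  "elt_mult A B = (\<lambda>U n. \<Sum>S\<in>Pow U. \<Sum>k\<le>n.
     form_scale (param_sign S (U - S))
       (wedge (A S k) (koszul (card S) (B (U - S) (n - k)))))"

primrec elt_power :: "'a riemannian3 \<Rightarrow> 'a elt \<Rightarrow> nat \<Rightarrow> 'a elt" where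
  "elt_power M A 0 = elt_one M"
| "elt_power M A (Suc m) = elt_mult A (elt_power M A m)"

definition elt_exp :: "'a riemannian3 \<Rightarrow> 'a elt \<Rightarrow> 'a elt" where
  "elt_exp M A = (\<lambda>S n c x vs. \<Sum>m. elt_power M A m S n c x vs / fact m)"

text \<open>\<open>\<delta>(\<alpha> t\<^sup>n \<tau>\<^sub>S) = (\<delta>\<alpha>) t\<^sup>n \<tau>\<^sub>S + (-1)\<^sup>|\<^sup>\<alpha>\<^sup>| \<alpha> n t\<^sup>n\<^sup>-\<^sup>1 dt \<tau>\<^sub>S\<close>\<close>

definition elt_diff :: "'a riemannian3 \<Rightarrow> 'a elt \<Rightarrow> 'a elt" where
  "elt_diff M A = (\<lambda>S n. codiff M (A S n) +
     (if Dt \<in> S then form_scale (real (Suc n)) (koszul 1 (A (S - {Dt}) (Suc n))) else 0))"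

definition degree_zero :: "'a riemannian3 \<Rightarrow> 'a elt \<Rightarrow> bool" where
  "degree_zero M A \<longleftrightarrow> (\<forall>S n. A S n \<in> kforms M (card S))"

definition homotopy :: "'a riemannian3 \<Rightarrow> 'a elt \<Rightarrow> bool" where
  "homotopy M A \<longleftrightarrow> degree_zero M A \<and> elt_diff M (elt_exp M A) = 0"

text \<open>\<open>f + X dt + V \<epsilon> + \<pi> dt \<epsilon>\<close>\<close>

definition assemble ::
  "(nat \<Rightarrow> 'a form) \<Rightarrow> (nat \<Rightarrow> 'a form) \<Rightarrow> (nat \<Rightarrow> 'a form) \<Rightarrow> (nat \<Rightarrow> 'a form) \<Rightarrow> 'a elt" where
  "assemble f X V \<pi> = (\<lambda>S. if S = {} then f else if S = {Dt} then X
     else if S = {Eps} then V else \<pi>)"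

text \<open>\<open>\<rho> = exp f\<close>\<close>

definition density_ser :: "'a riemannian3 \<Rightarrow> (nat \<Rightarrow> 'a form) \<Rightarrow> nat \<Rightarrow> 'a form" where
  "density_ser M f = elt_exp M (assemble f 0 0 0) {}"

definition unit_density :: "'a riemannian3 \<Rightarrow> nat \<Rightarrow> 'a form" where
  "unit_density M n = (if n = 0 then unit_form M else 0)"

end

theory Submission
  imports Defs
begin

text \<open>Work in one chart, with Gram matrix \<open>G\<close> and \<open>s = sqrt (det G)\<close>. Forms of degree zero to three on
\<open>real^3\<close> are the same as a number, a vector \<open>a\<close> (acting by \<open>a \<bullet> v\<close>), a vector \<open>b\<close> (acting by
\<open>b \<bullet> (v \<times> w)\<close>) and a number (multiplying \<open>u \<bullet> (v \<times> w)\<close>); these are \<open>cov0\<close>, \<open>cov1\<close>, \<open>cov2\<close>, \<open>cov3\<close>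
below. In these terms the Hodge star is multiplication by \<open>s\<close>, \<open>s G\<^sup>-\<^sup>1\<close>, \<open>G / s\<close> and \<open>1 / s\<close>, and the
exterior derivative is the coordinate gradient, rotation and divergence, so that every operator of the
statement becomes ordinary vector calculus on an open subset of \<open>real^3\<close>.

Let \<open>u\<close> be the velocity and \<open>\<omega>\<close> its curl, so that \<open>X = u\<^sup>\<flat>\<close> and \<open>V = - \<omega>\<^sup>\<flat>\<close>. Since \<open>f = 0\<close>, the element
is nilpotent and its exponential is \<open>1 + X dt + V \<epsilon> + (\<pi> - X \<and> V) dt \<epsilon>\<close>. Its differential has four
components. The one without parameters is \<open>\<delta> 1 = 0\<close>. The \<open>\<epsilon>\<close> component is \<open>\<delta> V\<close>, which
vanishes because a rotation has no divergence. The \<open>dt\<close> component is \<open>\<delta> X\<close>, the divergence of \<open>u\<close>. In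
the \<open>dt \<epsilon>\<close> component \<open>\<pi>\<close> drops out, being itself a codifferential, and \<open>X \<and> V\<close> is the
two-form of the vector product: what is left says that \<open>\<partial>\<^sub>t \<omega>\<close> equals \<open>rot (s (u \<times> \<omega>)) / s\<close>, where \<open>\<times>\<close>
and \<open>rot\<close> are those of the coordinates. As \<open>s u\<close> and \<open>s \<omega>\<close> are divergence free, the product rule for
the rotation of a vector product (\<open>rot_scaled_cross\<close>) makes this the Lie bracket
\<open>D u (\<omega>) - D \<omega> (u)\<close>, and as the Levi-Civita connection has no torsion (\<open>cov_deriv_commutator\<close>) this
is \<open>(\<omega> \<cdot> \<nabla>) u - (u \<cdot> \<nabla>) \<omega>\<close>.

Hence being a homotopy and solving the vorticity equations are equivalent
(\<open>homotopy_iff_vorticity\<close>), once all fields are known to be smooth and compatible with the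
transition maps. For \<open>V\<close> and \<open>\<omega>\<close> this passes from the given one to the other through
\<open>V = - \<omega>\<^sup>\<flat>\<close>, so the behaviour of the exterior derivative under a change of coordinates matters
only for functions, in the construction of \<open>\<pi>\<close> (\<open>energy_2form_kforms\<close>).\<close>

section \<open>Smooth functions\<close>

lemma frechet_derivative_cong_open:
  assumes "open S" "x \<in> S" "\<And>y. y \<in> S \<Longrightarrow> f y = g y"
  shows "frechet_derivative f (at x) = frechet_derivative g (at x)"
proof -
  have "(f has_derivative D) (at x) \<longleftrightarrow> (g has_derivative D) (at x)" for D
    using has_derivative_transform_within_open[of _ _ x UNIV S] assms by (metis)
  then show ?thesis
    by (simp add: frechet_derivative_def)
qed

lemma differentiable_cong_open:
  assumes "open S" "x \<in> S" "\<And>y. y \<in> S \<Longrightarrow> f y = g y"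
  shows "f differentiable (at x) \<longleftrightarrow> g differentiable (at x)"
  unfolding differentiable_def
  using has_derivative_transform_within_open[of _ _ x UNIV S] assms by (metis)

lemma Ck_cong:
  assumes "open S" "\<And>x. x \<in> S \<Longrightarrow> f x = g x"
  shows "Ck k S f \<longleftrightarrow> Ck k S g"
  using assms(2)
proof (induction k arbitrary: f g)
  case 0
  then show ?case by (auto intro!: continuous_on_cong)
next
  case (Suc k)
  have "\<And>x. x \<in> S \<Longrightarrow> f differentiable (at x) \<longleftrightarrow> g differentiable (at x)"
    using differentiable_cong_open[OF assms(1)] Suc.prems by blast
  moreover have "Ck k S (\<lambda>x. frechet_derivative f (at x) v) \<longleftrightarrow> Ck k S (\<lambda>x. frechet_derivative g (at x) v)" for v
    by (rule Suc.IH) (metis frechet_derivative_cong_open[OF assms(1)] Suc.prems)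
  ultimately show ?case by simp
qed

text \<open>The class \<open>Ck\<close> refers to the Frechet derivative chosen by description; this rule lets closure
properties be proved with whichever derivative the calculus rules deliver.\<close>
lemma Ck_Suc_I:
  assumes "open S" "\<And>x. x \<in> S \<Longrightarrow> (f has_derivative f' x) (at x)" "\<And>v. Ck k S (\<lambda>x. f' x v)"
  shows "Ck (Suc k) S f"
proof -
  have "frechet_derivative f (at x) = f' x" if "x \<in> S" for x
    using frechet_derivative_at[OF assms(2)[OF that]] by simp
  then show ?thesis
    using assms Ck_cong[OF assms(1), of "\<lambda>x. frechet_derivative f (at x) _" "\<lambda>x. f' x _" k]
    by (auto simp: differentiable_def) 
qed

lemma Ck_Suc_D:
  assumes "Ck (Suc k) S f" "x \<in> S"
  shows "(f has_derivative frechet_derivative f (at x)) (at x)"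
  using assms frechet_derivative_works by auto

lemma Ck_Suc_imp: "Ck (Suc k) S f \<Longrightarrow> Ck k S f"
proof (induction k arbitrary: f)
  case 0
  then have "\<forall>x\<in>S. f differentiable at x" by simp
  then show ?case
    by (simp add: continuous_at_imp_continuous_on differentiable_imp_continuous_within)
next
  case (Suc k)
  then show ?case by (metis Ck.simps(2))
qed

lemma Ck_const: "Ck k S (\<lambda>x. c)"
  by (induction k arbitrary: c) (auto)

lemma Ck_bounded_linear:
  assumes "open S" "bounded_linear L" "Ck k S f"
  shows "Ck k S (\<lambda>x. L (f x))"
  using assms(3)
proof (induction k arbitrary: f)
  case 0
  then show ?case
    using bounded_linear.continuous_on[OF assms(2)] by simp
next
  case (Suc k)
  show ?case
    by (rule Ck_Suc_I[OF assms(1) bounded_linear.has_derivative[OF assms(2) Ck_Suc_D[OF Suc.prems]]])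
      (use Suc in auto)
qed

lemma Ck_add:
  assumes "open S" "Ck k S f" "Ck k S g"
  shows "Ck k S (\<lambda>x. f x + g x)"
  using assms(2,3)
proof (induction k arbitrary: f g)
  case 0
  then show ?case by (auto intro: continuous_on_add)
next
  case (Suc k)
  show ?case
    by (rule Ck_Suc_I[OF assms(1) has_derivative_add[OF Ck_Suc_D[OF Suc.prems(1)] Ck_Suc_D[OF Suc.prems(2)]]])
      (use Suc in auto)
qed

lemma Ck_bilinear:
  assumes "open S" "bounded_bilinear p" "Ck k S f" "Ck k S g"
  shows "Ck k S (\<lambda>x. p (f x) (g x))"
  using assms(3,4)
proof (induction k arbitrary: f g)
  case 0
  then show ?case using bounded_bilinear.continuous_on[OF assms(2)] by auto
next
  case (Suc k)
  have "Ck k S f" "Ck k S g" using Suc.prems Ck_Suc_imp by blast+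
  then have c: "Ck k S (\<lambda>x. p (f x) (frechet_derivative g (at x) v) + p (frechet_derivative f (at x) v) (g x))" for v
    using Suc.prems by (intro Ck_add assms Suc.IH) auto
  show ?case
    by (rule Ck_Suc_I[OF assms(1) bounded_bilinear.FDERIV[OF assms(2)
          Ck_Suc_D[OF Suc.prems(1)] Ck_Suc_D[OF Suc.prems(2)]] c])
qed

lemma Ck_inverse:
  fixes f :: "'a::real_normed_vector \<Rightarrow> real"
  assumes "open S" "\<And>x. x \<in> S \<Longrightarrow> f x \<noteq> 0" "Ck k S f"
  shows "Ck k S (\<lambda>x. inverse (f x))"
  using assms(3)
proof (induction k)
  case 0
  then show ?case using assms(2) by (auto intro!: continuous_on_inverse)
next
  case (Suc k)
  have "Ck k S f" using Suc.prems Ck_Suc_imp by blast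
  then have i: "Ck k S (\<lambda>x. inverse (f x))" using Suc.IH by blast
  have c: "Ck k S (\<lambda>x. - (inverse (f x) * frechet_derivative f (at x) v * inverse (f x)))" for v
    using Suc.prems
    by (intro Ck_bounded_linear[OF assms(1) bounded_linear_minus[OF bounded_linear_ident]] Ck_bilinear[OF assms(1) bounded_bilinear_mult] i) auto
  show ?case
    by (rule Ck_Suc_I[OF assms(1) Deriv.has_derivative_inverse[OF assms(2) Ck_Suc_D[OF Suc.prems]] c])
qed

lemma Ck_sqrt:
  fixes f :: "'a::real_normed_vector \<Rightarrow> real"
  assumes "open S" "\<And>x. x \<in> S \<Longrightarrow> f x > 0" "Ck k S f"
  shows "Ck k S (\<lambda>x. sqrt (f x))"
  using assms(3)
proof (induction k)
  case 0
  then show ?case by (auto intro!: continuous_on_real_sqrt)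
next
  case (Suc k)
  have "Ck k S f" using Suc.prems Ck_Suc_imp by blast
  then have r: "Ck k S (\<lambda>x. sqrt (f x))" using Suc.IH by blast
  have "sqrt (f x) \<noteq> 0" if "x \<in> S" for x using assms(2)[OF that] by simp
  then have i: "Ck k S (\<lambda>x. inverse (sqrt (f x)))"
    by (rule Ck_inverse[OF assms(1) _ r])
  have c: "Ck k S (\<lambda>x. frechet_derivative f (at x) v * (inverse (sqrt (f x)) * (1/2)))" for v
  proof -
    have "Ck k S (\<lambda>x. frechet_derivative f (at x) v)" using Suc.prems by simp
    from Ck_bilinear[OF assms(1) bounded_bilinear_mult this
        Ck_bilinear[OF assms(1) bounded_bilinear_mult i Ck_const[of _ _ "1/2"]]]
    show ?thesis .
  qed
  have d: "((\<lambda>x. sqrt (f x)) has_derivative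
      (\<lambda>v. frechet_derivative f (at x) v * (inverse (sqrt (f x)) * (1/2)))) (at x)" if "x \<in> S" for x
  proof -
    have "(sqrt has_derivative (*) (inverse (sqrt (f x)) * (1/2))) (at (f x))"
      using DERIV_real_sqrt[OF assms(2)[OF that]] by (simp only: has_field_derivative_def divide_inverse mult_1_left)
    from has_derivative_compose[OF Ck_Suc_D[OF Suc.prems that] this] 
    show ?thesis by (simp add: mult.commute)
  qed
  show ?case by (rule Ck_Suc_I[OF assms(1) d c])
qed

lemma smooth_onD: "smooth_on S f \<Longrightarrow> x \<in> S \<Longrightarrow> f differentiable (at x)"
  unfolding smooth_on_def by (metis Ck.simps(2))

lemma smooth_on_has_derivative:
  "smooth_on S f \<Longrightarrow> x \<in> S \<Longrightarrow> (f has_derivative frechet_derivative f (at x)) (at x)"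
  using smooth_onD frechet_derivative_works by blast

lemma smooth_on_derivative: "smooth_on S f \<Longrightarrow> smooth_on S (\<lambda>x. frechet_derivative f (at x) v)"
  unfolding smooth_on_def by (metis Ck.simps(2))

lemma smooth_on_cong:
  "open S \<Longrightarrow> (\<And>x. x \<in> S \<Longrightarrow> f x = g x) \<Longrightarrow> smooth_on S f \<longleftrightarrow> smooth_on S g"
  unfolding smooth_on_def using Ck_cong by blast

lemma smooth_on_const: "smooth_on S (\<lambda>x. c)"
  by (simp add: smooth_on_def Ck_const)

lemma smooth_on_linear:
  "open S \<Longrightarrow> bounded_linear L \<Longrightarrow> smooth_on S f \<Longrightarrow> smooth_on S (\<lambda>x. L (f x))"
  by (simp add: smooth_on_def Ck_bounded_linear)

lemma smooth_on_add:
  "open S \<Longrightarrow> smooth_on S f \<Longrightarrow> smooth_on S g \<Longrightarrow> smooth_on S (\<lambda>x. f x + g x)"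
  by (simp add: smooth_on_def Ck_add)

lemma smooth_on_sum:
  "open S \<Longrightarrow> (\<And>i. i \<in> I \<Longrightarrow> smooth_on S (f i)) \<Longrightarrow> smooth_on S (\<lambda>x. \<Sum>i\<in>I. f i x)"
  by (induction I rule: infinite_finite_induct) (auto simp: smooth_on_const intro: smooth_on_add)

lemma smooth_on_bilinear:
  "open S \<Longrightarrow> bounded_bilinear p \<Longrightarrow> smooth_on S f \<Longrightarrow> smooth_on S g \<Longrightarrow> smooth_on S (\<lambda>x. p (f x) (g x))"
  by (simp add: smooth_on_def Ck_bilinear)

lemma smooth_on_inverse:
  fixes f :: "'a::real_normed_vector \<Rightarrow> real"
  shows "open S \<Longrightarrow> (\<And>x. x \<in> S \<Longrightarrow> f x \<noteq> 0) \<Longrightarrow> smooth_on S f \<Longrightarrow> smooth_on S (\<lambda>x. inverse (f x))"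
  by (simp add: smooth_on_def Ck_inverse)

lemma smooth_on_sqrt:
  fixes f :: "'a::real_normed_vector \<Rightarrow> real"
  shows "open S \<Longrightarrow> (\<And>x. x \<in> S \<Longrightarrow> f x > 0) \<Longrightarrow> smooth_on S f \<Longrightarrow> smooth_on S (\<lambda>x. sqrt (f x))"
  by (simp add: smooth_on_def Ck_sqrt)

lemma bounded_bilinear_cross3: "bounded_bilinear cross3"
  using bilinear_cross bilinear_conv_bounded_bilinear by blast

lemma bounded_bilinear_matrix_vector: "bounded_bilinear ((*v) :: real^'n^'m \<Rightarrow> real^'n \<Rightarrow> real^'m)"
  unfolding bilinear_conv_bounded_bilinear[symmetric] bilinear_def
  by (auto intro!: linearI simp: matrix_vector_right_distrib matrix_vector_mult_add_rdistrib
      scaleR_matrix_vector_assoc matrix_vector_mult_scaleR)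

section \<open>Symmetry of second derivatives\<close>

text \<open>The mean value theorem is applied along \<open>v\<close> to the increment of \<open>f\<close> in the direction \<open>w\<close>, and
then along \<open>w\<close> to the derivative of \<open>f\<close> in the direction \<open>v\<close>.\<close>
lemma second_difference_mvt:
  fixes f :: "'a::real_normed_vector \<Rightarrow> real"
  assumes "0 < h"
    and f: "\<And>s t. 0 \<le> s \<Longrightarrow> s \<le> h \<Longrightarrow> 0 \<le> t \<Longrightarrow> t \<le> h \<Longrightarrow>
      (f has_derivative f' (x + s *\<^sub>R v + t *\<^sub>R w)) (at (x + s *\<^sub>R v + t *\<^sub>R w))"
    and f': "\<And>s t. 0 \<le> s \<Longrightarrow> s \<le> h \<Longrightarrow> 0 \<le> t \<Longrightarrow> t \<le> h \<Longrightarrow>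
      ((\<lambda>y. f' y v) has_derivative f'' (x + s *\<^sub>R v + t *\<^sub>R w)) (at (x + s *\<^sub>R v + t *\<^sub>R w))"
  shows "\<exists>s t. 0 < s \<and> s < h \<and> 0 < t \<and> t < h \<and>
    f (x + h *\<^sub>R v + h *\<^sub>R w) - f (x + h *\<^sub>R v) - f (x + h *\<^sub>R w) + f x =
      h * (h * f'' (x + s *\<^sub>R v + t *\<^sub>R w) w)"
proof -
  have lin: "linear (f' (x + s *\<^sub>R v + t *\<^sub>R w))" "linear (f'' (x + s *\<^sub>R v + t *\<^sub>R w))"
    if "0 \<le> s" "s \<le> h" "0 \<le> t" "t \<le> h" for s t
    using f[OF that] f'[OF that] has_derivative_linear by blast+
  define g where "g s = f (x + s *\<^sub>R v + h *\<^sub>R w) - f (x + s *\<^sub>R v + 0 *\<^sub>R w)" for s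
  have "\<exists>s>0. s < h \<and> g h - g 0 = (h - 0) * (f' (x + s *\<^sub>R v + h *\<^sub>R w) v - f' (x + s *\<^sub>R v + 0 *\<^sub>R w) v)"
  proof (rule MVT2[OF \<open>0 < h\<close>])
    fix s assume s: "0 \<le> s" "s \<le> h"
    have "((\<lambda>s. f (x + s *\<^sub>R v + t *\<^sub>R w)) has_derivative (\<lambda>r. f' (x + s *\<^sub>R v + t *\<^sub>R w) (r *\<^sub>R v))) (at s)"
      if "0 \<le> t" "t \<le> h" for t
    proof -
      have "((\<lambda>s. x + s *\<^sub>R v + t *\<^sub>R w) has_derivative (\<lambda>r. r *\<^sub>R v)) (at s)"
        by (auto intro!: derivative_eq_intros)
      from has_derivative_compose[OF this f[OF s that]] show ?thesis .
    qed
    from this[of h] this[of 0] \<open>0 < h\<close> lin(1)[OF s, of h] lin(1)[OF s, of 0]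
    have "(g has_derivative (\<lambda>r. r *\<^sub>R f' (x + s *\<^sub>R v + h *\<^sub>R w) v - r *\<^sub>R f' (x + s *\<^sub>R v + 0 *\<^sub>R w) v)) (at s)"
      unfolding g_def by (intro has_derivative_diff) (auto simp: linear_cmul)
    then show "(g has_real_derivative f' (x + s *\<^sub>R v + h *\<^sub>R w) v - f' (x + s *\<^sub>R v + 0 *\<^sub>R w) v) (at s)"
      unfolding has_field_derivative_def
      by (rule has_derivative_eq_rhs) (auto simp: algebra_simps)
  qed
  then obtain s where s: "0 < s" "s < h"
    and gs: "g h - g 0 = h * (f' (x + s *\<^sub>R v + h *\<^sub>R w) v - f' (x + s *\<^sub>R v + 0 *\<^sub>R w) v)" by auto
  have "\<exists>t>0. t < h \<and> f' (x + s *\<^sub>R v + h *\<^sub>R w) v - f' (x + s *\<^sub>R v + 0 *\<^sub>R w) v = (h - 0) * f'' (x + s *\<^sub>R v + t *\<^sub>R w) w"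
  proof (rule MVT2[OF \<open>0 < h\<close>])
    fix t assume t: "0 \<le> t" "t \<le> h"
    have "((\<lambda>t. f' (x + s *\<^sub>R v + t *\<^sub>R w) v) has_derivative (\<lambda>r. f'' (x + s *\<^sub>R v + t *\<^sub>R w) (r *\<^sub>R w))) (at t)"
    proof -
      have "((\<lambda>t. x + s *\<^sub>R v + t *\<^sub>R w) has_derivative (\<lambda>r. r *\<^sub>R w)) (at t)"
        by (auto intro!: derivative_eq_intros)
      from has_derivative_compose[OF this f'[OF _ _ t, of s]] s show ?thesis by simp
    qed
    then show "((\<lambda>t. f' (x + s *\<^sub>R v + t *\<^sub>R w) v) has_real_derivative f'' (x + s *\<^sub>R v + t *\<^sub>R w) w) (at t)"
      unfolding has_field_derivative_def
      by (rule has_derivative_eq_rhs) (use lin s t in \<open>auto simp: linear_cmul\<close>)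
  qed
  then obtain t where "0 < t" "t < h"
    "f' (x + s *\<^sub>R v + h *\<^sub>R w) v - f' (x + s *\<^sub>R v + 0 *\<^sub>R w) v = h * f'' (x + s *\<^sub>R v + t *\<^sub>R w) w" by auto
  with s gs show ?thesis
    by (intro exI[of _ s] exI[of _ t]) (auto simp: g_def algebra_simps)
qed

lemma parallelogram_limit:
  fixes F :: "'a::real_normed_vector \<Rightarrow> real"
  assumes "isCont F x" "\<And>n. 0 < s n \<and> s n < inverse (real (Suc n))" "\<And>n. 0 < t n \<and> t n < inverse (real (Suc n))"
  shows "(\<lambda>n. F (x + s n *\<^sub>R v + t n *\<^sub>R w)) \<longlonglongrightarrow> F x"
proof -
  have "r \<longlonglongrightarrow> 0" if "\<And>n. 0 < r n \<and> r n < inverse (real (Suc n))" for r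
  proof (rule tendsto_sandwich[OF _ _ tendsto_const LIMSEQ_inverse_real_of_nat])
    show "\<forall>\<^sub>F n in sequentially. 0 \<le> r n" "\<forall>\<^sub>F n in sequentially. r n \<le> inverse (real (Suc n))"
      using that by (simp_all add: less_imp_le del: of_nat_Suc)
  qed
  from this[of s] this[of t] have "s \<longlonglongrightarrow> 0" "t \<longlonglongrightarrow> 0" using assms(2,3) by blast+
  then have "(\<lambda>n. x + s n *\<^sub>R v + t n *\<^sub>R w) \<longlonglongrightarrow> x + 0 *\<^sub>R v + 0 *\<^sub>R w"
    by (intro tendsto_intros)
  then show ?thesis
    using isCont_tendsto_compose[OF assms(1)] by simp
qed

lemma second_difference_smooth:
  fixes f :: "'a::real_normed_vector \<Rightarrow> real"
  assumes f: "smooth_on S f" and "0 < h"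
    and S: "\<And>s t. 0 \<le> s \<Longrightarrow> s \<le> h \<Longrightarrow> 0 \<le> t \<Longrightarrow> t \<le> h \<Longrightarrow> x + s *\<^sub>R v + t *\<^sub>R w \<in> S"
  shows "\<exists>s t. 0 < s \<and> s < h \<and> 0 < t \<and> t < h \<and>
    f (x + h *\<^sub>R v + h *\<^sub>R w) - f (x + h *\<^sub>R v) - f (x + h *\<^sub>R w) + f x =
      h * (h * frechet_derivative (\<lambda>y. frechet_derivative f (at y) v) (at (x + s *\<^sub>R v + t *\<^sub>R w)) w)"
  by (rule second_difference_mvt[where f' = "\<lambda>y. frechet_derivative f (at y)"
        and f'' = "\<lambda>y. frechet_derivative (\<lambda>y. frechet_derivative f (at y) v) (at y)", OF \<open>0 < h\<close>
        smooth_on_has_derivative[OF f S] smooth_on_has_derivative[OF smooth_on_derivative[OF f] S]])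

text \<open>The second difference over a parallelogram does not change when its sides are exchanged. Divided
by the square of the scale it is a value of one mixed derivative, and also of the other, at points that
converge to \<open>x\<close>.\<close>
lemma smooth_on_second_derivative_symmetric:
  fixes f :: "'a::real_normed_vector \<Rightarrow> real"
  assumes S: "open S" "x \<in> S" and f: "smooth_on S f"
  shows "frechet_derivative (\<lambda>y. frechet_derivative f (at y) v) (at x) w =
         frechet_derivative (\<lambda>y. frechet_derivative f (at y) w) (at x) v"
proof -
  let ?D = "\<lambda>v y. frechet_derivative f (at y) v"
  let ?DD = "\<lambda>v w y. frechet_derivative (?D v) (at y) w"
  obtain e where e: "0 < e" "ball x e \<subseteq> S" using S openE by blast
  have pos: "norm v + norm w + 1 > 0" by (simp add: add_nonneg_pos)
  \<comment> \<open>Within this scale the parallelogram spanned by \<open>v\<close> and \<open>w\<close> stays in the ball; the summand \<open>1\<close>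
    covers the case \<open>v = w = 0\<close>.\<close>
  define d where "d = e / (norm v + norm w + 1)"
  have d: "0 < d" using e(1) pos by (simp add: d_def)
  have inS: "x + s *\<^sub>R v + t *\<^sub>R w \<in> S" if "0 \<le> s" "s < d" "0 \<le> t" "t < d" for s t
  proof -
    have "norm (s *\<^sub>R v + t *\<^sub>R w) \<le> s * norm v + t * norm w"
      using norm_triangle_ineq[of "s *\<^sub>R v" "t *\<^sub>R w"] that by simp
    also have "\<dots> \<le> d * norm v + d * norm w"
      using that by (intro add_mono mult_right_mono) auto
    also have "\<dots> < d * (norm v + norm w + 1)" using d by (simp add: algebra_simps)
    also have "\<dots> = e" using pos by (simp add: d_def)
    finally have "dist x (x + s *\<^sub>R v + t *\<^sub>R w) < e"
      by (simp add: dist_norm norm_minus_commute add.assoc add.commute)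
    then show ?thesis using e(2) by auto
  qed
  obtain N where N: "\<And>n. n \<ge> N \<Longrightarrow> inverse (real (Suc n)) < d"
    using order_tendstoD(2)[OF LIMSEQ_inverse_real_of_nat d] by (auto simp: eventually_sequentially)
  define h where "h n = inverse (real (Suc (n + N)))" for n
  let ?Delta = "\<lambda>n. f (x + h n *\<^sub>R v + h n *\<^sub>R w) - f (x + h n *\<^sub>R v) - f (x + h n *\<^sub>R w) + f x"
  have h: "h n < d" "0 < h n" "h n \<le> inverse (real (Suc n))" for n
    using N[of "n + N"] by (auto simp: h_def le_imp_inverse_le)
  have "\<forall>n. \<exists>s t. 0 < s \<and> s < h n \<and> 0 < t \<and> t < h n \<and>
      ?Delta n = h n * (h n * ?DD v w (x + s *\<^sub>R v + t *\<^sub>R w))"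
    by (rule allI, rule second_difference_smooth[OF f h(2)], rule inS)
      (auto intro: order_le_less_trans[OF _ h(1)])
  then obtain s t where st: "\<And>n. 0 < s n \<and> s n < h n \<and> 0 < t n \<and> t n < h n \<and>
      ?Delta n = h n * (h n * ?DD v w (x + s n *\<^sub>R v + t n *\<^sub>R w))" by metis
  have inS': "x + s *\<^sub>R w + t *\<^sub>R v \<in> S" if "0 \<le> s" "s < d" "0 \<le> t" "t < d" for s t
    using inS[OF that(3,4,1,2)] by (simp add: algebra_simps)
  have "\<forall>n. \<exists>s t. 0 < s \<and> s < h n \<and> 0 < t \<and> t < h n \<and>
      f (x + h n *\<^sub>R w + h n *\<^sub>R v) - f (x + h n *\<^sub>R w) - f (x + h n *\<^sub>R v) + f x
       = h n * (h n * ?DD w v (x + s *\<^sub>R w + t *\<^sub>R v))"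
    by (rule allI, rule second_difference_smooth[OF f h(2)], rule inS')
      (auto intro: order_le_less_trans[OF _ h(1)])
  then obtain s' t' where st': "\<And>n. 0 < s' n \<and> s' n < h n \<and> 0 < t' n \<and> t' n < h n \<and>
      f (x + h n *\<^sub>R w + h n *\<^sub>R v) - f (x + h n *\<^sub>R w) - f (x + h n *\<^sub>R v) + f x
       = h n * (h n * ?DD w v (x + s' n *\<^sub>R w + t' n *\<^sub>R v))" by metis
  have comm: "?Delta n = f (x + h n *\<^sub>R w + h n *\<^sub>R v) - f (x + h n *\<^sub>R w) - f (x + h n *\<^sub>R v) + f x" for n
    by (simp add: algebra_simps)
  have eq: "?DD v w (x + s n *\<^sub>R v + t n *\<^sub>R w) = ?DD w v (x + s' n *\<^sub>R w + t' n *\<^sub>R v)" for n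
  proof -
    have "h n * (h n * ?DD v w (x + s n *\<^sub>R v + t n *\<^sub>R w)) = h n * (h n * ?DD w v (x + s' n *\<^sub>R w + t' n *\<^sub>R v))"
      using st[of n] st'[of n] comm[of n] by metis
    then show ?thesis using h(2)[of n] by simp
  qed
  have bounds: "0 < s n \<and> s n < inverse (real (Suc n))" "0 < t n \<and> t n < inverse (real (Suc n))"
      "0 < s' n \<and> s' n < inverse (real (Suc n))" "0 < t' n \<and> t' n < inverse (real (Suc n))" for n
    using st[of n] st'[of n] h(3)[of n] by linarith+
  have cont: "isCont (?DD v w) x" for v w
    using smooth_onD[OF smooth_on_derivative[OF smooth_on_derivative[OF f]] S(2)]
    by (rule differentiable_imp_continuous_within)
  have "(\<lambda>n. ?DD v w (x + s n *\<^sub>R v + t n *\<^sub>R w)) \<longlonglongrightarrow> ?DD v w x"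
    by (rule parallelogram_limit[OF cont bounds(1,2)])
  moreover have "(\<lambda>n. ?DD w v (x + s' n *\<^sub>R w + t' n *\<^sub>R v)) \<longlonglongrightarrow> ?DD w v x"
    by (rule parallelogram_limit[OF cont bounds(3,4)])
  ultimately show ?thesis
    unfolding eq by (rule LIMSEQ_unique)
qed

section \<open>Alternating forms on three-space\<close>

unbundle cross3_syntax

text \<open>The covectors of pure degree in coordinates. Two-forms are stored as the vector \<open>b\<close> with
\<open>b \<bullet> (v \<times> w)\<close>, so that the exterior derivative and the wedge product become operations of vector
calculus.\<close>
fun cov0 :: "real \<Rightarrow> covec" where
  "cov0 r [] = r"
| "cov0 r (v # vs) = 0"

fun cov1 :: "real^3 \<Rightarrow> covec" where
  "cov1 a [v] = a \<bullet> v"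
| "cov1 a [] = 0"
| "cov1 a (v # w # vs) = 0"

fun cov2 :: "real^3 \<Rightarrow> covec" where
  "cov2 b [v, w] = b \<bullet> (v \<times> w)"
| "cov2 b [] = 0"
| "cov2 b [v] = 0"
| "cov2 b (u # v # w # vs) = 0"

fun cov3 :: "real \<Rightarrow> covec" where
  "cov3 r [u, v, w] = r * (u \<bullet> (v \<times> w))"
| "cov3 r [] = 0"
| "cov3 r [u] = 0"
| "cov3 r [u, v] = 0"
| "cov3 r (u # v # w # z # vs) = 0"

lemma shuffle_sign_Sigma:
  "shuffle_sign I n = (-1) ^ card (Sigma (I \<inter> {..<n}) (\<lambda>i. {..<i} - I))"
  unfolding shuffle_sign_def by (rule arg_cong[where f = "\<lambda>A. (-1) ^ card A"]) auto

lemma shuffle_sign_sum: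
  "shuffle_sign I n = (-1) ^ (\<Sum>i\<in>I \<inter> {..<n}. card ({..<i} - I))"
  by (simp add: shuffle_sign_Sigma)

lemma shuffle_sign_insert_0: "shuffle_sign (insert 0 (Suc ` I)) (Suc n) = shuffle_sign I n"
proof -
  have *: "{..<Suc i} - insert 0 (Suc ` I) = Suc ` ({..<i} - I)" for i
    by (auto simp: lessThan_Suc_eq_insert_0)
  have "insert 0 (Suc ` I) \<inter> {..<Suc n} = insert 0 (Suc ` (I \<inter> {..<n}))" by auto
  then have "(\<Sum>i\<in>insert 0 (Suc ` I) \<inter> {..<Suc n}. card ({..<i} - insert 0 (Suc ` I)))
      = (\<Sum>i\<in>I \<inter> {..<n}. card ({..<i} - I))"
    by (simp add: sum.reindex * card_image)
  then show ?thesis by (simp only: shuffle_sign_sum)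
qed

lemma shuffle_sign_Suc:
  assumes "I \<subseteq> {..<n}"
  shows "shuffle_sign (Suc ` I) (Suc n) = (-1) ^ card I * shuffle_sign I n"
proof -
  have *: "card ({..<Suc i} - Suc ` I) = Suc (card ({..<i} - I))" for i
  proof -
    have "{..<Suc i} - Suc ` I = insert 0 (Suc ` ({..<i} - I))"
      by (auto simp: lessThan_Suc_eq_insert_0)
    then show ?thesis by (simp add: card_image)
  qed
  have "Suc ` I \<inter> {..<Suc n} = Suc ` I" "I \<inter> {..<n} = I" using assms by auto
  then have "(\<Sum>i\<in>Suc ` I \<inter> {..<Suc n}. card ({..<i} - Suc ` I))
      = card I + (\<Sum>i\<in>I \<inter> {..<n}. card ({..<i} - I))"
    by (simp add: sum.reindex * sum.distrib sum_Suc)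
  then show ?thesis by (simp only: shuffle_sign_sum power_add)
qed

lemma wedge_at_Nil: "wedge_at \<alpha> \<beta> [] = \<alpha> [] * \<beta> []"
  by (simp add: wedge_at_def shuffle_sign_Sigma)

text \<open>The first argument goes either to the first factor, where it creates no inversion, or to the
second, where it is overtaken by every argument of the first factor. This evaluates the shuffle sum
recursively.\<close>
lemma wedge_at_Cons:
  "wedge_at \<alpha> \<beta> (v # vs) = wedge_at (\<lambda>ws. \<alpha> (v # ws)) \<beta> vs
     + wedge_at (\<lambda>ws. (-1) ^ length ws * \<alpha> ws) (\<lambda>ws. \<beta> (v # ws)) vs"
proof -
  let ?n = "length vs"
  let ?f = "\<lambda>I. shuffle_sign I (Suc ?n) * \<alpha> (nths (v # vs) I) * \<beta> (nths (v # vs) (- I))"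
  have Pow: "Pow {..<Suc ?n} = insert 0 ` image Suc ` Pow {..<?n} \<union> image Suc ` Pow {..<?n}"
    by (simp add: lessThan_Suc_eq_insert_0 Pow_insert image_Pow_surj Un_commute)
  have inj: "inj_on (image Suc) A" "inj_on (\<lambda>I. insert 0 (Suc ` I)) A" for A
    by (auto simp: inj_on_def inj_image_eq_iff insert_eq_iff)
  have "wedge_at \<alpha> \<beta> (v # vs) = (\<Sum>I\<in>insert 0 ` image Suc ` Pow {..<?n}. ?f I) + (\<Sum>I\<in>image Suc ` Pow {..<?n}. ?f I)"
    unfolding wedge_at_def list.size add_0_right add_Suc_right Pow by (intro sum.union_disjoint) auto
  also have "(\<Sum>I\<in>insert 0 ` image Suc ` Pow {..<?n}. ?f I) = (\<Sum>I\<in>Pow {..<?n}. ?f (insert 0 (Suc ` I)))"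
    by (simp add: image_image sum.reindex[OF inj(2)])
  also have "\<dots> = wedge_at (\<lambda>ws. \<alpha> (v # ws)) \<beta> vs"
    unfolding wedge_at_def
    by (intro sum.cong refl) (simp add: shuffle_sign_insert_0 nths_Cons Compl_eq inj_image_mem_iff)
  also have "(\<Sum>I\<in>image Suc ` Pow {..<?n}. ?f I) = (\<Sum>I\<in>Pow {..<?n}. ?f (Suc ` I))"
    by (simp add: sum.reindex[OF inj(1)])
  also have "\<dots> = wedge_at (\<lambda>ws. (-1) ^ length ws * \<alpha> ws) (\<lambda>ws. \<beta> (v # ws)) vs"
    unfolding wedge_at_def
  proof (intro sum.cong refl)
    fix I assume I: "I \<in> Pow {..<?n}"
    then have "{i. i < ?n \<and> i \<in> I} = I" by auto
    then have "length (nths vs I) = card I" by (simp add: length_nths)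
    then show "?f (Suc ` I) = shuffle_sign I ?n * ((-1) ^ length (nths vs I) * \<alpha> (nths vs I)) * \<beta> (v # nths vs (- I))"
      using I by (simp add: shuffle_sign_Suc nths_Cons Compl_eq inj_image_mem_iff image_iff[of 0])
  qed
  finally show ?thesis .
qed

lemma wedge_at_2:
  "wedge_at \<alpha> \<beta> [v, w] = \<alpha> [] * \<beta> [v, w] + \<alpha> [v] * \<beta> [w] - \<alpha> [w] * \<beta> [v] + \<alpha> [v, w] * \<beta> []"
  by (simp add: wedge_at_Cons wedge_at_Nil)

lemma wedge_at_3:
  "wedge_at \<alpha> \<beta> [u, v, w] =
     \<alpha> [] * \<beta> [u, v, w] + \<alpha> [u] * \<beta> [v, w] - \<alpha> [v] * \<beta> [u, w] + \<alpha> [w] * \<beta> [u, v]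
     + \<alpha> [u, v] * \<beta> [w] - \<alpha> [u, w] * \<beta> [v] + \<alpha> [v, w] * \<beta> [u] + \<alpha> [u, v, w] * \<beta> []"
  by (simp add: wedge_at_Cons wedge_at_Nil)

lemma cov_eq_0:
  "length vs \<noteq> 0 \<Longrightarrow> cov0 r vs = 0" "length vs \<noteq> 1 \<Longrightarrow> cov1 a vs = 0"
  "length vs \<noteq> 2 \<Longrightarrow> cov2 b vs = 0" "length vs \<noteq> 3 \<Longrightarrow> cov3 r vs = 0"
  subgoal by (cases "(r, vs)" rule: cov0.cases) auto
  subgoal by (cases "(a, vs)" rule: cov1.cases) auto
  subgoal by (cases "(b, vs)" rule: cov2.cases) auto
  subgoal by (cases "(r, vs)" rule: cov3.cases) auto
  done

text \<open>A shuffle distributes all arguments, so the degrees of the factors add up.\<close>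
lemma wedge_at_length:
  assumes "\<And>ws. length ws \<noteq> k \<Longrightarrow> \<alpha> ws = 0" "\<And>ws. length ws \<noteq> l \<Longrightarrow> \<beta> ws = 0" "length vs \<noteq> k + l"
  shows "wedge_at \<alpha> \<beta> vs = 0"
proof -
  have "length (nths vs I) + length (nths vs (- I)) = length vs" for I
  proof -
    have "card {i. i < length vs \<and> i \<in> I} + card {i. i < length vs \<and> i \<in> - I}
        = card ({i. i < length vs \<and> i \<in> I} \<union> {i. i < length vs \<and> i \<in> - I})"
      by (intro card_Un_disjoint[symmetric]) auto
    also have "{i. i < length vs \<and> i \<in> I} \<union> {i. i < length vs \<and> i \<in> - I} = {..<length vs}" by auto
    finally show ?thesis by (simp add: length_nths)
  qed
  then have "\<alpha> (nths vs I) = 0 \<or> \<beta> (nths vs (- I)) = 0" for I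
    using assms by metis
  then show ?thesis
    unfolding wedge_at_def by (intro sum.neutral) auto
qed

lemma length_2_conv: "length vs = 2 \<longleftrightarrow> (\<exists>v w. vs = [v, w])"
  and length_3_conv: "length vs = 3 \<longleftrightarrow> (\<exists>u v w. vs = [u, v, w])"
  by (auto simp: numeral_eq_Suc length_Suc_conv)

lemma wedge_at_cov1_cov1: "wedge_at (cov1 a) (cov1 b) = cov2 (a \<times> b)"
proof
  fix vs show "wedge_at (cov1 a) (cov1 b) vs = cov2 (a \<times> b) vs"
  proof (cases "length vs = 2")
    case True
    then show ?thesis by (auto simp: length_2_conv wedge_at_2 dot_cross)
  next
    case False
    then show ?thesis using wedge_at_length[of 1 "cov1 a" 1 "cov1 b"] by (simp add: cov_eq_0)
  qed
qed

lemma cov1_wedge_2form: "(a \<bullet> u) * (b \<bullet> (v \<times> w)) - (a \<bullet> v) * (b \<bullet> (u \<times> w)) + (a \<bullet> w) * (b \<bullet> (u \<times> v))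
    = (a \<bullet> b) * (u \<bullet> (v \<times> w))"
  by (simp add: cross3_simps)

lemma wedge_at_cov1_cov2: "wedge_at (cov1 a) (cov2 b) = cov3 (a \<bullet> b)"
proof
  fix vs show "wedge_at (cov1 a) (cov2 b) vs = cov3 (a \<bullet> b) vs"
  proof (cases "length vs = 3")
    case True
    then show ?thesis by (auto simp: length_3_conv wedge_at_3 cov1_wedge_2form)
  next
    case False
    then show ?thesis using wedge_at_length[of 1 "cov1 a" 2 "cov2 b"] by (simp add: cov_eq_0)
  qed
qed

lemma wedge_at_unit: "wedge_at \<alpha> (cov0 1) = \<alpha>"
proof
  fix vs
  have "wedge_at \<alpha> (cov0 1) vs = (\<Sum>I\<in>Pow {..<length vs}. if I = {..<length vs} then \<alpha> vs else 0)"
    unfolding wedge_at_def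
  proof (rule sum.cong[OF refl])
    fix I assume I: "I \<in> Pow {..<length vs}"
    have *: "cov0 1 ws = (if ws = [] then 1 else 0)" for ws by (cases ws) auto
    have "nths vs (- I) = [] \<longleftrightarrow> {i. i < length vs \<and> i \<in> - I} = {}"
      by (simp flip: length_0_conv add: length_nths)
    also have "\<dots> \<longleftrightarrow> I = {..<length vs}" using I by auto
    finally have "nths vs (- I) = [] \<longleftrightarrow> I = {..<length vs}" .
    moreover have "shuffle_sign {..<length vs} (length vs) = 1"
      by (simp add: shuffle_sign_Sigma) 
    ultimately show "shuffle_sign I (length vs) * \<alpha> (nths vs I) * cov0 1 (nths vs (- I)) =
        (if I = {..<length vs} then \<alpha> vs else 0)"
      unfolding * by (auto simp: nths_all)
  qed
  also have "\<dots> = \<alpha> vs" by simp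
  finally show "wedge_at \<alpha> (cov0 1) vs = \<alpha> vs" .
qed

lemma wedge_at_zero: "wedge_at 0 \<beta> = 0" "wedge_at \<alpha> 0 = 0"
  by (auto simp: wedge_at_def fun_eq_iff)

lemma Alt_zero: "0 \<in> Alt"
  by (simp add: Alt_def linear_zero)

lemma linear_cov_slots:
  "linear (\<lambda>v. a \<bullet> v)" "linear (\<lambda>v. b \<bullet> (v \<times> w))" "linear (\<lambda>v. b \<bullet> (w \<times> v))"
  "linear (\<lambda>u. r * (u \<bullet> (v \<times> w)))" "linear (\<lambda>v. r * (u \<bullet> (v \<times> w)))" "linear (\<lambda>w. r * (u \<bullet> (v \<times> w)))"
  by (auto intro!: linearI simp: inner_add_right inner_add_left cross_add_left cross_add_right
      cross_mult_left cross_mult_right algebra_simps)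

lemma cov_Alt: "cov0 r \<in> Alt" "cov1 a \<in> Alt" "cov2 b \<in> Alt" "cov3 r \<in> Alt"
proof -
  have const: "linear (\<lambda>w. \<alpha> (vs[i := w]))" if "length vs \<noteq> k" "\<And>ws. length ws \<noteq> k \<Longrightarrow> \<alpha> ws = 0"
    for \<alpha> :: covec and vs k i using that by (simp add: linear_zero)
  have "linear (\<lambda>w. cov0 r (vs[i := w]))" if "i < length vs" for vs i
    by (rule const[of _ 0]) (use that in \<open>auto simp: cov_eq_0\<close>)
  moreover have "\<not> distinct vs \<Longrightarrow> cov0 r vs = 0" for vs
    by (cases vs) auto
  ultimately show "cov0 r \<in> Alt" by (auto simp: Alt_def)
  have "linear (\<lambda>w. cov1 a (vs[i := w]))" if "i < length vs" for vs i
  proof (cases "length vs = 1")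
    case True
    then show ?thesis using that by (auto simp: length_Suc_conv linear_cov_slots)
  next
    case False
    then show ?thesis by (rule const) (simp add: cov_eq_0)
  qed
  moreover have "\<not> distinct vs \<Longrightarrow> cov1 a vs = 0" for vs
    by (cases "length vs = 1") (auto simp: length_Suc_conv cov_eq_0)
  ultimately show "cov1 a \<in> Alt" by (auto simp: Alt_def)
  have "linear (\<lambda>w. cov2 b (vs[i := w]))" if "i < length vs" for vs i
  proof (cases "length vs = 2")
    case True
    then show ?thesis using that
      by (auto simp: length_2_conv linear_cov_slots less_Suc_eq)
  next
    case False
    then show ?thesis by (rule const) (simp add: cov_eq_0)
  qed
  moreover have "\<not> distinct vs \<Longrightarrow> cov2 b vs = 0" for vs
    by (cases "length vs = 2") (auto simp: length_2_conv cov_eq_0)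
  ultimately show "cov2 b \<in> Alt" by (auto simp: Alt_def)
  have "linear (\<lambda>w. cov3 r (vs[i := w]))" if "i < length vs" for vs i
  proof (cases "length vs = 3")
    case True
    then show ?thesis using that
      by (auto simp: length_3_conv linear_cov_slots less_Suc_eq)
  next
    case False
    then show ?thesis by (rule const) (simp add: cov_eq_0)
  qed
  moreover have "\<not> distinct vs \<Longrightarrow> cov3 r vs = 0" for vs
    by (cases "length vs = 3") (auto simp: length_3_conv cov_eq_0 dot_cross_self)
  ultimately show "cov3 r \<in> Alt" by (auto simp: Alt_def)
qed

abbreviation e :: "3 \<Rightarrow> real^3" where "e i \<equiv> axis i 1"

lemma e_nth [simp]: "e i $ j = (if i = j then 1 else 0)"
  by (simp add: axis_def)

lemma vec3_expansion: "v = v$1 *\<^sub>R e 1 + v$2 *\<^sub>R e 2 + v$3 *\<^sub>R e 3" for v :: "real^3"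
  by (simp add: vec_eq_iff forall_3 axis_def)

lemma linear_vec3_expansion:
  assumes "linear L"
  shows "L v = v$1 *\<^sub>R L (e 1) + v$2 *\<^sub>R L (e 2) + v$3 *\<^sub>R L (e 3)"
  by (subst vec3_expansion[of v]) (simp only: linear_add[OF assms] linear_cmul[OF assms])

lemma Alt_linear:
  assumes "\<alpha> \<in> Alt"
  shows "linear (\<lambda>v. \<alpha> [v])" "linear (\<lambda>v. \<alpha> [v, w])" "linear (\<lambda>w. \<alpha> [v, w])"
    "linear (\<lambda>u. \<alpha> [u, v, w])" "linear (\<lambda>v. \<alpha> [u, v, w])" "linear (\<lambda>w. \<alpha> [u, v, w])"
proof -
  have *: "linear (\<lambda>w. \<alpha> (vs[i := w]))" if "i < length vs" for vs i
    using assms that by (auto simp: Alt_def)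
  show "linear (\<lambda>v. \<alpha> [v])" "linear (\<lambda>v. \<alpha> [v, w])" "linear (\<lambda>w. \<alpha> [v, w])"
    "linear (\<lambda>u. \<alpha> [u, v, w])" "linear (\<lambda>v. \<alpha> [u, v, w])" "linear (\<lambda>w. \<alpha> [u, v, w])"
    using *[of 0 "[0]"] *[of 0 "[0, w]"] *[of 1 "[v, 0]"]
      *[of 0 "[0, v, w]"] *[of 1 "[u, 0, w]"] *[of 2 "[u, v, 0]"] by simp_all
qed

lemma alternating_bilinear_swap:
  fixes A :: "real^3 \<Rightarrow> real^3 \<Rightarrow> real"
  assumes "\<And>w. linear (\<lambda>v. A v w)" "\<And>v. linear (A v)" "\<And>v. A v v = 0"
  shows "A w v = - A v w"
proof -
  have "A (v + w) (v + w) = A v v + A v w + (A w v + A w w)"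
    by (simp add: linear_add[OF assms(1)] linear_add[OF assms(2)])
  then show ?thesis by (simp add: assms(3))
qed

lemma alternating_bilinear_cross:
  fixes A :: "real^3 \<Rightarrow> real^3 \<Rightarrow> real"
  assumes "\<And>w. linear (\<lambda>v. A v w)" "\<And>v. linear (A v)" "\<And>v. A v v = 0"
  shows "A v w = vector [A (e 2) (e 3), A (e 3) (e 1), A (e 1) (e 2)] \<bullet> (v \<times> w)"
proof -
  note swap = alternating_bilinear_swap[of A, OF assms]
  have left: "A v y = v$1 * A (e 1) y + v$2 * A (e 2) y + v$3 * A (e 3) y" for y
    using linear_vec3_expansion[OF assms(1), of v y] by simp
  have right: "A x w = w$1 * A x (e 1) + w$2 * A x (e 2) + w$3 * A x (e 3)" for x
    using linear_vec3_expansion[OF assms(2), of x w] by simp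
  show ?thesis
    unfolding left right
    by (simp add: assms(3) inner_vec_def sum_3 cross_components
        swap[of "e 2" "e 1"] swap[of "e 3" "e 2"] swap[of "e 1" "e 3"] algebra_simps)
qed

lemma Alt_nondistinct: "\<alpha> \<in> Alt \<Longrightarrow> \<not> distinct vs \<Longrightarrow> \<alpha> vs = 0"
  by (auto simp: Alt_def)

definition vec1 :: "covec \<Rightarrow> real^3" where
  "vec1 \<alpha> = (\<chi> i. \<alpha> [e i])"

definition vec2 :: "covec \<Rightarrow> real^3" where
  "vec2 \<alpha> = vector [\<alpha> [e 2, e 3], \<alpha> [e 3, e 1], \<alpha> [e 1, e 2]]"

lemma Alt_1: "\<alpha> \<in> Alt \<Longrightarrow> \<alpha> [v] = vec1 \<alpha> \<bullet> v"
  by (subst linear_vec3_expansion[OF Alt_linear(1)])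
    (simp_all add: vec1_def inner_vec_def sum_3)

lemma Alt_2: "\<alpha> \<in> Alt \<Longrightarrow> \<alpha> [v, w] = vec2 \<alpha> \<bullet> (v \<times> w)"
  unfolding vec2_def
  by (rule alternating_bilinear_cross[of "\<lambda>v w. \<alpha> [v, w]"]) (auto simp: Alt_linear Alt_nondistinct)

lemma Alt_3:
  assumes "\<alpha> \<in> Alt"
  shows "\<alpha> [u, v, w] = \<alpha> [e 1, e 2, e 3] * (u \<bullet> (v \<times> w))"
proof -
  have swap12: "\<alpha> [v, u, w] = - \<alpha> [u, v, w]" and swap23: "\<alpha> [u, w, v] = - \<alpha> [u, v, w]" for u v w
    by (rule alternating_bilinear_swap[of "\<lambda>v w. \<alpha> [u, v, w]" for u]
        alternating_bilinear_swap[of "\<lambda>u v. \<alpha> [u, v, w]" for w];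
        simp add: Alt_linear assms Alt_nondistinct)+
  have "\<alpha> [u, v, w] = vector [\<alpha> [u, e 2, e 3], \<alpha> [u, e 3, e 1], \<alpha> [u, e 1, e 2]] \<bullet> (v \<times> w)"
    by (rule alternating_bilinear_cross[of "\<lambda>v w. \<alpha> [u, v, w]"]) (auto simp: Alt_linear Alt_nondistinct assms)
  also have "vector [\<alpha> [u, e 2, e 3], \<alpha> [u, e 3, e 1], \<alpha> [u, e 1, e 2]] = \<alpha> [e 1, e 2, e 3] *\<^sub>R u"
  proof -
    have u: "\<alpha> [u, v, w] = u$1 * \<alpha> [e 1, v, w] + u$2 * \<alpha> [e 2, v, w] + u$3 * \<alpha> [e 3, v, w]" for v w
      using linear_vec3_expansion[OF Alt_linear(4)[OF assms], of u v w] by simp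
    have "\<alpha> [e 2, e 3, e 1] = \<alpha> [e 1, e 2, e 3]" "\<alpha> [e 3, e 1, e 2] = \<alpha> [e 1, e 2, e 3]"
      using swap12[of "e 2" "e 1" "e 3"] swap23[of "e 2" "e 3" "e 1"]
        swap12[of "e 3" "e 1" "e 2"] swap23[of "e 1" "e 3" "e 2"] by simp_all
    then show ?thesis
      unfolding u by (simp add: vec_eq_iff forall_3 Alt_nondistinct[OF assms])
  qed
  finally show ?thesis by simp
qed

text \<open>More than three vectors are dependent, so one of them is a combination of the others; expanding
it leaves only terms with a repeated argument.\<close>
lemma Alt_long:
  assumes "\<alpha> \<in> Alt" "length vs > 3"
  shows "\<alpha> vs = 0"
proof (cases "distinct vs")
  case True
  then have "card (set vs) > DIM(real^3)"
    using assms(2) by (simp add: distinct_card)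
  then have "dependent (set vs)" by (intro dependent_biggerset) simp
  then obtain a where a: "a \<in> set vs" "a \<in> span (set vs - {a})" by (auto simp: dependent_def)
  then obtain i where i: "i < length vs" "vs ! i = a" by (auto simp: in_set_conv_nth)
  have lin: "linear (\<lambda>w. \<alpha> (vs[i := w]))" using assms(1) i(1) by (auto simp: Alt_def)
  have "\<alpha> (vs[i := w]) = 0" if w: "w \<in> set vs - {a}" for w
  proof (rule Alt_nondistinct[OF assms(1)])
    obtain j where "j < length vs" "vs ! j = w" using w by (auto simp: in_set_conv_nth)
    then show "\<not> distinct (vs[i := w])"
      using w i by (metis DiffD2 length_list_update nth_eq_iff_index_eq nth_list_update_eq nth_list_update_neq singletonI)
  qed
  then have "\<alpha> (vs[i := a]) = 0" using linear_eq_0_on_span[OF lin _ a(2)] by blast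
  then show ?thesis using i by (metis list_update_id)
qed (rule Alt_nondistinct[OF assms(1)])

lemma list_cases_3:
  obtains "xs = []" | a where "xs = [a]" | a b where "xs = [a, b]" | a b c where "xs = [a, b, c]"
    | "length xs > 3"
  by (metis (no_types, opaque_lifting) One_nat_def Suc_lessI length_0_conv length_Suc_conv length_greater_0_conv numeral_3_eq_3)

lemma Alt_eqI:
  assumes "\<alpha> \<in> Alt" "\<beta> \<in> Alt" "\<alpha> [] = \<beta> []" "vec1 \<alpha> = vec1 \<beta>" "vec2 \<alpha> = vec2 \<beta>"
    "\<alpha> [e 1, e 2, e 3] = \<beta> [e 1, e 2, e 3]"
  shows "\<alpha> = \<beta>"
proof
  fix vs
  show "\<alpha> vs = \<beta> vs"
  proof (rule list_cases_3[of vs])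
    fix u v w assume "vs = [u, v, w]"
    then show ?thesis using Alt_3[OF assms(1)] Alt_3[OF assms(2)] assms(6) by metis
  qed (use assms in \<open>simp_all add: Alt_1 Alt_2 Alt_long\<close>)
qed

lemma Alt_swap2: "\<alpha> \<in> Alt \<Longrightarrow> \<alpha> [w, v] = - \<alpha> [v, w]"
  by (subst (1 2) Alt_2) (simp_all add: cross_skew[of w v])

section \<open>The Hodge star\<close>

text \<open>The defining equation of the Hodge star has at most one solution: wedging with the basis
covectors of every degree reads off all components.\<close>
lemma hodge_at_eqI:
  assumes "\<gamma> \<in> Alt"
    and "\<And>\<alpha> u v w. \<alpha> \<in> Alt \<Longrightarrow> wedge_at \<alpha> \<gamma> [u, v, w] = inner_at G \<alpha> \<beta> * volume_at G [u, v, w]"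
  shows "hodge_at G \<beta> = \<gamma>"
  unfolding hodge_at_def
proof (rule the_equality)
  show "\<gamma> \<in> Alt \<and> (\<forall>\<alpha>\<in>Alt. \<forall>vs. length vs = 3 \<longrightarrow> wedge_at \<alpha> \<gamma> vs = inner_at G \<alpha> \<beta> * volume_at G vs)"
    using assms by (auto simp: length_3_conv)
next
  fix \<eta> assume \<eta>: "\<eta> \<in> Alt \<and> (\<forall>\<alpha>\<in>Alt. \<forall>vs. length vs = 3 \<longrightarrow> wedge_at \<alpha> \<eta> vs = inner_at G \<alpha> \<beta> * volume_at G vs)"
  have eq: "wedge_at \<alpha> \<eta> [e 1, e 2, e 3] = wedge_at \<alpha> \<gamma> [e 1, e 2, e 3]" if "\<alpha> \<in> Alt" for \<alpha>
    using \<eta> assms(2) that by simp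
  show "\<eta> = \<gamma>"
  proof (rule Alt_eqI)
    show "\<eta> [e 1, e 2, e 3] = \<gamma> [e 1, e 2, e 3]"
      using eq[OF cov_Alt(1)[of 1]] by (simp add: wedge_at_3)
    show "vec2 \<eta> = vec2 \<gamma>"
      using eq[OF cov_Alt(2)[of "e 1"]] eq[OF cov_Alt(2)[of "e 2"]] eq[OF cov_Alt(2)[of "e 3"]]
        Alt_swap2[OF conjunct1[OF \<eta>], of "e 1" "e 3"] Alt_swap2[OF assms(1), of "e 1" "e 3"]
      by (simp add: wedge_at_3 vec2_def inner_axis_axis)
    show "vec1 \<eta> = vec1 \<gamma>"
      using eq[OF cov_Alt(3)[of "e 1"]] eq[OF cov_Alt(3)[of "e 2"]] eq[OF cov_Alt(3)[of "e 3"]]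
      by (simp add: wedge_at_3 vec1_def inner_axis_axis cross_basis vec_eq_iff forall_3)
    show "\<eta> [] = \<gamma> []"
      using eq[OF cov_Alt(4)[of 1]] by (simp add: wedge_at_3 cross_basis inner_axis_axis)
  qed (use \<eta> assms(1) in blast)+
qed

text \<open>This turns the index lists in the inner product into iterated sums.\<close>
lemma sum_lists_Suc:
  fixes f :: "'i::finite list \<Rightarrow> real"
  shows "(\<Sum>is | length is = Suc k. f is) = (\<Sum>i\<in>UNIV. \<Sum>is | length is = k. f (i # is))"
proof -
  have "{is :: 'i list. length is = Suc k} = (\<lambda>(i, is). i # is) ` (Sigma UNIV (\<lambda>_. {is. length is = k}))"
    by (auto simp: length_Suc_conv image_iff)
  moreover have "inj_on (\<lambda>(i :: 'i, is). i # is) (Sigma UNIV (\<lambda>_. {is. length is = k}))"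
    by (auto simp: inj_on_def)
  ultimately show ?thesis
    by (simp add: sum.reindex sum.cartesian_product case_prod_unfold)
qed

lemma inner_at_pure:
  assumes "\<And>ws. length ws \<noteq> k \<Longrightarrow> \<beta> ws = 0" "k \<le> 3"
  shows "inner_at G \<alpha> \<beta> = (\<Sum>is | length is = k. \<Sum>js | length js = k.
      (\<Prod>m<k. matrix_inv G $ (is ! m) $ (js ! m)) * \<alpha> (map e is) * \<beta> (map e js)) / fact k"
proof -
  let ?S = "\<lambda>k. (\<Sum>is | length is = k. \<Sum>js | length js = k.
      (\<Prod>m<k. matrix_inv G $ (is ! m) $ (js ! m)) * \<alpha> (map e is) * \<beta> (map e js)) / fact k"
  have "inner_at G \<alpha> \<beta> = (\<Sum>j\<le>3. if j = k then ?S j else 0)"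
    unfolding inner_at_def by (intro sum.cong refl) (auto simp: assms(1))
  then show ?thesis using assms(2) by (simp add: sum.delta)
qed

definition vol_density :: "real^3^3 \<Rightarrow> real" where
  "vol_density G = sqrt (det G)"

locale gram =
  fixes G :: "real^3^3"
  assumes sym: "transpose G = G" and det_pos: "det G > 0"
begin

abbreviation "H \<equiv> matrix_inv G"

lemma inverse_right: "G ** H = mat 1" and inverse_left: "H ** G = mat 1"
proof -
  obtain K where "G ** K = mat 1 \<and> K ** G = mat 1"
    using det_pos invertible_det_nz[of G] by (auto simp: invertible_def)
  then have "G ** H = mat 1 \<and> H ** G = mat 1"
    unfolding matrix_inv_def by (rule someI)
  then show "G ** H = mat 1" "H ** G = mat 1" by auto
qed

lemma H_sym: "transpose H = H"
proof -
  have "transpose H ** G = mat 1" by (metis inverse_right matrix_transpose_mul sym transpose_mat)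
  then have "transpose H ** G ** H = H" by (simp add: matrix_mul_lid)
  then show ?thesis by (simp add: inverse_right matrix_mul_rid flip: matrix_mul_assoc)
qed

lemma det_H: "det H = 1 / det G"
proof -
  have "det G * det H = 1" using arg_cong[OF inverse_right, of det] by (simp add: det_mul)
  then show ?thesis using det_pos by (simp add: field_simps)
qed

lemma GH: "G *v (H *v v) = v" and HG: "H *v (G *v v) = v"
  by (simp_all add: matrix_vector_mul_assoc inverse_left inverse_right)

lemma G_self_adjoint: "(G *v v) \<bullet> w = v \<bullet> (G *v w)"
  using dot_lmul_matrix[of v G w] by (simp add: sym flip: transpose_matrix_vector)

lemma H_self_adjoint: "(H *v v) \<bullet> w = v \<bullet> (H *v w)"
  using dot_lmul_matrix[of v H w] by (simp add: H_sym flip: transpose_matrix_vector)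

text \<open>The cofactor matrix of \<open>G\<close> is \<open>det G\<close> times its inverse.\<close>
lemma G_cross: "(G *v v) \<times> (G *v w) = det G *\<^sub>R (H *v (v \<times> w))"
proof -
  have "G *v ((G *v v) \<times> (G *v w)) = det G *\<^sub>R (v \<times> w)" using cross_matrix_mult[of G v w] by (simp add: sym)
  then have "H *v (G *v ((G *v v) \<times> (G *v w))) = H *v (det G *\<^sub>R (v \<times> w))" by simp
  then show ?thesis by (simp add: HG matrix_vector_mult_scaleR)
qed

lemma H_cross: "(H *v v) \<times> (H *v w) = (G *v (v \<times> w)) /\<^sub>R det G"
proof -
  have "H *v ((H *v v) \<times> (H *v w)) = det H *\<^sub>R (v \<times> w)" using cross_matrix_mult[of H v w] by (simp add: H_sym)
  then have "G *v (H *v ((H *v v) \<times> (H *v w))) = G *v (det H *\<^sub>R (v \<times> w))" by simp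
  then show ?thesis by (simp add: GH matrix_vector_mult_scaleR det_H inverse_eq_divide)
qed

lemma H_entry: "H $ i $ j = (H *v e i) $ j"
  using H_sym by (simp add: matrix_vector_mult_def axis_def vec_eq_iff transpose_def if_distrib cong: if_cong)

abbreviation "s \<equiv> vol_density G"

lemma s_pos: "s > 0" and s_square: "s * s = det G"
  using det_pos by (auto simp: vol_density_def)

lemma volume_at_3: "volume_at G [u, v, w] = s * (u \<bullet> (v \<times> w))"
  by (simp add: volume_at_def vol_density_def dot_cross_det)

lemma inner_at_cov0: "inner_at G \<alpha> (cov0 r) = \<alpha> [] * r"
  by (subst inner_at_pure[where k = 0]) (auto simp: cov_eq_0)

lemma inner_at_cov1: "inner_at G \<alpha> (cov1 a) = vec1 \<alpha> \<bullet> (H *v a)"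
proof -
  have "inner_at G \<alpha> (cov1 a) = (\<Sum>i\<in>UNIV. \<Sum>j\<in>UNIV. H $ i $ j * \<alpha> [e i] * a $ j)"
    by (simp add: inner_at_pure[OF cov_eq_0(2)] sum_lists_Suc inner_axis)
  also have "\<dots> = vec1 \<alpha> \<bullet> (H *v a)"
    by (simp add: vec1_def inner_vec_def matrix_vector_mult_def sum_3 algebra_simps)
  finally show ?thesis .
qed

lemma inner_at_cov2:
  assumes "\<alpha> \<in> Alt"
  shows "inner_at G \<alpha> (cov2 b) = vec2 \<alpha> \<bullet> (G *v b) / det G"
proof -
  have *: "(\<Sum>j\<in>UNIV. \<Sum>k\<in>UNIV. x $ j * y $ k * (b \<bullet> (e j \<times> e k))) = b \<bullet> (x \<times> y)" for x y :: "real^3"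
    by (simp add: sum_3 cross_basis inner_axis cross_components inner_vec_def algebra_simps)
  have **: "(\<Sum>j\<in>UNIV. \<Sum>k\<in>UNIV. (x \<bullet> (e j \<times> e k)) * (y \<bullet> (e j \<times> e k))) = 2 * (x \<bullet> y)" for x y :: "real^3"
    by (simp add: sum_3 cross_basis inner_axis inner_vec_def algebra_simps)
  have "inner_at G \<alpha> (cov2 b) = (\<Sum>i\<in>UNIV. \<Sum>l\<in>UNIV. \<Sum>j\<in>UNIV. \<Sum>k\<in>UNIV.
      (H *v e i) $ j * (H *v e l) $ k * \<alpha> [e i, e l] * (b \<bullet> (e j \<times> e k))) / 2"
    by (simp add: inner_at_pure[OF cov_eq_0(3)] numeral_eq_Suc sum_lists_Suc H_entry mult.assoc)
  also have "\<dots> = (\<Sum>i\<in>UNIV. \<Sum>l\<in>UNIV. \<alpha> [e i, e l] *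
      (\<Sum>j\<in>UNIV. \<Sum>k\<in>UNIV. (H *v e i) $ j * (H *v e l) $ k * (b \<bullet> (e j \<times> e k)))) / 2"
    by (simp add: sum_distrib_left ac_simps)
  also have "\<dots> = (\<Sum>i\<in>UNIV. \<Sum>l\<in>UNIV. 1 / det G * ((vec2 \<alpha> \<bullet> (e i \<times> e l)) * ((G *v b) \<bullet> (e i \<times> e l)))) / 2"
  proof -
    have "\<alpha> [e i, e l] * (b \<bullet> ((H *v e i) \<times> (H *v e l)))
        = 1 / det G * ((vec2 \<alpha> \<bullet> (e i \<times> e l)) * ((G *v b) \<bullet> (e i \<times> e l)))" for i l
      by (simp add: H_cross Alt_2[OF assms] G_self_adjoint divide_inverse)
    then show ?thesis unfolding * by simp
  qed
  also have "\<dots> = vec2 \<alpha> \<bullet> (G *v b) / det G"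
    unfolding sum_distrib_left[symmetric] ** by simp
  finally show ?thesis .
qed

lemma inner_at_cov3:
  assumes "\<alpha> \<in> Alt"
  shows "inner_at G \<alpha> (cov3 r) = \<alpha> [e 1, e 2, e 3] * r / det G"
proof -
  define A where "A = \<alpha> [e 1, e 2, e 3]"
  have *: "(\<Sum>l\<in>UNIV. \<Sum>m\<in>UNIV. \<Sum>n\<in>UNIV. x $ l * y $ m * z $ n * (e l \<bullet> (e m \<times> e n))) = x \<bullet> (y \<times> z)" for x y z :: "real^3"
    by (simp add: sum_3 cross_basis inner_axis_axis cross_components inner_vec_def algebra_simps)
  have **: "(\<Sum>i\<in>UNIV. \<Sum>j\<in>UNIV. \<Sum>k\<in>UNIV. (e i \<bullet> (e j \<times> e k)) * (e i \<bullet> (e j \<times> e k))) = 6"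
    by (simp add: sum_3 cross_basis inner_axis_axis)
  have "inner_at G \<alpha> (cov3 r) = (\<Sum>i\<in>UNIV. \<Sum>j\<in>UNIV. \<Sum>k\<in>UNIV. \<Sum>l\<in>UNIV. \<Sum>m\<in>UNIV. \<Sum>n\<in>UNIV.
      (H *v e i) $ l * (H *v e j) $ m * (H *v e k) $ n * \<alpha> [e i, e j, e k] * (r * (e l \<bullet> (e m \<times> e n)))) / 6"
    by (simp add: inner_at_pure[OF cov_eq_0(4)] numeral_eq_Suc sum_lists_Suc H_entry mult.assoc)
  also have "\<dots> = (\<Sum>i\<in>UNIV. \<Sum>j\<in>UNIV. \<Sum>k\<in>UNIV. r * \<alpha> [e i, e j, e k] *
      (\<Sum>l\<in>UNIV. \<Sum>m\<in>UNIV. \<Sum>n\<in>UNIV. (H *v e i) $ l * (H *v e j) $ m * (H *v e k) $ n * (e l \<bullet> (e m \<times> e n)))) / 6"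
    by (simp add: sum_distrib_left ac_simps)
  also have "\<dots> = (\<Sum>i\<in>UNIV. \<Sum>j\<in>UNIV. \<Sum>k\<in>UNIV.
      r * A / det G * ((e i \<bullet> (e j \<times> e k)) * (e i \<bullet> (e j \<times> e k)))) / 6"
  proof -
    have "(H *v e i) \<bullet> ((H *v e j) \<times> (H *v e k)) = (e i \<bullet> (e j \<times> e k)) / det G" for i j k
      by (simp add: H_cross GH divide_inverse flip: G_self_adjoint)
    moreover have "\<alpha> [e i, e j, e k] = A * (e i \<bullet> (e j \<times> e k))" for i j k
      unfolding A_def by (rule Alt_3[OF assms])
    ultimately have "r * \<alpha> [e i, e j, e k] * ((H *v e i) \<bullet> ((H *v e j) \<times> (H *v e k)))
        = r * A / det G * ((e i \<bullet> (e j \<times> e k)) * (e i \<bullet> (e j \<times> e k)))" for i j k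
      by simp
    then show ?thesis unfolding * by simp
  qed
  also have "\<dots> = \<alpha> [e 1, e 2, e 3] * r / det G"
    unfolding sum_distrib_left[symmetric] ** by (simp add: A_def)
  finally show ?thesis .
qed

text \<open>In each degree, the wedge product with a general \<open>\<alpha>\<close> pairs the coefficient vectors, and the
volume form contributes the factor \<open>s\<close>; in degrees two and three one factor \<open>1 / det G = 1 / s\<^sup>2\<close> comes
from the inner product.\<close>
lemma hodge_at_cov0: "hodge_at G (cov0 r) = cov3 (s * r)"
  by (rule hodge_at_eqI) (simp_all add: cov_Alt wedge_at_3 inner_at_cov0 volume_at_3)

lemma hodge_at_cov1: "hodge_at G (cov1 a) = cov2 (s *\<^sub>R (H *v a))"
proof (rule hodge_at_eqI)
  fix \<alpha> :: covec and u v w assume "\<alpha> \<in> Alt"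
  then show "wedge_at \<alpha> (cov2 (s *\<^sub>R (H *v a))) [u, v, w] = inner_at G \<alpha> (cov1 a) * volume_at G [u, v, w]"
    using cov1_wedge_2form[of "vec1 \<alpha>" u "s *\<^sub>R (H *v a)" v w]
    by (simp add: wedge_at_3 inner_at_cov1 volume_at_3 Alt_1)
qed (rule cov_Alt)

lemma hodge_at_cov2: "hodge_at G (cov2 b) = cov1 ((G *v b) /\<^sub>R s)"
proof (rule hodge_at_eqI)
  fix \<alpha> :: covec and u v w assume \<alpha>: "\<alpha> \<in> Alt"
  have "wedge_at \<alpha> (cov1 ((G *v b) /\<^sub>R s)) [u, v, w] = (vec2 \<alpha> \<bullet> (G *v b)) / s * (u \<bullet> (v \<times> w))"
    using cov1_wedge_2form[of "(G *v b) /\<^sub>R s" u "vec2 \<alpha>" v w]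
    by (simp add: wedge_at_3 Alt_2[OF \<alpha>] inner_commute divide_inverse algebra_simps)
  also have "\<dots> = (vec2 \<alpha> \<bullet> (G *v b)) / (s * s) * (s * (u \<bullet> (v \<times> w)))"
    using s_pos by simp
  finally show "wedge_at \<alpha> (cov1 ((G *v b) /\<^sub>R s)) [u, v, w] = inner_at G \<alpha> (cov2 b) * volume_at G [u, v, w]"
    by (simp add: inner_at_cov2[OF \<alpha>] volume_at_3 s_square)
qed (rule cov_Alt)

lemma hodge_at_cov3: "hodge_at G (cov3 r) = cov0 (r / s)"
proof (rule hodge_at_eqI)
  fix \<alpha> :: covec and u v w assume \<alpha>: "\<alpha> \<in> Alt"
  have "wedge_at \<alpha> (cov0 (r / s)) [u, v, w] = \<alpha> [e 1, e 2, e 3] * r / (s * s) * (s * (u \<bullet> (v \<times> w)))"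
    using s_pos by (simp add: wedge_at_3) (subst Alt_3[OF \<alpha>], simp)
  then show "wedge_at \<alpha> (cov0 (r / s)) [u, v, w] = inner_at G \<alpha> (cov3 r) * volume_at G [u, v, w]"
    by (simp add: inner_at_cov3[OF \<alpha>] volume_at_3 s_square)
qed (rule cov_Alt)

end

section \<open>Gradient, rotation and divergence\<close>

lemma smooth_on_intros:
  assumes "open S"
  shows "\<And>f g :: 'a::real_normed_vector \<Rightarrow> real. smooth_on S f \<Longrightarrow> smooth_on S g \<Longrightarrow> smooth_on S (\<lambda>x. f x * g x)"
    and "\<And>(f :: 'a \<Rightarrow> real) (g :: 'a \<Rightarrow> 'b::real_normed_vector). smooth_on S f \<Longrightarrow> smooth_on S g \<Longrightarrow> smooth_on S (\<lambda>x. f x *\<^sub>R g x)"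
    and "\<And>(f :: 'a \<Rightarrow> 'c::real_inner) g. smooth_on S f \<Longrightarrow> smooth_on S g \<Longrightarrow> smooth_on S (\<lambda>x. f x \<bullet> g x)"
    and "\<And>f g. smooth_on S f \<Longrightarrow> smooth_on S g \<Longrightarrow> smooth_on S (\<lambda>x. f x \<times> g x)"
    and "\<And>(A :: 'a \<Rightarrow> real^'n^'m) g. smooth_on S A \<Longrightarrow> smooth_on S g \<Longrightarrow> smooth_on S (\<lambda>x. A x *v g x)"
  by (rule smooth_on_bilinear[OF assms]; (rule bounded_bilinear_mult bounded_bilinear_scaleR
        bounded_bilinear_inner bounded_bilinear_cross3 bounded_bilinear_matrix_vector | assumption))+

lemma frechet_derivative_bounded_linear:
  assumes "bounded_linear L" "f differentiable (at x)"
  shows "frechet_derivative (\<lambda>y. L (f y)) (at x) v = L (frechet_derivative f (at x) v)"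
  using frechet_derivative_at[OF bounded_linear.has_derivative[OF assms(1) assms(2)[unfolded frechet_derivative_works]]]
  by metis

lemma frechet_derivative_nth:
  "f differentiable (at x) \<Longrightarrow> frechet_derivative (\<lambda>y. f y $ i) (at x) v = frechet_derivative f (at x) v $ i"
  for f :: "'a::real_normed_vector \<Rightarrow> real^'n"
  using frechet_derivative_bounded_linear[OF bounded_linear_vec_nth] .

lemma frechet_derivative_add:
  "f differentiable (at x) \<Longrightarrow> g differentiable (at x) \<Longrightarrow>
    frechet_derivative (\<lambda>y. f y + g y) (at x) v = frechet_derivative f (at x) v + frechet_derivative g (at x) v"
  using frechet_derivative_at[OF has_derivative_add[of f _ "at x" g]] frechet_derivative_works by metis

lemma frechet_derivative_sum:
  "finite I \<Longrightarrow> (\<And>i. i \<in> I \<Longrightarrow> f i differentiable (at x)) \<Longrightarrow>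
    frechet_derivative (\<lambda>y. \<Sum>i\<in>I. f i y) (at x) v = (\<Sum>i\<in>I. frechet_derivative (f i) (at x) v)"
  by (induction I rule: finite_induct) (auto simp: frechet_derivative_add differentiable_sum)

lemma frechet_derivative_bilinear:
  assumes "bounded_bilinear p" "f differentiable (at x)" "g differentiable (at x)"
  shows "frechet_derivative (\<lambda>y. p (f y) (g y)) (at x) v =
    p (f x) (frechet_derivative g (at x) v) + p (frechet_derivative f (at x) v) (g x)"
  using frechet_derivative_at[OF bounded_bilinear.FDERIV[OF assms(1) assms(2)[unfolded frechet_derivative_works]
        assms(3)[unfolded frechet_derivative_works]]]
  by metis

lemma differentiable_bilinear:
  assumes "bounded_bilinear p" "f differentiable (at x)" "g differentiable (at x)"
  shows "(\<lambda>y. p (f y) (g y)) differentiable (at x)"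
  using bounded_bilinear.FDERIV[OF assms(1) assms(2)[unfolded frechet_derivative_works]
        assms(3)[unfolded frechet_derivative_works]]
  by (auto simp: differentiable_def)

lemma linear_frechet_derivative_vec3:
  fixes f :: "real^3 \<Rightarrow> 'b::real_normed_vector"
  assumes "f differentiable (at x)"
  shows "frechet_derivative f (at x) v = v$1 *\<^sub>R frechet_derivative f (at x) (e 1)
    + v$2 *\<^sub>R frechet_derivative f (at x) (e 2) + v$3 *\<^sub>R frechet_derivative f (at x) (e 3)"
  using linear_frechet_derivative[OF assms]
  by (subst vec3_expansion[of v]) (simp only: linear_add linear_cmul)

text \<open>These are the operators of the coordinate space with its standard inner product, not those of the
Riemannian metric.\<close>
definition grad :: "(real^3 \<Rightarrow> real) \<Rightarrow> real^3 \<Rightarrow> real^3" where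
  "grad f x = (\<chi> i. frechet_derivative f (at x) (e i))"

definition rot :: "(real^3 \<Rightarrow> real^3) \<Rightarrow> real^3 \<Rightarrow> real^3" where
  "rot a x = (\<Sum>i\<in>UNIV. e i \<times> frechet_derivative a (at x) (e i))"

definition dvg :: "(real^3 \<Rightarrow> real^3) \<Rightarrow> real^3 \<Rightarrow> real" where
  "dvg b x = (\<Sum>i\<in>UNIV. frechet_derivative b (at x) (e i) $ i)"

lemma grad_inner:
  assumes "f differentiable (at x)"
  shows "grad f x \<bullet> v = frechet_derivative f (at x) v"
  using linear_frechet_derivative_vec3[OF assms, of v] by (simp add: grad_def inner_vec_def sum_3 mult.commute)

lemma rot_inner_cross:
  assumes "a differentiable (at x)"
  shows "rot a x \<bullet> (v \<times> w) = frechet_derivative a (at x) v \<bullet> w - frechet_derivative a (at x) w \<bullet> v"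
  unfolding linear_frechet_derivative_vec3[OF assms, of v] linear_frechet_derivative_vec3[OF assms, of w]
  by (simp add: rot_def inner_vec_def sum_3 cross_components algebra_simps)

lemma dvg_triple:
  assumes "b differentiable (at x)"
  shows "dvg b x * (u \<bullet> (v \<times> w)) = frechet_derivative b (at x) u \<bullet> (v \<times> w)
    - frechet_derivative b (at x) v \<bullet> (u \<times> w) + frechet_derivative b (at x) w \<bullet> (u \<times> v)"
  unfolding linear_frechet_derivative_vec3[OF assms, of u] linear_frechet_derivative_vec3[OF assms, of v]
    linear_frechet_derivative_vec3[OF assms, of w]
  by (simp add: dvg_def inner_vec_def sum_3 cross_components algebra_simps)

lemma rot_add: "a differentiable (at x) \<Longrightarrow> b differentiable (at x) \<Longrightarrow> rot (\<lambda>y. a y + b y) x = rot a x + rot b x"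
  by (simp add: rot_def frechet_derivative_add cross_add_right sum.distrib)

lemma rot_scaleR: "a differentiable (at x) \<Longrightarrow> rot (\<lambda>y. r *\<^sub>R a y) x = r *\<^sub>R rot a x"
  by (simp add: rot_def frechet_derivative_bounded_linear[OF bounded_linear_scaleR_right] cross_mult_right scaleR_sum_right)

lemma rot_sum:
  "finite I \<Longrightarrow> (\<And>i. i \<in> I \<Longrightarrow> a i differentiable (at x)) \<Longrightarrow> rot (\<lambda>y. \<Sum>i\<in>I. a i y) x = (\<Sum>i\<in>I. rot (a i) x)"
  by (induction I rule: finite_induct) (auto simp: rot_add differentiable_sum, simp add: rot_def)

lemma rot_cong: "open S \<Longrightarrow> x \<in> S \<Longrightarrow> (\<And>y. y \<in> S \<Longrightarrow> a y = b y) \<Longrightarrow> rot a x = rot b x"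
  unfolding rot_def using frechet_derivative_cong_open[of S x a b] by simp

lemma dvg_cong: "open S \<Longrightarrow> x \<in> S \<Longrightarrow> (\<And>y. y \<in> S \<Longrightarrow> a y = b y) \<Longrightarrow> dvg a x = dvg b x"
  unfolding dvg_def using frechet_derivative_cong_open[of S x a b] by simp

lemma smooth_on_nth: "open S \<Longrightarrow> smooth_on S f \<Longrightarrow> smooth_on S (\<lambda>x. f x $ i)"
  using smooth_on_linear[OF _ bounded_linear_vec_nth] by blast

lemma smooth_on_vec3:
  fixes f :: "'a::real_normed_vector \<Rightarrow> real^3"
  assumes "open S" "\<And>i. smooth_on S (\<lambda>x. f x $ i)"
  shows "smooth_on S f"
proof -
  have "smooth_on S (\<lambda>x. f x $ 1 *\<^sub>R e 1 + f x $ 2 *\<^sub>R e 2 + f x $ 3 *\<^sub>R e 3)"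
    by (intro smooth_on_add smooth_on_intros assms smooth_on_const)
  then show ?thesis by (simp flip: vec3_expansion)
qed

lemma smooth_on_grad: "open S \<Longrightarrow> smooth_on S f \<Longrightarrow> smooth_on S (grad f)"
  by (rule smooth_on_vec3) (simp_all add: grad_def smooth_on_derivative)

lemma smooth_on_second_derivative_symmetric_vec:
  fixes a :: "'a::real_normed_vector \<Rightarrow> real^'n"
  assumes S: "open S" "x \<in> S" and a: "smooth_on S a"
  shows "frechet_derivative (\<lambda>y. frechet_derivative a (at y) v) (at x) w =
         frechet_derivative (\<lambda>y. frechet_derivative a (at y) w) (at x) v"
proof -
  have "frechet_derivative (\<lambda>y. frechet_derivative a (at y) v) (at x) w $ i =
      frechet_derivative (\<lambda>y. frechet_derivative (\<lambda>z. a z $ i) (at y) v) (at x) w" for i v w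
  proof -
    have "frechet_derivative (\<lambda>y. frechet_derivative a (at y) v) (at x) w $ i =
        frechet_derivative (\<lambda>y. frechet_derivative a (at y) v $ i) (at x) w"
      by (rule frechet_derivative_nth[symmetric]) (rule smooth_onD[OF smooth_on_derivative[OF a] S(2)])
    also have "\<dots> = frechet_derivative (\<lambda>y. frechet_derivative (\<lambda>z. a z $ i) (at y) v) (at x) w"
      by (subst frechet_derivative_cong_open[OF S, where g = "\<lambda>y. frechet_derivative (\<lambda>z. a z $ i) (at y) v"])
        (simp_all add: frechet_derivative_nth smooth_onD[OF a])
    finally show ?thesis .
  qed
  then show ?thesis
    using smooth_on_second_derivative_symmetric[OF S smooth_on_nth[OF S(1) a]]
    by (simp add: vec_eq_iff)
qed

lemma rot_grad:
  assumes "open S" "x \<in> S" "smooth_on S f"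
  shows "rot (grad f) x = 0"
proof -
  have "frechet_derivative (grad f) (at x) (e i) $ j = frechet_derivative (\<lambda>y. frechet_derivative f (at y) (e j)) (at x) (e i)" for i j
    using frechet_derivative_nth[of "grad f" x j "e i"] smooth_onD[OF smooth_on_grad assms(2)] assms
    by (simp add: grad_def)
  then show ?thesis
    using smooth_on_second_derivative_symmetric[OF assms]
    by (simp add: rot_def vec_eq_iff forall_3 sum_3 cross_components)
qed

lemma dvg_rot:
  assumes "open S" "x \<in> S" "smooth_on S a"
  shows "dvg (rot a) x = 0"
proof -
  let ?D = "\<lambda>i y. frechet_derivative a (at y) (e i)"
  have d: "?D i differentiable (at x)" for i
    by (rule smooth_onD[OF smooth_on_derivative[OF assms(3)] assms(2)])
  have "frechet_derivative (rot a) (at x) v = (\<Sum>i\<in>UNIV. e i \<times> frechet_derivative (?D i) (at x) v)" for v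
    unfolding rot_def[abs_def]
    by (subst frechet_derivative_sum)
      (simp_all add: d frechet_derivative_bilinear[OF bounded_bilinear_cross3] differentiable_bilinear[OF bounded_bilinear_cross3])
  then show ?thesis
    using smooth_on_second_derivative_symmetric_vec[OF assms, of "e 1" "e 2"]
      smooth_on_second_derivative_symmetric_vec[OF assms, of "e 2" "e 3"]
      smooth_on_second_derivative_symmetric_vec[OF assms, of "e 3" "e 1"]
    by (simp add: dvg_def sum_3 cross_components)
qed

text \<open>This is the classical identity for \<open>rot (u \<times> m w)\<close>, with the derivatives of \<open>m\<close> absorbed into
the two divergences: the fields that are divergence free on the manifold are \<open>m u\<close> and \<open>m w\<close>, where
\<open>m\<close> is the volume density.\<close>
lemma rot_scaled_cross:
  assumes "m differentiable (at x)" "u differentiable (at x)" "w differentiable (at x)"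
  shows "rot (\<lambda>y. m y *\<^sub>R (u y \<times> w y)) x =
     dvg (\<lambda>y. m y *\<^sub>R w y) x *\<^sub>R u x - dvg (\<lambda>y. m y *\<^sub>R u y) x *\<^sub>R w x
     + m x *\<^sub>R (frechet_derivative u (at x) (w x) - frechet_derivative w (at x) (u x))"
proof -
  note bil = frechet_derivative_bilinear differentiable_bilinear
  have "rot (\<lambda>y. m y *\<^sub>R (u y \<times> w y)) x = (\<Sum>i\<in>UNIV. e i \<times>
      (m x *\<^sub>R (u x \<times> frechet_derivative w (at x) (e i) + frechet_derivative u (at x) (e i) \<times> w x)
      + frechet_derivative m (at x) (e i) *\<^sub>R (u x \<times> w x)))"
    unfolding rot_def
    by (simp add: assms bil[OF bounded_bilinear_scaleR] bil[OF bounded_bilinear_cross3])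
  moreover have "dvg (\<lambda>y. m y *\<^sub>R w y) x = (\<Sum>i\<in>UNIV. (m x *\<^sub>R frechet_derivative w (at x) (e i)
      + frechet_derivative m (at x) (e i) *\<^sub>R w x) $ i)"
    "dvg (\<lambda>y. m y *\<^sub>R u y) x = (\<Sum>i\<in>UNIV. (m x *\<^sub>R frechet_derivative u (at x) (e i)
      + frechet_derivative m (at x) (e i) *\<^sub>R u x) $ i)"
    unfolding dvg_def by (simp_all add: assms bil[OF bounded_bilinear_scaleR])
  ultimately show ?thesis
    unfolding linear_frechet_derivative_vec3[OF assms(2), of "w x"] linear_frechet_derivative_vec3[OF assms(3), of "u x"]
    by (simp add: vec_eq_iff forall_3 sum_3 cross_components algebra_simps)
qed

section \<open>The exterior derivative in a chart\<close>

lemma ext_d_length: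
  assumes "open (chart_image c)" "in_chart M c x"
    "\<And>y ws. y \<in> chart_image c \<Longrightarrow> length ws \<noteq> k \<Longrightarrow> \<alpha> c y ws = 0" "length vs \<noteq> Suc k"
  shows "ext_d M \<alpha> c x vs = 0"
proof -
  have "frechet_derivative (\<lambda>y. \<alpha> c y (take i vs @ drop (Suc i) vs)) (at x) = (\<lambda>_. 0)" if "i < length vs" for i
  proof -
    have "length (take i vs @ drop (Suc i) vs) \<noteq> k" using that assms(4) by auto
    then have "frechet_derivative (\<lambda>y. \<alpha> c y (take i vs @ drop (Suc i) vs)) (at x) = frechet_derivative (\<lambda>y. 0) (at x)"
      using assms by (intro frechet_derivative_cong_open[OF assms(1)]) (auto simp: in_chart_def)
    then show ?thesis by simp
  qed
  then show ?thesis by (simp add: ext_d_def)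
qed

lemma ext_d_rep:
  assumes "open (chart_image c)" "in_chart M c x" "\<And>y. y \<in> chart_image c \<Longrightarrow> \<alpha> c y = \<beta> y"
  shows "ext_d M \<alpha> c x vs = (\<Sum>i<length vs. (-1) ^ i *
        frechet_derivative (\<lambda>y. \<beta> y (take i vs @ drop (Suc i) vs)) (at x) (vs ! i))"
proof -
  have "frechet_derivative (\<lambda>y. \<alpha> c y ws) (at x) = frechet_derivative (\<lambda>y. \<beta> y ws) (at x)" for ws
    using assms by (intro frechet_derivative_cong_open[OF assms(1)]) (auto simp: in_chart_def)
  then show ?thesis using assms(2) by (simp add: ext_d_def)
qed

lemma ext_d_cov0:
  assumes "open (chart_image c)" "in_chart M c x" "\<And>y. y \<in> chart_image c \<Longrightarrow> \<alpha> c y = cov0 (f y)"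
    "f differentiable (at x)"
  shows "ext_d M \<alpha> c x = cov1 (grad f x)"
proof
  fix vs show "ext_d M \<alpha> c x vs = cov1 (grad f x) vs"
  proof (cases "length vs = 1")
    case True
    then show ?thesis
      by (auto simp: length_Suc_conv ext_d_rep[where \<alpha> = \<alpha> and \<beta> = "\<lambda>y. cov0 (f y)", OF assms(1-3)] grad_inner[OF assms(4)])
  next
    case False
    then show ?thesis using ext_d_length[OF assms(1,2), of 0] by (simp add: assms(3) cov_eq_0)
  qed
qed

lemma ext_d_cov1:
  assumes "open (chart_image c)" "in_chart M c x" "\<And>y. y \<in> chart_image c \<Longrightarrow> \<alpha> c y = cov1 (a y)"
    "a differentiable (at x)"
  shows "ext_d M \<alpha> c x = cov2 (rot a x)"
proof
  fix vs show "ext_d M \<alpha> c x vs = cov2 (rot a x) vs"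
  proof (cases "length vs = 2")
    case True
    then obtain v w where "vs = [v, w]" by (auto simp: length_2_conv)
    then show ?thesis
      by (simp add: numeral_eq_Suc ext_d_rep[where \<alpha> = \<alpha> and \<beta> = "\<lambda>y. cov1 (a y)", OF assms(1-3)] rot_inner_cross[OF assms(4)]
          frechet_derivative_bounded_linear[OF bounded_linear_inner_left assms(4)])
  next
    case False
    then show ?thesis using ext_d_length[OF assms(1,2), of 1] by (simp add: assms(3) cov_eq_0)
  qed
qed

lemma ext_d_cov2:
  assumes "open (chart_image c)" "in_chart M c x" "\<And>y. y \<in> chart_image c \<Longrightarrow> \<alpha> c y = cov2 (b y)"
    "b differentiable (at x)"
  shows "ext_d M \<alpha> c x = cov3 (dvg b x)"
proof
  fix vs show "ext_d M \<alpha> c x vs = cov3 (dvg b x) vs"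
  proof (cases "length vs = 3")
    case True
    then obtain u v w where "vs = [u, v, w]" by (auto simp: length_3_conv)
    then show ?thesis
      by (simp add: numeral_eq_Suc ext_d_rep[where \<alpha> = \<alpha> and \<beta> = "\<lambda>y. cov2 (b y)", OF assms(1-3)] dvg_triple[OF assms(4)]
          frechet_derivative_bounded_linear[OF bounded_linear_inner_left assms(4)])
  next
    case False
    then show ?thesis using ext_d_length[OF assms(1,2), of 2] by (simp add: assms(3) cov_eq_0)
  qed
qed

text \<open>Four vectors in three-space satisfy a linear relation, namely the expansion of one of them in the
other three by Cramer's rule; the derivative of \<open>r\<close> is applied to it.\<close>
lemma ext_d_cov3:
  assumes "open (chart_image c)" "in_chart M c x" "\<And>y. y \<in> chart_image c \<Longrightarrow> \<alpha> c y = cov3 (r y)"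
    "r differentiable (at x)"
  shows "ext_d M \<alpha> c x = 0"
proof
  fix vs show "ext_d M \<alpha> c x vs = 0 vs"
  proof (cases "length vs = 4")
    case True
    then obtain t u v w where vs: "vs = [t, u, v, w]" by (auto simp: numeral_eq_Suc length_Suc_conv)
    have "(g \<bullet> t) * (u \<bullet> (v \<times> w)) - (g \<bullet> u) * (t \<bullet> (v \<times> w)) + (g \<bullet> v) * (t \<bullet> (u \<times> w)) - (g \<bullet> w) * (t \<bullet> (u \<times> v)) = 0"
      for g :: "real^3" by (simp add: inner_vec_def sum_3 cross_components algebra_simps)
    then show ?thesis
      by (simp add: vs numeral_eq_Suc ext_d_rep[where \<alpha> = \<alpha> and \<beta> = "\<lambda>y. cov3 (r y)", OF assms(1-3)] grad_inner[OF assms(4), symmetric]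
          frechet_derivative_bounded_linear[OF bounded_linear_mult_left assms(4)])
  next
    case False
    then show ?thesis using ext_d_length[OF assms(1,2), of 3] by (simp add: assms(3) cov_eq_0)
  qed
qed

section \<open>Products and exponentials of elements without constant part\<close>

lemma zero_fun_apply: "0 x = 0"
  by simp

lemma sum_fun_apply: "(\<Sum>i\<in>I. f i) x = (\<Sum>i\<in>I. f i x)"
  for f :: "'i \<Rightarrow> 'a \<Rightarrow> 'b::comm_monoid_add"
  by (induction I rule: infinite_finite_induct) auto

lemma UNIV_odd_param: "UNIV = {Dt, Eps}"
  using odd_param.exhaust by auto

lemma finite_odd_params [simp]: "finite (S :: odd_param set)"
  by (rule finite_subset[OF subset_UNIV]) (simp add: UNIV_odd_param)

lemma odd_params_cases: "S = {} \<or> S = {Dt} \<or> S = {Eps} \<or> S = {Dt, Eps}" for S :: "odd_param set"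
proof -
  have "S \<subseteq> {Dt, Eps}" using UNIV_odd_param by auto
  then show ?thesis by (cases "Dt \<in> S"; cases "Eps \<in> S") auto
qed

lemma wedge_zero [simp]: "wedge 0 \<beta> = 0" "wedge \<alpha> 0 = 0"
  by (simp_all add: wedge_def wedge_at_zero fun_eq_iff)

lemma koszul_zero [simp]: "koszul m 0 = 0" and form_scale_zero [simp]: "form_scale r 0 = 0"
  and form_scale_one [simp]: "form_scale 1 \<alpha> = \<alpha>"
  by (simp_all add: koszul_def form_scale_def fun_eq_iff)

text \<open>Every factor contributes at least one of the odd parameters, and none of them can occur twice.\<close>
lemma elt_power_vanish:
  assumes "A {} = 0" "card S < m"
  shows "elt_power M A m S n = 0"
  using assms(2)
proof (induction m arbitrary: S n)
  case (Suc m)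
  have "wedge (A T k) (koszul (card T) (elt_power M A m (S - T) (n - k))) = 0" if "T \<subseteq> S" for T k
  proof (cases "T = {}")
    case False
    then have "card (S - T) < card S"
      using that by (intro psubset_card_mono) auto
    then have "elt_power M A m (S - T) (n - k) = 0"
      using Suc.prems by (intro Suc.IH) simp
    then show ?thesis by (simp only: koszul_zero wedge_zero)
  qed (simp add: assms(1))
  then show ?case by (simp add: elt_mult_def sum.neutral)
qed simp

lemma wedge_unit_form:
  assumes "\<And>c x. \<not> in_chart M c x \<Longrightarrow> \<alpha> c x = 0"
  shows "wedge \<alpha> (koszul m (unit_form M)) = \<alpha>"
proof (intro ext)
  fix c x vs
  show "wedge \<alpha> (koszul m (unit_form M)) c x vs = \<alpha> c x vs"
  proof (cases "in_chart M c x")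
    case True
    have "koszul m (unit_form M) c x ws = cov0 1 ws" for ws
      using True by (cases ws) (auto simp: koszul_def unit_form_def)
    then have "koszul m (unit_form M) c x = cov0 1" by (rule ext)
    then show ?thesis by (simp add: wedge_def wedge_at_unit)
  qed (simp add: wedge_def assms wedge_at_zero)
qed

lemma elt_mult_one:
  assumes "\<And>S n c x. \<not> in_chart M c x \<Longrightarrow> A S n c x = 0"
  shows "elt_mult A (elt_one M) = A"
proof (intro ext)
  fix U n c x vs
  have *: "form_scale (param_sign S (U - S)) (wedge (A S k) (koszul (card S) (elt_one M (U - S) (n - k))))
      = (if S = U then if k = n then A U n else 0 else 0)" if "S \<in> Pow U" "k \<in> {..n}" for S k
    using that by (auto simp: elt_one_def param_sign_def wedge_unit_form[OF assms])
  have "elt_mult A (elt_one M) U n = (\<Sum>S\<in>Pow U. \<Sum>k\<le>n. if S = U then if k = n then A U n else 0 else 0)"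
    unfolding elt_mult_def by (intro sum.cong refl *)
  also have "\<dots> = (\<Sum>S\<in>Pow U. if S = U then (\<Sum>k\<le>n. if k = n then A U n else 0) else 0)"
    by (intro sum.cong refl) simp
  also have "\<dots> = A U n" by simp
  finally show "elt_mult A (elt_one M) U n c x vs = A U n c x vs" by simp
qed

text \<open>There are two odd parameters, so the exponential series stops after the square.\<close>
lemma elt_exp_nilpotent:
  assumes "A {} = 0" "\<And>S n c x. \<not> in_chart M c x \<Longrightarrow> A S n c x = 0"
  shows "elt_exp M A S n c x vs = elt_one M S n c x vs + A S n c x vs + elt_mult A A S n c x vs / 2"
proof -
  have "card S \<le> card {Dt, Eps}" by (rule card_mono) (use odd_params_cases[of S] in auto)
  then have S: "card S \<le> 2" by simp
  have "elt_power M A m S n = 0" if "m \<notin> {0, 1, 2}" for m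
    using that S by (intro elt_power_vanish[of A] assms(1)) auto
  then have "elt_exp M A S n c x vs = (\<Sum>m\<in>{0, 1, 2}. elt_power M A m S n c x vs / fact m)"
    unfolding elt_exp_def by (intro suminf_finite) simp_all
  moreover have "elt_power M A 1 = A" "elt_power M A 2 = elt_mult A A"
    by (simp_all add: numeral_2_eq_2 elt_mult_one[OF assms(2)])
  ultimately show ?thesis by simp
qed

lemma elt_mult_degree_one:
  assumes "A {} = 0" "card S \<le> 1"
  shows "elt_mult A A S n = 0"
proof -
  have "form_scale (param_sign T (S - T)) (wedge (A T k) (koszul (card T) (A (S - T) (n - k)))) = 0"
    if "T \<subseteq> S" for T k
  proof -
    have "T = S" if "T \<noteq> {}"
    proof (rule card_seteq)
      have "card T > 0" using that by (simp add: card_gt_0_iff)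
      then show "card S \<le> card T" using assms(2) by linarith
    qed (use \<open>T \<subseteq> S\<close> in auto)
    then consider "T = {}" | "S - T = {}" by auto
    then show ?thesis by cases (simp_all only: assms(1) zero_fun_apply koszul_zero wedge_zero form_scale_zero)
  qed
  then show ?thesis by (simp add: elt_mult_def sum.neutral)
qed

text \<open>The sign of the second sum is that of moving \<open>\<epsilon>\<close> past \<open>dt\<close>.\<close>
lemma elt_mult_top:
  assumes "A {} = 0"
  shows "elt_mult A A {Dt, Eps} n =
    (\<Sum>k\<le>n. wedge (A {Dt} k) (koszul 1 (A {Eps} (n - k)))) -
    (\<Sum>k\<le>n. wedge (A {Eps} k) (koszul 1 (A {Dt} (n - k))))"
proof -
  have P: "Pow {Dt, Eps} = {{}, {Dt}, {Eps}, {Dt, Eps}}" by (auto simp: Pow_insert)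
  have d: "{Dt, Eps} - {Dt} = {Eps}" "{Dt, Eps} - {Eps} = {Dt}" by auto
  have neg: "form_scale (-1) \<alpha> = - \<alpha>" for \<alpha> :: "'a form"
    by (simp add: form_scale_def fun_eq_iff)
  have "elt_mult A A {Dt, Eps} n = (\<Sum>k\<le>n. wedge (A {Dt} k) (koszul 1 (A {Eps} (n - k)))) +
    (\<Sum>k\<le>n. - wedge (A {Eps} k) (koszul 1 (A {Dt} (n - k))))"
    unfolding elt_mult_def P by (simp add: d assms param_sign_def neg)
  then show ?thesis by (simp add: sum_negf)
qed

section \<open>Gram matrices\<close>

text \<open>Sylvester's criterion, run through the leading minors. A positive definite form is evaluated at
vectors of cofactors, which the matrix maps to multiples of a basis vector.\<close>
lemma det_posdef3:
  fixes G :: "real^3^3"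
  assumes sym: "transpose G = G" and pos: "\<And>v. v \<noteq> 0 \<Longrightarrow> v \<bullet> (G *v v) > 0"
  shows "det G > 0"
proof -
  have sym': "G $ i $ j = G $ j $ i" for i j
  proof -
    have "transpose G $ i $ j = G $ j $ i" by (simp add: transpose_def)
    then show ?thesis by (simp only: sym)
  qed
  have e: "e i \<noteq> 0" for i by (simp add: axis_eq_0_iff)
  have g11: "G $ 1 $ 1 > 0"
    using pos[OF e[of 1]] by (simp add: inner_axis' matrix_vector_mult_basis column_def)
  \<comment> \<open>The third column of the cofactor matrix; its last entry is the second leading minor.\<close>
  define v where "v = (G *v e 1) \<times> (G *v e 2)"
  have v3: "v $ 3 = G $ 1 $ 1 * G $ 2 $ 2 - G $ 1 $ 2 * G $ 2 $ 1"
    by (simp add: v_def cross_components matrix_vector_mult_basis column_def)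
  \<comment> \<open>The same choice for the leading block of size two.\<close>
  define w :: "real^3" where "w = vector [- G $ 1 $ 2, G $ 1 $ 1, 0]"
  have "w $ 2 \<noteq> 0" using g11 by (simp add: w_def)
  then have "w \<noteq> 0" by auto
  then have "w \<bullet> (G *v w) > 0" by (rule pos)
  also have "w \<bullet> (G *v w) = G $ 1 $ 1 * v $ 3"
    by (simp add: w_def v3 inner_vec_def sum_3 matrix_vector_mult_def sym'[of 2 1] algebra_simps)
  finally have v3pos: "v $ 3 > 0" using g11 by (simp add: zero_less_mult_iff)
  then have "v \<noteq> 0" by auto
  then have "v \<bullet> (G *v v) > 0" by (rule pos)
  also have "G *v v = det G *\<^sub>R e 3"
    using cross_matrix_mult[of G "e 1" "e 2"] by (simp add: v_def sym cross_basis)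
  finally show ?thesis using v3pos by (simp add: inner_axis zero_less_mult_iff)
qed

lemma triple_matrix_mult: "(J *v u) \<bullet> ((J *v v) \<times> (J *v w)) = det J * (u \<bullet> (v \<times> w))" for J :: "real^3^3"
proof -
  have "(J *v u) \<bullet> ((J *v v) \<times> (J *v w)) = u \<bullet> (transpose J *v ((J *v v) \<times> (J *v w)))"
    by (metis dot_lmul_matrix inner_commute transpose_matrix_vector transpose_transpose)
  then show ?thesis by (simp only: cross_matrix_mult inner_scaleR_right)
qed

text \<open>This is where the orientation enters: for a negative determinant the sign would change.\<close>
lemma vol_density_pullback:
  fixes J :: "real^3^3"
  assumes "det J > 0" "G = transpose J ** G' ** J"
  shows "vol_density G = vol_density G' * det J"
proof -
  have "det G = det G' * (det J)\<^sup>2"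
    unfolding assms(2) by (simp add: det_mul det_transpose power2_eq_square)
  then show ?thesis using assms(1) by (simp add: vol_density_def real_sqrt_mult)
qed

text \<open>If the covectors correspond under \<open>J\<close>, so do the vectors that represent them in the two metrics.\<close>
lemma sharp_pullback:
  assumes "gram G" "gram G'" "det J > 0" "G = transpose J ** G' ** J" "\<And>v. a \<bullet> v = a' \<bullet> (J *v v)"
  shows "matrix_inv G' *v a' = J *v (matrix_inv G *v a)"
proof -
  interpret G: gram G by fact
  interpret G': gram G' by fact
  have a: "a = transpose J *v a'"
    by (rule vector_eq_ldot[THEN iffD1])
      (metis assms(5) dot_lmul_matrix inner_commute transpose_matrix_vector)
  have "transpose J *v (G' *v (J *v (matrix_inv G *v a))) = G *v (matrix_inv G *v a)"
    unfolding assms(4) by (simp add: matrix_vector_mul_assoc matrix_mul_assoc)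
  also have "\<dots> = transpose J *v a'" by (simp add: G.GH a)
  finally have "G' *v (J *v (matrix_inv G *v a)) = a'"
    using assms(3) by (metis det_transpose inj_matrix_vector_mult injD invertible_det_nz less_irrefl)
  then show ?thesis using G'.HG by metis
qed

lemma smooth_on_cov:
  assumes "open S"
  shows "smooth_on S a \<Longrightarrow> smooth_on S (\<lambda>x. cov1 (a x) vs)" "smooth_on S b \<Longrightarrow> smooth_on S (\<lambda>x. cov2 (b x) vs)"
  subgoal
    by (cases "length vs = 1") (auto simp: length_Suc_conv cov_eq_0 smooth_on_const intro!: smooth_on_intros[OF assms])
  subgoal
    by (cases "length vs = 2") (auto simp: length_2_conv cov_eq_0 smooth_on_const intro!: smooth_on_intros[OF assms])
  done

text \<open>The entries of the inverse are cofactors, that is, vector products of the columns, divided by the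
determinant.\<close>
lemma smooth_on_matrix_inv:
  assumes S: "open S" and G: "\<And>x. x \<in> S \<Longrightarrow> gram (G x)" "smooth_on S G"
  shows "smooth_on S (\<lambda>x. vol_density (G x))"
    and "smooth_on S a \<Longrightarrow> smooth_on S (\<lambda>x. matrix_inv (G x) *v a x)"
proof -
  have col: "smooth_on S (\<lambda>x. G x *v e i)" for i
    by (intro smooth_on_intros[OF S] G smooth_on_const)
  have "(G x *v e 1) \<bullet> ((G x *v e 2) \<times> (G x *v e 3)) = det (G x)" for x
    by (simp add: triple_matrix_mult cross_basis inner_axis_axis)
  then have det: "smooth_on S (\<lambda>x. det (G x))"
    using smooth_on_intros(3,4)[OF S] col by (metis (no_types, lifting) ext)
  have pos: "det (G x) > 0" if "x \<in> S" for x
    using G(1)[OF that] by (simp add: gram.det_pos)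
  show "smooth_on S (\<lambda>x. vol_density (G x))"
    unfolding vol_density_def by (intro smooth_on_sqrt[OF S] pos det)
  have inv: "smooth_on S (\<lambda>x. inverse (det (G x)))"
    by (intro smooth_on_inverse[OF S] det) (use pos in fastforce)
  assume a: "smooth_on S a"
  show "smooth_on S (\<lambda>x. matrix_inv (G x) *v a x)"
  proof (rule smooth_on_vec3[OF S])
    fix i :: 3
    have ex: "\<exists>j k. e i = e j \<times> e k"
      using exhaust_3[of i] cross_basis by metis
    then obtain j k where jk: "e i = e j \<times> e k" by blast
    have "(matrix_inv (G x) *v a x) $ i = inverse (det (G x)) * (a x \<bullet> ((G x *v e j) \<times> (G x *v e k)))" if "x \<in> S" for x
    proof -
      interpret gram "G x" by (rule G(1)[OF that])
      have "(matrix_inv (G x) *v a x) $ i = a x \<bullet> (matrix_inv (G x) *v e i)"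
        using H_self_adjoint[of "a x" "e i"] by (simp add: inner_axis)
      then show ?thesis using pos[OF that] by (simp add: G_cross jk)
    qed
    moreover have "smooth_on S (\<lambda>x. inverse (det (G x)) * (a x \<bullet> ((G x *v e j) \<times> (G x *v e k))))"
      by (intro smooth_on_intros[OF S] inv a col)
    ultimately show "smooth_on S (\<lambda>x. (matrix_inv (G x) *v a x) $ i)"
      using smooth_on_cong[OF S] by (metis (no_types, lifting))
  qed
qed

section \<open>Fields and forms in the charts of a Riemannian three-manifold\<close>

locale oriented_riemannian3 =
  fixes M :: "'a riemannian3"
  assumes oriented_smooth_atlas: "oriented_smooth_atlas (mtop M) (atlas M)"
    and riemannian_metric: "riemannian_metric (atlas M) (metric M)"
begin

abbreviation vol :: "'a chart \<Rightarrow> real^3 \<Rightarrow> real" where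
  "vol c x \<equiv> vol_density (metric M c x)"

abbreviation inv_metric :: "'a chart \<Rightarrow> real^3 \<Rightarrow> real^3^3" where
  "inv_metric c x \<equiv> matrix_inv (metric M c x)"

lemma open_chart: "c \<in> atlas M \<Longrightarrow> open (chart_image c)"
  using oriented_smooth_atlas by (auto simp: oriented_smooth_atlas_def)

lemma gram_metric: "in_chart M c x \<Longrightarrow> gram (metric M c x)"
  using riemannian_metric by (auto simp: riemannian_metric_def in_chart_def intro!: gram.intro det_posdef3)

lemma smooth_metric: "c \<in> atlas M \<Longrightarrow> smooth_on (chart_image c) (metric M c)"
  using riemannian_metric by (auto simp: riemannian_metric_def)

lemma smooth_vol: "c \<in> atlas M \<Longrightarrow> smooth_on (chart_image c) (vol c)"
  by (intro smooth_on_matrix_inv open_chart gram_metric smooth_metric) (auto simp: in_chart_def)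

lemma smooth_inv_metric:
  "c \<in> atlas M \<Longrightarrow> smooth_on (chart_image c) a \<Longrightarrow> smooth_on (chart_image c) (\<lambda>x. inv_metric c x *v a x)"
  by (intro smooth_on_matrix_inv open_chart gram_metric smooth_metric) (auto simp: in_chart_def)

lemma smooth_metric_mult:
  "c \<in> atlas M \<Longrightarrow> smooth_on (chart_image c) a \<Longrightarrow> smooth_on (chart_image c) (\<lambda>x. metric M c x *v a x)"
  by (intro smooth_on_intros open_chart smooth_metric)

lemma inj_on_chart: "c \<in> atlas M \<Longrightarrow> inj_on (snd c) (fst c)"
  and open_map_chart: "c \<in> atlas M \<Longrightarrow> openin (mtop M) V \<Longrightarrow> V \<subseteq> fst c \<Longrightarrow> open (snd c ` V)"
proof -
  assume c: "c \<in> atlas M"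
  then have o: "openin (mtop M) (fst c)" and
    h: "homeomorphic_map (subtopology (mtop M) (fst c)) (top_of_set (chart_image c)) (snd c)"
    using oriented_smooth_atlas by (auto simp: oriented_smooth_atlas_def)
  have "topspace (subtopology (mtop M) (fst c)) = fst c"
    using openin_subset[OF o] by auto
  then show "inj_on (snd c) (fst c)"
    using homeomorphic_imp_injective_map[OF h] by simp
  assume "openin (mtop M) V" "V \<subseteq> fst c"
  then have "openin (subtopology (mtop M) (fst c)) V" by (auto simp: openin_subtopology)
  then have "openin (top_of_set (chart_image c)) (snd c ` V)"
    using homeomorphic_imp_open_map[OF h] by (auto simp: open_map_def)
  then show "open (snd c ` V)"
    using open_chart[OF c] openin_open_eq by blast
qed

context
  fixes c c' assumes c: "c \<in> atlas M" "c' \<in> atlas M"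
begin

lemma open_overlap: "open (overlap c c')"
proof -
  have "openin (mtop M) (fst c \<inter> fst c')"
    using oriented_smooth_atlas c by (auto simp: oriented_smooth_atlas_def)
  then show ?thesis unfolding overlap_def by (intro open_map_chart c) auto
qed

lemma transition_differentiable: "x \<in> overlap c c' \<Longrightarrow> transition c c' differentiable (at x)"
  by (rule smooth_onD[of "overlap c c'"])
    (use oriented_smooth_atlas c in \<open>simp_all add: oriented_smooth_atlas_def\<close>)

lemma det_jacobian_pos: "x \<in> overlap c c' \<Longrightarrow> det (jacobian c c' x) > 0"
  using oriented_smooth_atlas c by (auto simp: oriented_smooth_atlas_def)

lemma metric_transition: "x \<in> overlap c c' \<Longrightarrow>
    metric M c x = transpose (jacobian c c' x) ** metric M c' (transition c c' x) ** jacobian c c' x"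
  using riemannian_metric c by (auto simp: riemannian_metric_def)

lemma jacobian_mult: "x \<in> overlap c c' \<Longrightarrow>
    jacobian c c' x *v v = frechet_derivative (transition c c') (at x) v"
  unfolding jacobian_def
  by (rule fun_cong[OF matrix_vector_mul(2)[OF linear_frechet_derivative[OF transition_differentiable]]])

lemma in_chart_overlap:
  assumes "x \<in> overlap c c'"
  shows "in_chart M c x" "in_chart M c' (transition c c' x)"
proof -
  obtain p where p: "p \<in> fst c" "p \<in> fst c'" "x = snd c p" using assms by (auto simp: overlap_def)
  then have "transition c c' x = snd c' p"
    using inj_on_chart[OF c(1)] by (simp add: transition_def inv_into_f_f)
  with p c show "in_chart M c x" "in_chart M c' (transition c c' x)"
    by (auto simp: in_chart_def chart_image_def)
qed

end

lemma vector_fieldsD: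
  assumes "u \<in> vector_fields M"
  shows "\<not> in_chart M c x \<Longrightarrow> u c x = 0" "c \<in> atlas M \<Longrightarrow> smooth_on (chart_image c) (u c)"
    "c \<in> atlas M \<Longrightarrow> c' \<in> atlas M \<Longrightarrow> x \<in> overlap c c' \<Longrightarrow> u c' (transition c c' x) = jacobian c c' x *v u c x"
  using assms unfolding vector_fields_def by blast+

lemma kformsD:
  assumes "\<alpha> \<in> kforms M k"
  shows "\<not> in_chart M c x \<Longrightarrow> \<alpha> c x = 0" "\<alpha> c x \<in> Alt" "length vs \<noteq> k \<Longrightarrow> \<alpha> c x vs = 0"
    "c \<in> atlas M \<Longrightarrow> smooth_on (chart_image c) (\<lambda>x. \<alpha> c x vs)"
    "c \<in> atlas M \<Longrightarrow> c' \<in> atlas M \<Longrightarrow> x \<in> overlap c c' \<Longrightarrow>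
      \<alpha> c x vs = \<alpha> c' (transition c c' x) (map ((*v) (jacobian c c' x)) vs)"
  using assms unfolding kforms_def forms_def by blast+

lemma zero_kforms: "0 \<in> kforms M k"
  by (auto simp: kforms_def forms_def Alt_zero smooth_on_const)

lemma uminus_kforms:
  assumes "\<alpha> \<in> kforms M k"
  shows "- \<alpha> \<in> kforms M k"
proof -
  have "- \<beta> \<in> Alt" if "\<beta> \<in> Alt" for \<beta>
    using that by (auto simp: Alt_def intro: linear_compose_neg)
  moreover have "smooth_on (chart_image c) (\<lambda>x. - \<alpha> c x vs)" if "c \<in> atlas M" for c vs
    using smooth_on_linear[OF open_chart[OF that] bounded_linear_minus[OF bounded_linear_ident]
        kformsD(4)[OF assms that]] .
  ultimately show ?thesis
    using kformsD(1-3,5)[OF assms] by (simp add: kforms_def forms_def)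
qed

lemma flat_chart:
  assumes "in_chart M c x"
  shows "flat M u c x = cov1 (metric M c x *v u c x)"
proof
  fix vs
  interpret gram "metric M c x" by (rule gram_metric[OF assms])
  show "flat M u c x vs = cov1 (metric M c x *v u c x) vs"
    by (cases "length vs = 1") (auto simp: flat_def assms cov_eq_0 length_Suc_conv G_self_adjoint)
qed

lemma flat_outside: "\<not> in_chart M c x \<Longrightarrow> flat M u c x = 0"
  by (auto simp: flat_def fun_eq_iff)

lemma cov1_natural: "(\<And>v. a \<bullet> v = b \<bullet> (J *v v)) \<Longrightarrow> cov1 a vs = cov1 b (map ((*v) J) vs)"
  by (cases "length vs = 1") (auto simp: cov_eq_0 length_Suc_conv)

lemma cov2_natural: "(\<And>v w. a \<bullet> (v \<times> w) = b \<bullet> ((J *v v) \<times> (J *v w))) \<Longrightarrow> cov2 a vs = cov2 b (map ((*v) J) vs)"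
  by (cases "length vs = 2") (auto simp: cov_eq_0 length_2_conv)

lemma flat_kforms:
  assumes "u \<in> vector_fields M"
  shows "flat M u \<in> kforms M 1"
proof -
  have "flat M u c x \<in> Alt" for c x
    by (cases "in_chart M c x") (auto simp: flat_chart flat_outside cov_Alt Alt_zero)
  moreover have "smooth_on (chart_image c) (\<lambda>x. flat M u c x vs)" if c: "c \<in> atlas M" for c vs
  proof -
    have "smooth_on (chart_image c) (\<lambda>x. cov1 (metric M c x *v u c x) vs)"
      by (intro smooth_on_cov open_chart smooth_metric_mult c vector_fieldsD assms)
    then show ?thesis
      by (subst smooth_on_cong[OF open_chart[OF c]]) (use c in \<open>auto simp: flat_chart in_chart_def\<close>)
  qed
  moreover have "flat M u c x vs = flat M u c' (transition c c' x) (map ((*v) (jacobian c c' x)) vs)"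
    if c: "c \<in> atlas M" "c' \<in> atlas M" and x: "x \<in> overlap c c'" for c c' x vs
    unfolding flat_chart[OF in_chart_overlap(1)[OF c x]] flat_chart[OF in_chart_overlap(2)[OF c x]]
  proof (rule cov1_natural)
    fix v
    interpret G: gram "metric M c x" by (rule gram_metric[OF in_chart_overlap(1)[OF c x]])
    interpret G': gram "metric M c' (transition c c' x)" by (rule gram_metric[OF in_chart_overlap(2)[OF c x]])
    let ?J = "jacobian c c' x" and ?G' = "metric M c' (transition c c' x)"
    have "u c x \<bullet> (metric M c x *v v) = u c x \<bullet> (transpose ?J *v (?G' *v (?J *v v)))"
      unfolding metric_transition[OF c x] by (simp only: matrix_vector_mul_assoc matrix_mul_assoc)
    also have "\<dots> = (?J *v u c x) \<bullet> (?G' *v (?J *v v))"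
      by (metis dot_lmul_matrix inner_commute transpose_matrix_vector)
    finally show "(metric M c x *v u c x) \<bullet> v = (?G' *v u c' (transition c c' x)) \<bullet> (?J *v v)"
      by (simp add: G.G_self_adjoint G'.G_self_adjoint vector_fieldsD(3)[OF assms c x])
  qed
  ultimately show ?thesis
    by (auto simp: kforms_def forms_def flat_outside, auto simp: flat_def)
qed

lemma kforms_1_chart:
  assumes "\<alpha> \<in> kforms M 1"
  shows "\<alpha> c x = cov1 (vec1 (\<alpha> c x))"
proof
  fix vs show "\<alpha> c x vs = cov1 (vec1 (\<alpha> c x)) vs"
    using kformsD[OF assms] Alt_1[of "\<alpha> c x"]
    by (cases "length vs = 1") (auto simp: cov_eq_0 length_Suc_conv)
qed

lemma sharp_chart:
  assumes "in_chart M c x" "\<alpha> c x = cov1 a"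
  shows "sharp M \<alpha> c x = inv_metric c x *v a"
  by (simp add: sharp_def assms inner_axis)

lemma sharp_vector_fields:
  assumes "\<alpha> \<in> kforms M 1"
  shows "sharp M \<alpha> \<in> vector_fields M"
proof -
  have chart: "sharp M \<alpha> c x = inv_metric c x *v vec1 (\<alpha> c x)" if "in_chart M c x" for c x
    using sharp_chart[OF that kforms_1_chart[OF assms]] .
  have "smooth_on (chart_image c) (sharp M \<alpha> c)" if c: "c \<in> atlas M" for c
  proof -
    have "smooth_on (chart_image c) (\<lambda>x. vec1 (\<alpha> c x))"
      by (rule smooth_on_vec3[OF open_chart[OF c]]) (simp add: vec1_def kformsD(4)[OF assms c])
    then have "smooth_on (chart_image c) (\<lambda>x. inv_metric c x *v vec1 (\<alpha> c x))"
      by (intro smooth_inv_metric c)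
    then show ?thesis
      using smooth_on_cong[OF open_chart[OF c], of "sharp M \<alpha> c"] c by (simp add: chart in_chart_def)
  qed
  moreover have "sharp M \<alpha> c' (transition c c' x) = jacobian c c' x *v sharp M \<alpha> c x"
    if c: "c \<in> atlas M" "c' \<in> atlas M" and x: "x \<in> overlap c c'" for c c' x
  proof -
    note i = in_chart_overlap[OF c x]
    have "vec1 (\<alpha> c x) \<bullet> v = vec1 (\<alpha> c' (transition c c' x)) \<bullet> (jacobian c c' x *v v)" for v
      using kformsD(5)[OF assms c x, of "[v]"] by (simp add: Alt_1[OF kformsD(2)[OF assms]])
    then show ?thesis
      unfolding chart[OF i(1)] chart[OF i(2)]
      by (intro sharp_pullback gram_metric i det_jacobian_pos metric_transition c x)
  qed
  ultimately show ?thesis by (auto simp: vector_fields_def sharp_def)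
qed

lemma flat_sharp:
  assumes "\<alpha> \<in> kforms M 1"
  shows "flat M (sharp M \<alpha>) = \<alpha>"
proof (intro ext)
  fix c x vs
  show "flat M (sharp M \<alpha>) c x vs = \<alpha> c x vs"
  proof (cases "in_chart M c x")
    case True
    then show ?thesis
      using kforms_1_chart[OF assms] gram.GH[OF gram_metric[OF True]]
      by (simp add: flat_chart sharp_chart[OF True kforms_1_chart[OF assms]])
  qed (simp add: flat_outside kformsD(1)[OF assms])
qed

lemma star_chart:
  assumes "in_chart M c x"
  shows "\<alpha> c x = cov0 r \<Longrightarrow> star M \<alpha> c x = cov3 (vol c x * r)"
    "\<alpha> c x = cov1 a \<Longrightarrow> star M \<alpha> c x = cov2 (vol c x *\<^sub>R (inv_metric c x *v a))"
    "\<alpha> c x = cov2 b \<Longrightarrow> star M \<alpha> c x = cov1 ((metric M c x *v b) /\<^sub>R vol c x)"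
    "\<alpha> c x = cov3 r \<Longrightarrow> star M \<alpha> c x = cov0 (r / vol c x)"
  using gram.hodge_at_cov0 gram.hodge_at_cov1 gram.hodge_at_cov2 gram.hodge_at_cov3 gram_metric[OF assms]
  by (auto simp: star_def assms)

lemma star_outside: "\<not> in_chart M c x \<Longrightarrow> star M \<alpha> c x = 0"
  by (simp add: star_def)

lemma codiff_outside: "\<not> in_chart M c x \<Longrightarrow> codiff M \<alpha> c x = 0"
  by (simp add: codiff_def star_outside fun_eq_iff)

lemma vol_pos: "in_chart M c x \<Longrightarrow> vol c x > 0"
  using gram.s_pos gram_metric by blast

lemma codiff_sign:
  assumes "star M (ext_d M (star M \<alpha>)) c x = \<beta>" "\<And>vs. length vs \<noteq> k \<Longrightarrow> \<beta> vs = 0"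
  shows "codiff M \<alpha> c x vs = (-1) ^ k * \<beta> vs"
  using assms by (cases "length vs = k") (auto simp: codiff_def power_add power_mult)

lemma codiff_cov0:
  assumes c: "c \<in> atlas M" and x: "x \<in> chart_image c" and \<alpha>: "\<And>y. y \<in> chart_image c \<Longrightarrow> \<alpha> c y = cov0 (r y)"
    and r: "smooth_on (chart_image c) r"
  shows "codiff M \<alpha> c x = 0"
proof -
  have in_chart: "in_chart M c y" if "y \<in> chart_image c" for y using c that by (simp add: in_chart_def)
  have "star M \<alpha> c y = cov3 (vol c y * r y)" if "y \<in> chart_image c" for y
    by (rule star_chart(1)[where \<alpha> = \<alpha>, OF in_chart[OF that] \<alpha>[OF that]])
  moreover have "(\<lambda>y. vol c y * r y) differentiable (at x)"
    by (intro smooth_onD[OF _ x] smooth_on_intros open_chart smooth_vol c r)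
  ultimately have "ext_d M (star M \<alpha>) c x = 0"
    by (intro ext_d_cov3[OF open_chart[OF c] in_chart[OF x]])
  moreover have "0 = cov0 0"
  proof
    fix vs show "0 vs = cov0 0 vs" by (cases vs) auto
  qed
  ultimately have "star M (ext_d M (star M \<alpha>)) c x = cov3 0"
    using star_chart(1)[OF in_chart[OF x], of "ext_d M (star M \<alpha>)" 0] by simp
  moreover have "cov3 0 vs = 0" for vs by (cases "(0 :: real, vs)" rule: cov3.cases) auto
  ultimately show ?thesis by (simp add: codiff_def fun_eq_iff)
qed

lemma codiff_cov1:
  assumes c: "c \<in> atlas M" and x: "x \<in> chart_image c" and \<alpha>: "\<And>y. y \<in> chart_image c \<Longrightarrow> \<alpha> c y = cov1 (a y)"
    and a: "smooth_on (chart_image c) a"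
  shows "codiff M \<alpha> c x = cov0 (dvg (\<lambda>y. vol c y *\<^sub>R (inv_metric c y *v a y)) x / vol c x)"
proof -
  have in_chart: "in_chart M c y" if "y \<in> chart_image c" for y using c that by (simp add: in_chart_def)
  have "star M \<alpha> c y = cov2 (vol c y *\<^sub>R (inv_metric c y *v a y))" if "y \<in> chart_image c" for y
    by (rule star_chart(2)[where \<alpha> = \<alpha>, OF in_chart[OF that] \<alpha>[OF that]])
  moreover have "(\<lambda>y. vol c y *\<^sub>R (inv_metric c y *v a y)) differentiable (at x)"
    by (intro smooth_onD[OF _ x] smooth_on_intros open_chart smooth_vol smooth_inv_metric c a)
  ultimately have "ext_d M (star M \<alpha>) c x = cov3 (dvg (\<lambda>y. vol c y *\<^sub>R (inv_metric c y *v a y)) x)"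
    by (intro ext_d_cov2[OF open_chart[OF c] in_chart[OF x]])
  from codiff_sign[where k = 0, OF star_chart(4)[where \<alpha> = "ext_d M (star M \<alpha>)", OF in_chart[OF x] this] cov_eq_0(1)]
  show ?thesis by (auto simp: fun_eq_iff)
qed

lemma codiff_cov2:
  assumes c: "c \<in> atlas M" and x: "x \<in> chart_image c" and \<alpha>: "\<And>y. y \<in> chart_image c \<Longrightarrow> \<alpha> c y = cov2 (b y)"
    and d: "(\<lambda>y. (metric M c y *v b y) /\<^sub>R vol c y) differentiable (at x)"
  shows "codiff M \<alpha> c x = cov1 (- (metric M c x *v rot (\<lambda>y. (metric M c y *v b y) /\<^sub>R vol c y) x) /\<^sub>R vol c x)"
proof -
  have in_chart: "in_chart M c y" if "y \<in> chart_image c" for y using c that by (simp add: in_chart_def)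
  have "star M \<alpha> c y = cov1 ((metric M c y *v b y) /\<^sub>R vol c y)" if "y \<in> chart_image c" for y
    by (rule star_chart(3)[where \<alpha> = \<alpha>, OF in_chart[OF that] \<alpha>[OF that]])
  then have "ext_d M (star M \<alpha>) c x = cov2 (rot (\<lambda>y. (metric M c y *v b y) /\<^sub>R vol c y) x)"
    by (intro ext_d_cov1[OF open_chart[OF c] in_chart[OF x]] d)
  from codiff_sign[where k = 1, OF star_chart(3)[where \<alpha> = "ext_d M (star M \<alpha>)", OF in_chart[OF x] this] cov_eq_0(2)]
  have "codiff M \<alpha> c x vs = - cov1 ((metric M c x *v rot (\<lambda>y. (metric M c y *v b y) /\<^sub>R vol c y) x) /\<^sub>R vol c x) vs" for vs
    by simp
  moreover have "- cov1 v vs = cov1 (- v) vs" for v vs by (cases "(v, vs)" rule: cov1.cases) auto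
  ultimately show ?thesis by (auto simp: fun_eq_iff)
qed

lemma codiff_cov3:
  assumes c: "c \<in> atlas M" and x: "x \<in> chart_image c" and \<alpha>: "\<And>y. y \<in> chart_image c \<Longrightarrow> \<alpha> c y = cov3 (vol c y * f y)"
    and f: "f differentiable (at x)"
  shows "codiff M \<alpha> c x = cov2 (vol c x *\<^sub>R (inv_metric c x *v grad f x))"
proof -
  have in_chart: "in_chart M c y" if "y \<in> chart_image c" for y using c that by (simp add: in_chart_def)
  have "star M \<alpha> c y = cov0 (f y)" if "y \<in> chart_image c" for y
    using star_chart(4)[where \<alpha> = \<alpha>, OF in_chart[OF that] \<alpha>[OF that]] vol_pos[OF in_chart[OF that]] by simp
  then have "ext_d M (star M \<alpha>) c x = cov1 (grad f x)"
    by (intro ext_d_cov0[OF open_chart[OF c] in_chart[OF x]] f)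
  from codiff_sign[where k = 2, OF star_chart(2)[where \<alpha> = "ext_d M (star M \<alpha>)", OF in_chart[OF x] this] cov_eq_0(3)]
  show ?thesis by (auto simp: fun_eq_iff)
qed

lemma star_ext_d_flat_chart:
  assumes u: "u \<in> vector_fields M" and c: "c \<in> atlas M" and x: "x \<in> chart_image c"
  shows "star M (ext_d M (flat M u)) c x = cov1 ((metric M c x *v rot (\<lambda>y. metric M c y *v u c y) x) /\<^sub>R vol c x)"
proof -
  have in_chart: "in_chart M c y" if "y \<in> chart_image c" for y using c that by (simp add: in_chart_def)
  have "ext_d M (flat M u) c x = cov2 (rot (\<lambda>y. metric M c y *v u c y) x)"
  proof (rule ext_d_cov1[OF open_chart[OF c] in_chart[OF x]])
    show "flat M u c y = cov1 (metric M c y *v u c y)" if "y \<in> chart_image c" for y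
      by (rule flat_chart[OF in_chart[OF that]])
  qed (intro smooth_onD[OF _ x] smooth_metric_mult c vector_fieldsD(2)[OF u])
  then show ?thesis
    by (rule star_chart(3)[where \<alpha> = "ext_d M (flat M u)", OF in_chart[OF x]])
qed

lemma curl_chart:
  assumes u: "u \<in> vector_fields M" and c: "c \<in> atlas M" and x: "x \<in> chart_image c"
  shows "curl M u c x = rot (\<lambda>y. metric M c y *v u c y) x /\<^sub>R vol c x"
proof -
  have i: "in_chart M c x" using c x by (simp add: in_chart_def)
  interpret gram "metric M c x" by (rule gram_metric[OF i])
  show ?thesis
    unfolding curl_def sharp_chart[where \<alpha> = "star M (ext_d M (flat M u))", OF i star_ext_d_flat_chart[OF assms]]
    by (simp add: matrix_vector_mult_scaleR HG)
qed

text \<open>With \<open>\<omega>\<close> the curl of \<open>u\<close>, this is \<open>V = - \<omega>\<^sup>\<flat>\<close>: the smoothness and the transition law of \<open>V\<close>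
and of \<open>\<omega>\<close> follow from each other.\<close>
lemma flat_curl:
  assumes u: "u \<in> vector_fields M"
  shows "flat M (curl M u) = star M (ext_d M (flat M u))"
proof (intro ext)
  fix c x vs
  show "flat M (curl M u) c x vs = star M (ext_d M (flat M u)) c x vs"
  proof (cases "in_chart M c x")
    case True
    then have cx: "c \<in> atlas M" "x \<in> chart_image c" by (auto simp: in_chart_def)
    show ?thesis
      by (simp add: flat_chart[OF True] curl_chart[OF u cx] star_ext_d_flat_chart[OF u cx] matrix_vector_mult_scaleR)
  qed (simp add: flat_outside star_outside)
qed

lemma divergence_chart:
  assumes u: "u \<in> vector_fields M" and c: "c \<in> atlas M" and x: "x \<in> chart_image c"
  shows "divergence M u c x = cov0 (dvg (\<lambda>y. vol c y *\<^sub>R u c y) x / vol c x)"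
proof -
  have in_chart: "in_chart M c y" if "y \<in> chart_image c" for y using c that by (simp add: in_chart_def)
  have "divergence M u c x =
      cov0 (dvg (\<lambda>y. vol c y *\<^sub>R (inv_metric c y *v (metric M c y *v u c y))) x / vol c x)"
    unfolding divergence_def
  proof (rule codiff_cov1[OF c x])
    show "flat M u c y = cov1 (metric M c y *v u c y)" if "y \<in> chart_image c" for y
      by (rule flat_chart[OF in_chart[OF that]])
  qed (intro smooth_metric_mult c vector_fieldsD(2)[OF u])
  also have "dvg (\<lambda>y. vol c y *\<^sub>R (inv_metric c y *v (metric M c y *v u c y))) x = dvg (\<lambda>y. vol c y *\<^sub>R u c y) x"
    by (rule dvg_cong[OF open_chart[OF c] x]) (simp add: gram.HG[OF gram_metric[OF in_chart]])
  finally show ?thesis .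
qed

text \<open>The volume density times the curl is a coordinate rotation.\<close>
lemma dvg_curl:
  assumes u: "u \<in> vector_fields M" and c: "c \<in> atlas M" and x: "x \<in> chart_image c"
  shows "dvg (\<lambda>y. vol c y *\<^sub>R curl M u c y) x = 0"
proof -
  have "dvg (\<lambda>y. vol c y *\<^sub>R curl M u c y) x = dvg (rot (\<lambda>y. metric M c y *v u c y)) x"
  proof (rule dvg_cong[OF open_chart[OF c] x])
    fix y assume y: "y \<in> chart_image c"
    then have "vol c y > 0" using c by (intro vol_pos) (simp add: in_chart_def)
    then show "vol c y *\<^sub>R curl M u c y = rot (\<lambda>y. metric M c y *v u c y) y"
      by (simp add: curl_chart[OF u c y])
  qed
  also have "\<dots> = 0"
    by (intro dvg_rot[OF open_chart[OF c] x] smooth_metric_mult c vector_fieldsD(2)[OF u])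
  finally show ?thesis .
qed

lemma christoffel_symmetric:
  assumes "in_chart M c x"
  shows "christoffel M c x i j k = christoffel M c x i k j"
proof -
  have "metric M c y $ i $ j = metric M c y $ j $ i" if "y \<in> chart_image c" for y i j
  proof -
    have "in_chart M c y" using assms that by (simp add: in_chart_def)
    then have "transpose (metric M c y) $ i $ j = metric M c y $ i $ j"
      by (simp only: gram.sym[OF gram_metric])
    then show ?thesis by (simp add: transpose_def)
  qed
  then have "partial_metric M c x l i j = partial_metric M c x l j i" for l i j
    unfolding partial_metric_def using assms open_chart
    by (subst frechet_derivative_cong_open[where S = "chart_image c" and g = "\<lambda>y. metric M c y $ j $ i"])
      (auto simp: in_chart_def)
  then show ?thesis
    unfolding christoffel_def by (simp add: add.commute)
qed

text \<open>The connection has no torsion: its coefficients are symmetric and cancel.\<close>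
lemma cov_deriv_commutator:
  assumes "in_chart M c x"
  shows "cov_deriv M w u c x - cov_deriv M u w c x =
    frechet_derivative (u c) (at x) (w c x) - frechet_derivative (w c) (at x) (u c x)"
proof -
  have "(\<Sum>j\<in>UNIV. \<Sum>k\<in>UNIV. christoffel M c x i j k * w c x $ j * u c x $ k) =
      (\<Sum>j\<in>UNIV. \<Sum>k\<in>UNIV. christoffel M c x i j k * u c x $ j * w c x $ k)" for i
    by (subst sum.swap) (simp add: christoffel_symmetric[OF assms, of i] mult.commute mult.left_commute)
  then show ?thesis using assms by (simp add: cov_deriv_def)
qed

end

section \<open>Linear combinations of covectors and elements\<close>

lemma cov1_scale: "r * cov1 a vs = cov1 (r *\<^sub>R a) vs"
  by (cases "length vs = 1") (auto simp: cov_eq_0 length_Suc_conv)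

lemma cov1_minus: "- cov1 a vs = cov1 (- a) vs"
  using cov1_scale[of "-1" a vs] by simp

lemma cov1_add: "cov1 a vs + cov1 b vs = cov1 (a + b) vs"
  by (cases "length vs = 1") (auto simp: cov_eq_0 length_Suc_conv inner_add_left)

lemma cov2_scale: "r * cov2 b vs = cov2 (r *\<^sub>R b) vs"
  by (cases "length vs = 2") (auto simp: cov_eq_0 length_2_conv)

lemma cov2_add: "cov2 a vs + cov2 b vs = cov2 (a + b) vs"
  by (cases "length vs = 2") (auto simp: cov_eq_0 length_2_conv inner_add_left)

lemma cov2_sum: "(\<Sum>k\<in>K. cov2 (b k) vs) = cov2 (\<Sum>k\<in>K. b k) vs"
  by (cases "length vs = 2") (auto simp: cov_eq_0 length_2_conv inner_sum_left)

lemma cov3_sum: "(\<Sum>k\<in>K. cov3 (r k) vs) = cov3 (\<Sum>k\<in>K. r k) vs"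
  by (cases "length vs = 3") (auto simp: cov_eq_0 length_3_conv sum_distrib_right)

lemma cov1_eq_0_iff: "cov1 a = 0 \<longleftrightarrow> a = 0"
proof
  assume "cov1 a = 0"
  then have "cov1 a [a] = 0" by (simp only: zero_fun_apply)
  then show "a = 0" by simp
next
  assume "a = 0"
  then show "cov1 a = 0" using cov1_scale[of 0 a] by (simp add: fun_eq_iff)
qed

lemma sum_rev: "(\<Sum>k\<le>n. f (n - k)) = (\<Sum>k\<le>n. f k)" for n :: nat
  by (rule sum.reindex_bij_witness[of _ "\<lambda>k. n - k" "\<lambda>k. n - k"]) auto

lemma odd_params_induct: "P {} \<Longrightarrow> P {Dt} \<Longrightarrow> P {Eps} \<Longrightarrow> P {Dt, Eps} \<Longrightarrow> P S"
  using odd_params_cases[of S] by auto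

lemma assemble_simps [simp]:
  "assemble f X V \<pi> {} = f" "assemble f X V \<pi> {Dt} = X" "assemble f X V \<pi> {Eps} = V"
  "assemble f X V \<pi> {Dt, Eps} = \<pi>"
  by (auto simp: assemble_def)

context oriented_riemannian3
begin

section \<open>The energy form\<close>

text \<open>The coefficient of \<open>t\<^sup>n\<close> in the squared length of the velocity.\<close>
definition speed_square :: "(nat \<Rightarrow> 'a vfield) \<Rightarrow> nat \<Rightarrow> 'a chart \<Rightarrow> real^3 \<Rightarrow> real" where
  "speed_square u n c x = (\<Sum>k\<le>n. u k c x \<bullet> (metric M c x *v u (n - k) c x))"

text \<open>The coefficients of \<open>\<pi>\<close>. The three-form \<open>X \<and> \<star>X\<close> is the squared speed times the volume form,
so \<open>\<pi>\<close> is the Hodge star of the differential of the kinetic energy.\<close>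
abbreviation energy_2form :: "(nat \<Rightarrow> 'a vfield) \<Rightarrow> nat \<Rightarrow> 'a form" where
  "energy_2form u \<equiv> (\<lambda>n. form_scale (1/2) (codiff M
     (wedge_ser (\<lambda>n. flat M (u n)) (\<lambda>n. star M (flat M (u n))) n)))"

lemma smooth_speed_square:
  assumes "\<And>n. u n \<in> vector_fields M" "c \<in> atlas M"
  shows "smooth_on (chart_image c) (speed_square u n c)"
  unfolding speed_square_def[abs_def]
  by (intro smooth_on_sum smooth_on_intros open_chart smooth_metric vector_fieldsD assms)

lemma energy_2form_chart:
  assumes u: "\<And>n. u n \<in> vector_fields M" and c: "c \<in> atlas M" and x: "x \<in> chart_image c"
  shows "energy_2form u n c x = cov2 ((vol c x / 2) *\<^sub>R (inv_metric c x *v grad (speed_square u n c) x))"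
proof -
  have "wedge_ser (\<lambda>n. flat M (u n)) (\<lambda>n. star M (flat M (u n))) n c y = cov3 (vol c y * speed_square u n c y)"
    if y: "y \<in> chart_image c" for y
  proof -
    have i: "in_chart M c y" using c y by (simp add: in_chart_def)
    interpret gram "metric M c y" by (rule gram_metric[OF i])
    have "wedge (flat M (u k)) (star M (flat M (u l))) c y =
        cov3 (vol c y * (u k c y \<bullet> (metric M c y *v u l c y)))" for k l
      by (simp add: wedge_def flat_chart[OF i] star_chart(2)[where \<alpha> = "flat M (u l)", OF i flat_chart[OF i]]
          HG wedge_at_cov1_cov2 G_self_adjoint)
    then show ?thesis
      by (simp add: fun_eq_iff wedge_ser_def sum_fun_apply cov3_sum speed_square_def sum_distrib_left)
  qed
  then have "codiff M (wedge_ser (\<lambda>n. flat M (u n)) (\<lambda>n. star M (flat M (u n))) n) c x =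
      cov2 (vol c x *\<^sub>R (inv_metric c x *v grad (speed_square u n c) x))"
    by (intro codiff_cov3[OF c x] smooth_onD[OF smooth_speed_square[OF u c] x])
  then have "energy_2form u n c x vs = 1/2 * cov2 (vol c x *\<^sub>R (inv_metric c x *v grad (speed_square u n c) x)) vs" for vs
    by (simp only: form_scale_def)
  then show ?thesis unfolding cov2_scale by (simp add: fun_eq_iff)
qed

lemma energy_2form_outside: "\<not> in_chart M c x \<Longrightarrow> energy_2form u n c x = 0"
  by (simp add: form_scale_def codiff_outside fun_eq_iff)

lemma speed_square_transition:
  assumes u: "\<And>n. u n \<in> vector_fields M" and c: "c \<in> atlas M" "c' \<in> atlas M" and x: "x \<in> overlap c c'"
  shows "speed_square u n c x = speed_square u n c' (transition c c' x)"
proof -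
  let ?J = "jacobian c c' x" and ?G' = "metric M c' (transition c c' x)"
  have "v \<bullet> (metric M c x *v w) = (?J *v v) \<bullet> (?G' *v (?J *v w))" for v w
  proof -
    have "v \<bullet> (metric M c x *v w) = v \<bullet> (transpose ?J *v (?G' *v (?J *v w)))"
      unfolding metric_transition[OF c x] by (simp only: matrix_vector_mul_assoc matrix_mul_assoc)
    also have "\<dots> = (?J *v v) \<bullet> (?G' *v (?J *v w))"
      by (metis dot_lmul_matrix inner_commute transpose_matrix_vector)
    finally show ?thesis .
  qed
  then show ?thesis by (simp add: speed_square_def vector_fieldsD(3)[OF u c x])
qed

text \<open>The squared speed is a function on the manifold, so the chain rule gives the transition law of
its gradient covector; passing to the gradient vector and multiplying by the volume density keeps it.\<close>
lemma energy_2form_kforms: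
  assumes u: "\<And>n. u n \<in> vector_fields M"
  shows "energy_2form u n \<in> kforms M 2"
proof -
  have in_chart: "c \<in> atlas M \<and> x \<in> chart_image c" if "in_chart M c x" for c x
    using that by (simp add: in_chart_def)
  have rep: "energy_2form u n c x = cov2 (if in_chart M c x
      then (vol c x / 2) *\<^sub>R (inv_metric c x *v grad (speed_square u n c) x) else 0)" for c x
  proof (cases "in_chart M c x")
    case False
    then show ?thesis using cov2_scale[of 0] by (simp add: energy_2form_outside fun_eq_iff)
  qed (simp add: energy_2form_chart[OF u] in_chart)
  have "smooth_on (chart_image c) (\<lambda>x. energy_2form u n c x vs)" if c: "c \<in> atlas M" for c vs
  proof -
    have "smooth_on (chart_image c) (\<lambda>x. cov2 ((vol c x * (1/2)) *\<^sub>R (inv_metric c x *v grad (speed_square u n c) x)) vs)"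
      by (intro smooth_on_cov smooth_on_intros smooth_vol smooth_inv_metric smooth_on_grad smooth_speed_square
          smooth_on_const open_chart c u)
    then show ?thesis
      by (subst smooth_on_cong[OF open_chart[OF c]]) (use c in \<open>auto simp: energy_2form_chart[OF u]\<close>)
  qed
  moreover have "energy_2form u n c x vs = energy_2form u n c' (transition c c' x) (map ((*v) (jacobian c c' x)) vs)"
    if c: "c \<in> atlas M" "c' \<in> atlas M" and x: "x \<in> overlap c c'" for c c' x vs
  proof -
    let ?J = "jacobian c c' x" and ?x' = "transition c c' x"
    note i = in_chart_overlap[OF c x]
    have E: "speed_square u n c differentiable (at x)" "speed_square u n c' differentiable (at ?x')"
      using in_chart[OF i(1)] in_chart[OF i(2)]
      by (auto intro!: smooth_onD[OF smooth_speed_square[of u, OF u]])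
    have "grad (speed_square u n c) x \<bullet> v = grad (speed_square u n c') ?x' \<bullet> (?J *v v)" for v
    proof -
      have "frechet_derivative (speed_square u n c) (at x) = frechet_derivative (speed_square u n c' \<circ> transition c c') (at x)"
        by (rule frechet_derivative_cong_open[OF open_overlap[OF c] x]) (simp add: speed_square_transition[OF u c])
      also have "\<dots> = frechet_derivative (speed_square u n c') (at ?x') \<circ> frechet_derivative (transition c c') (at x)"
        by (rule frechet_derivative_compose) (rule transition_differentiable[OF c x], rule E(2))
      finally show ?thesis by (simp add: grad_inner E jacobian_mult[OF c x])
    qed
    then have "inv_metric c' ?x' *v grad (speed_square u n c') ?x' = ?J *v (inv_metric c x *v grad (speed_square u n c) x)"
      by (intro sharp_pullback gram_metric i det_jacobian_pos metric_transition c x)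
    moreover have "vol c x = vol c' ?x' * det ?J"
      by (intro vol_density_pullback det_jacobian_pos metric_transition c x)
    ultimately show ?thesis
      unfolding energy_2form_chart[OF u conjunct1[OF in_chart[OF i(1)]] conjunct2[OF in_chart[OF i(1)]]]
        energy_2form_chart[OF u conjunct1[OF in_chart[OF i(2)]] conjunct2[OF in_chart[OF i(2)]]]
      by (intro cov2_natural) (simp add: triple_matrix_mult)
  qed
  moreover have "energy_2form u n c x vs = 0" if "length vs \<noteq> 2" for c x vs
    unfolding rep by (rule cov_eq_0(3)[OF that])
  moreover have "energy_2form u n c x \<in> Alt" for c x unfolding rep by (rule cov_Alt)
  ultimately show ?thesis
    using energy_2form_outside unfolding kforms_def forms_def by blast
qed

end

section \<open>Closedness of the exponential and the vorticity equations\<close>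

text \<open>The common situation of both directions: a time-dependent velocity whose curl is again a smooth
vector field. Whether it is divergence free and solves the evolution equation is what remains to be seen.\<close>
locale vorticity_homotopy = oriented_riemannian3 +
  fixes u :: "nat \<Rightarrow> 'a vfield"
  assumes u: "u n \<in> vector_fields M" and curl_u: "curl M (u n) \<in> vector_fields M"
begin

abbreviation w :: "nat \<Rightarrow> 'a vfield" where "w n \<equiv> curl M (u n)"

text \<open>The element that the theorem attaches to the velocity \<open>u\<close>.\<close>
definition vorticity_elt :: "'a elt" where
  "vorticity_elt = assemble 0 (\<lambda>n. flat M (u n)) (\<lambda>n. - star M (ext_d M (flat M (u n)))) (energy_2form u)"

lemma vorticity_elt_components: "vorticity_elt {} = 0" "vorticity_elt {Dt} n = flat M (u n)" "vorticity_elt {Eps} n = - flat M (w n)" "vorticity_elt {Dt, Eps} = energy_2form u"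
  unfolding vorticity_elt_def flat_curl[OF u, symmetric] by simp_all

lemma degree_zero_vorticity_elt: "degree_zero M vorticity_elt"
proof -
  have "vorticity_elt {Dt, Eps} n \<in> kforms M 2" for n
    unfolding vorticity_elt_components by (rule energy_2form_kforms[OF u])
  moreover have "vorticity_elt {Eps} n \<in> kforms M 1" for n
    unfolding vorticity_elt_components by (rule uminus_kforms[OF flat_kforms[OF curl_u]])
  moreover have "vorticity_elt {Dt} n \<in> kforms M 1" for n
    unfolding vorticity_elt_components by (rule flat_kforms[OF u])
  moreover have "vorticity_elt {} n \<in> kforms M 0" for n
    by (simp only: vorticity_elt_components zero_fun_apply zero_kforms)
  moreover have "card {Dt, Eps} = 2" "card {Dt} = 1" "card {Eps} = 1" by simp_all
  ultimately have "\<forall>n. vorticity_elt S n \<in> kforms M (card S)" for S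
    by - (rule odd_params_induct[of "\<lambda>S. \<forall>n. vorticity_elt S n \<in> kforms M (card S)"]; simp add: numeral_2_eq_2)
  then show ?thesis by (simp add: degree_zero_def)
qed

lemma vorticity_elt_outside: "\<not> in_chart M c x \<Longrightarrow> vorticity_elt S n c x = 0"
  by (rule kformsD(1)[of _ "card S"]) (use degree_zero_vorticity_elt in \<open>simp_all add: degree_zero_def\<close>)

lemma elt_exp_vorticity_elt: "elt_exp M vorticity_elt S n c x vs = elt_one M S n c x vs + vorticity_elt S n c x vs + elt_mult vorticity_elt vorticity_elt S n c x vs / 2"
  by (rule elt_exp_nilpotent) (simp_all only: vorticity_elt_components(1) vorticity_elt_outside not_False_eq_True)

lemma elt_exp_low:
  "card S \<le> 1 \<Longrightarrow> elt_exp M vorticity_elt S n = elt_one M S n + vorticity_elt S n"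
  using elt_mult_degree_one[where A = vorticity_elt, OF vorticity_elt_components(1), of S n] by (simp add: fun_eq_iff elt_exp_vorticity_elt)

text \<open>Both orders of the factors in the square contribute the same term \<open>- X \<and> V\<close>, which cancels the
factor \<open>1/2\<close> of the exponential series; with \<open>V = - \<omega>\<^sup>\<flat>\<close> the sign becomes positive.\<close>
lemma elt_exp_top_chart:
  assumes c: "c \<in> atlas M" and x: "x \<in> chart_image c"
  shows "elt_exp M vorticity_elt {Dt, Eps} n c x = cov2 ((vol c x / 2) *\<^sub>R (inv_metric c x *v grad (speed_square u n c) x)
    + (\<Sum>k\<le>n. (metric M c x *v u k c x) \<times> (metric M c x *v w (n - k) c x)))"
proof -
  have i: "in_chart M c x" using c x by (simp add: in_chart_def)
  let ?G = "metric M c x"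
  have X: "vorticity_elt {Dt} k c x = cov1 (?G *v u k c x)" and V: "vorticity_elt {Eps} k c x = cov1 (- (?G *v w k c x))" for k
    by (simp_all add: vorticity_elt_components flat_chart[OF i] cov1_minus fun_eq_iff)
  have kos: "koszul 1 \<alpha> c x = cov1 (- a)" if "\<alpha> c x = cov1 a" for \<alpha> a
  proof
    fix vs show "koszul 1 \<alpha> c x vs = cov1 (- a) vs"
      by (cases "length vs = 1") (simp_all add: koszul_def that cov_eq_0 cov1_minus)
  qed
  have KX: "koszul 1 (vorticity_elt {Dt} k) c x = cov1 (- (?G *v u k c x))"
    and KV: "koszul 1 (vorticity_elt {Eps} k) c x = cov1 (?G *v w k c x)" for k
    using kos[where \<alpha> = "vorticity_elt {Dt} k", OF X] kos[where \<alpha> = "vorticity_elt {Eps} k", OF V] by simp_all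
  have "(\<Sum>k\<le>n. wedge (vorticity_elt {Dt} k) (koszul 1 (vorticity_elt {Eps} (n - k)))) c x vs
      = cov2 (\<Sum>k\<le>n. (?G *v u k c x) \<times> (?G *v w (n - k) c x)) vs" for vs
    by (simp only: sum_fun_apply wedge_def X KV wedge_at_cov1_cov1 cov2_sum minus_minus)
  moreover have "(\<Sum>k\<le>n. wedge (vorticity_elt {Eps} k) (koszul 1 (vorticity_elt {Dt} (n - k)))) c x vs
      = - cov2 (\<Sum>k\<le>n. (?G *v u k c x) \<times> (?G *v w (n - k) c x)) vs" for vs
  proof -
    have "(\<Sum>k\<le>n. wedge (vorticity_elt {Eps} k) (koszul 1 (vorticity_elt {Dt} (n - k)))) c x vs
        = cov2 (\<Sum>k\<le>n. (?G *v w k c x) \<times> (?G *v u (n - k) c x)) vs"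
      by (simp only: sum_fun_apply wedge_def V KX wedge_at_cov1_cov1 cov2_sum minus_minus
          cross_minus_left cross_minus_right)
    also have "(\<Sum>k\<le>n. (?G *v w k c x) \<times> (?G *v u (n - k) c x)) = (\<Sum>k\<le>n. (?G *v w (n - k) c x) \<times> (?G *v u k c x))"
      by (subst sum_rev[symmetric]) (rule sum.cong, auto)
    also have "\<dots> = - (\<Sum>k\<le>n. (?G *v u k c x) \<times> (?G *v w (n - k) c x))"
      unfolding sum_negf[symmetric] by (intro sum.cong refl cross_skew)
    finally show ?thesis using cov2_scale[of "-1"] by simp
  qed
  ultimately have "elt_mult vorticity_elt vorticity_elt {Dt, Eps} n c x vs / 2 = cov2 (\<Sum>k\<le>n. (?G *v u k c x) \<times> (?G *v w (n - k) c x)) vs" for vs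
    by (simp add: elt_mult_top[where A = vorticity_elt, OF vorticity_elt_components(1)])
  moreover have "elt_one M {Dt, Eps} n c x vs = 0" for vs by (simp add: elt_one_def)
  ultimately show ?thesis
    by (simp add: fun_eq_iff elt_exp_vorticity_elt vorticity_elt_components energy_2form_chart[OF u c x] cov2_add)
qed

lemma elt_diff_empty: "elt_diff M (elt_exp M vorticity_elt) {} n = 0"
proof -
  have one: "elt_exp M vorticity_elt {} n = elt_one M {} n" by (simp add: elt_exp_low vorticity_elt_components)
  have "codiff M (elt_one M {} n) c x = 0" for c x
  proof (cases "in_chart M c x")
    case True
    then have c: "c \<in> atlas M" and x: "x \<in> chart_image c" by (auto simp: in_chart_def)
    show ?thesis
    proof (rule codiff_cov0[OF c x])
      fix y assume "y \<in> chart_image c"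
      then have "in_chart M c y" using c by (simp add: in_chart_def)
      then have "elt_one M {} n c y vs = cov0 (if n = 0 then 1 else 0) vs" for vs
        by (cases vs) (auto simp: elt_one_def unit_form_def)
      then show "elt_one M {} n c y = cov0 (if n = 0 then 1 else 0)" by (rule ext)
    qed (rule smooth_on_const)
  qed (rule codiff_outside)
  then show ?thesis by (simp add: elt_diff_def one fun_eq_iff)
qed

lemma elt_diff_Dt: "elt_diff M (elt_exp M vorticity_elt) {Dt} n = divergence M (u n)"
proof -
  have "elt_exp M vorticity_elt {Dt} n = flat M (u n)" "elt_exp M vorticity_elt {} (Suc n) = 0"
    by (simp_all add: elt_exp_low vorticity_elt_components elt_one_def)
  then show ?thesis by (simp add: elt_diff_def divergence_def del: zero_fun_apply)
qed

text \<open>The codifferential of the flat of a curl is the divergence of a rotation.\<close>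
lemma elt_diff_Eps: "elt_diff M (elt_exp M vorticity_elt) {Eps} n = 0"
proof -
  have V: "elt_exp M vorticity_elt {Eps} n = - flat M (w n)"
    by (simp add: elt_exp_low vorticity_elt_components elt_one_def)
  have "codiff M (- flat M (w n)) c x = 0" for c x
  proof (cases "in_chart M c x")
    case True
    then have c: "c \<in> atlas M" and x: "x \<in> chart_image c" by (auto simp: in_chart_def)
    have in_chart: "in_chart M c y" if "y \<in> chart_image c" for y using c that by (simp add: in_chart_def)
    have sw: "smooth_on (chart_image c) (w n c)" by (rule vector_fieldsD(2)[OF curl_u c])
    have "codiff M (- flat M (w n)) c x =
        cov0 (dvg (\<lambda>y. vol c y *\<^sub>R (inv_metric c y *v - (metric M c y *v w n c y))) x / vol c x)"
    proof (rule codiff_cov1[OF c x])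
      fix y assume "y \<in> chart_image c"
      then show "(- flat M (w n)) c y = cov1 (- (metric M c y *v w n c y))"
        by (simp add: fun_eq_iff flat_chart[OF in_chart] cov1_minus)
    next
      show "smooth_on (chart_image c) (\<lambda>y. - (metric M c y *v w n c y))"
        by (rule smooth_on_linear[OF open_chart[OF c] bounded_linear_minus[OF bounded_linear_ident]
              smooth_metric_mult[OF c sw]])
    qed
    also have "dvg (\<lambda>y. vol c y *\<^sub>R (inv_metric c y *v - (metric M c y *v w n c y))) x =
        dvg (\<lambda>y. - (vol c y *\<^sub>R w n c y)) x"
      by (rule dvg_cong[OF open_chart[OF c] x])
        (simp add: gram.HG[OF gram_metric[OF in_chart]] linear_neg[OF matrix_vector_mul_linear])
    also have "\<dots> = - dvg (\<lambda>y. vol c y *\<^sub>R w n c y) x"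
    proof -
      have "(\<lambda>y. vol c y *\<^sub>R w n c y) differentiable (at x)"
        by (intro smooth_onD[OF _ x] smooth_on_intros open_chart smooth_vol c sw)
      from frechet_derivative_bounded_linear[OF bounded_linear_minus[OF bounded_linear_ident] this]
      show ?thesis unfolding dvg_def by (simp add: sum_negf)
    qed
    also have "dvg (\<lambda>y. vol c y *\<^sub>R w n c y) x = 0" by (rule dvg_curl[OF u c x])
    finally have "codiff M (- flat M (w n)) c x = cov0 (- 0 / vol c x)" .
    then have "codiff M (- flat M (w n)) c x = cov0 0" by (simp only: minus_zero div_0)
    also have "cov0 0 = 0"
    proof
      fix vs show "cov0 0 vs = 0 vs" by (cases vs) auto
    qed
    finally show ?thesis .
  qed (rule codiff_outside)
  then show ?thesis by (simp add: elt_diff_def V fun_eq_iff)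
qed

text \<open>The Hodge star takes \<open>\<pi>\<close> to half a gradient, which has no rotation, and \<open>X \<and> \<omega>\<^sup>\<flat>\<close> to \<open>s (u \<times> \<omega>)\<close>,
whose rotation is \<open>s\<close> times the Lie bracket. The time derivative comes from the \<open>\<epsilon>\<close>
component through the differential of \<open>t\<close>.\<close>
lemma elt_diff_top_chart:
  assumes div: "\<And>n. divergence M (u n) = 0" and c: "c \<in> atlas M" and x: "x \<in> chart_image c"
  shows "elt_diff M (elt_exp M vorticity_elt) {Dt, Eps} n c x =
    cov1 (metric M c x *v (time_deriv_vf w n - (cov_deriv_ser M w u n - cov_deriv_ser M u w n)) c x)"
proof -
  have in_chart: "in_chart M c y" if "y \<in> chart_image c" for y using c that by (simp add: in_chart_def)
  let ?S = "chart_image c"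
  have su: "smooth_on ?S (u k c)" and sw: "smooth_on ?S (w k c)" for k
    using vector_fieldsD(2) u curl_u c by blast+
  have dm: "vol c differentiable (at x)" by (rule smooth_onD[OF smooth_vol[OF c] x])
  let ?b = "\<lambda>y. (vol c y / 2) *\<^sub>R (inv_metric c y *v grad (speed_square u n c) y)
    + (\<Sum>k\<le>n. (metric M c y *v u k c y) \<times> (metric M c y *v w (n - k) c y))"
  let ?a = "\<lambda>y. (1/2) *\<^sub>R grad (speed_square u n c) y + (\<Sum>k\<le>n. vol c y *\<^sub>R (u k c y \<times> w (n - k) c y))"
  have ab: "(metric M c y *v ?b y) /\<^sub>R vol c y = ?a y" if y: "y \<in> ?S" for y
  proof -
    interpret gram "metric M c y" by (rule gram_metric[OF in_chart[OF y]])
    have "metric M c y *v ((metric M c y *v p) \<times> (metric M c y *v q)) = (vol c y * vol c y) *\<^sub>R (p \<times> q)" for p q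
      by (simp add: G_cross matrix_vector_mult_scaleR GH s_square)
    then have "metric M c y *v ?b y = (vol c y / 2) *\<^sub>R grad (speed_square u n c) y
        + (\<Sum>k\<le>n. (vol c y * vol c y) *\<^sub>R (u k c y \<times> w (n - k) c y))"
      by (simp add: matrix_vector_right_distrib matrix_vector_mult_scaleR GH
          linear_sum[OF matrix_vector_mul_linear])
    then show ?thesis
      using s_pos by (simp add: scaleR_right_distrib scaleR_sum_right flip: mult.assoc)
  qed
  have sg: "smooth_on ?S (grad (speed_square u n c))"
    by (intro smooth_on_grad open_chart c smooth_speed_square u)
  have sk: "smooth_on ?S (\<lambda>y. vol c y *\<^sub>R (u k c y \<times> w (n - k) c y))" for k
    by (intro smooth_on_intros open_chart c smooth_vol su sw)
  have dg: "grad (speed_square u n c) differentiable (at x)" by (rule smooth_onD[OF sg x])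
  have dk: "(\<lambda>y. vol c y *\<^sub>R (u k c y \<times> w (n - k) c y)) differentiable (at x)" for k
    by (rule smooth_onD[OF sk x])
  have da: "?a differentiable (at x)"
    by (intro smooth_onD[OF _ x] smooth_on_add smooth_on_sum smooth_on_intros smooth_on_const sg sk open_chart c
        smooth_vol su sw)
  \<comment> \<open>The two divergence terms of \<open>rot_scaled_cross\<close> drop out: that of \<open>u\<close> by incompressibility,
    that of the curl by \<open>dvg_curl\<close>.\<close>
  have D0: "dvg (\<lambda>y. vol c y *\<^sub>R u k c y) x = 0" for k
  proof -
    have "cov0 (dvg (\<lambda>y. vol c y *\<^sub>R u k c y) x / vol c x) [] = divergence M (u k) c x []"
      by (simp only: divergence_chart[OF u c x])
    also have "\<dots> = 0" by (simp add: div)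
    finally show ?thesis using vol_pos[OF in_chart[OF x]] by simp
  qed
  have rot: "rot ?a x = vol c x *\<^sub>R (\<Sum>k\<le>n. frechet_derivative (u k c) (at x) (w (n - k) c x)
      - frechet_derivative (w (n - k) c) (at x) (u k c x))"
  proof -
    have "rot ?a x = rot (\<lambda>y. (1/2) *\<^sub>R grad (speed_square u n c) y) x
        + rot (\<lambda>y. \<Sum>k\<le>n. vol c y *\<^sub>R (u k c y \<times> w (n - k) c y)) x"
      by (intro rot_add smooth_onD[OF _ x] smooth_on_sum smooth_on_intros smooth_on_const sg sk open_chart c
        smooth_vol su sw)
    also have "rot (\<lambda>y. (1/2) *\<^sub>R grad (speed_square u n c) y) x = 0"
      by (simp add: rot_scaleR[OF dg] rot_grad[OF open_chart[OF c] x smooth_speed_square[OF u c]])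
    also have "rot (\<lambda>y. \<Sum>k\<le>n. vol c y *\<^sub>R (u k c y \<times> w (n - k) c y)) x =
        (\<Sum>k\<le>n. rot (\<lambda>y. vol c y *\<^sub>R (u k c y \<times> w (n - k) c y)) x)"
      by (rule rot_sum) (auto intro: dk)
    also have "\<dots> = (\<Sum>k\<le>n. vol c x *\<^sub>R (frechet_derivative (u k c) (at x) (w (n - k) c x)
      - frechet_derivative (w (n - k) c) (at x) (u k c x)))"
      by (intro sum.cong refl)
        (simp add: rot_scaled_cross[OF dm smooth_onD[OF su x] smooth_onD[OF sw x]] D0 dvg_curl[OF u c x])
    finally show ?thesis by (simp add: scaleR_sum_right)
  qed
  have bracket: "(cov_deriv_ser M w u n - cov_deriv_ser M u w n) c x =
      (\<Sum>k\<le>n. frechet_derivative (u k c) (at x) (w (n - k) c x) - frechet_derivative (w (n - k) c) (at x) (u k c x))"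
  proof -
    have "cov_deriv_ser M w u n c x = (\<Sum>k\<le>n. cov_deriv M (w (n - k)) (u k) c x)"
      unfolding cov_deriv_ser_def sum_fun_apply by (subst sum_rev[symmetric]) (rule sum.cong, auto)
    moreover have "cov_deriv_ser M u w n c x = (\<Sum>k\<le>n. cov_deriv M (u k) (w (n - k)) c x)"
      by (simp add: cov_deriv_ser_def sum_fun_apply)
    ultimately show ?thesis
      by (simp add: cov_deriv_commutator[OF in_chart[OF x]] flip: sum_subtractf)
  qed
  have "codiff M (elt_exp M vorticity_elt {Dt, Eps} n) c x =
      cov1 (- (metric M c x *v rot (\<lambda>y. (metric M c y *v ?b y) /\<^sub>R vol c y) x) /\<^sub>R vol c x)"
  proof (rule codiff_cov2[OF c x])
    show "elt_exp M vorticity_elt {Dt, Eps} n c y = cov2 (?b y)" if "y \<in> ?S" for y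
      by (rule elt_exp_top_chart[OF c that])
    show "(\<lambda>y. (metric M c y *v ?b y) /\<^sub>R vol c y) differentiable (at x)"
      by (rule iffD2[OF differentiable_cong_open[where g = ?a, OF open_chart[OF c] x] da]) (rule ab)
  qed
  also have "rot (\<lambda>y. (metric M c y *v ?b y) /\<^sub>R vol c y) x = rot ?a x"
    by (rule rot_cong[OF open_chart[OF c] x ab])
  also have "- (metric M c x *v rot ?a x) /\<^sub>R vol c x =
      - (metric M c x *v (cov_deriv_ser M w u n - cov_deriv_ser M u w n) c x)"
    unfolding rot bracket using vol_pos[OF in_chart[OF x]] by (simp add: matrix_vector_mult_scaleR)
  finally have 1: "codiff M (elt_exp M vorticity_elt {Dt, Eps} n) c x =
      cov1 (- (metric M c x *v (cov_deriv_ser M w u n - cov_deriv_ser M u w n) c x))" .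
  have V: "elt_exp M vorticity_elt {Eps} (Suc n) = - flat M (w (Suc n))"
    by (simp add: elt_exp_low vorticity_elt_components elt_one_def)
  have 2: "form_scale (real (Suc n)) (koszul 1 (elt_exp M vorticity_elt {Eps} (Suc n))) c x vs =
      cov1 (metric M c x *v time_deriv_vf w n c x) vs" for vs
    unfolding V by (cases "length vs = 1")
      (simp_all add: form_scale_def koszul_def flat_chart[OF in_chart[OF x]] cov_eq_0 time_deriv_vf_def
        cov1_scale cov1_minus matrix_vector_mult_scaleR del: of_nat_Suc)
  have "{Dt, Eps} - {Dt} = {Eps}" by auto
  then show ?thesis
    by (simp add: elt_diff_def fun_eq_iff 1 2 cov1_add matrix_vector_mult_diff_distrib algebra_simps
        del: of_nat_Suc One_nat_def)
qed

text \<open>Of the four components of the differential two vanish identically, one is the divergence, and the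
last is the flat of the evolution equation; the metric is invertible, so nothing is lost by lowering
the index.\<close>
lemma homotopy_iff_vorticity: "homotopy M vorticity_elt \<longleftrightarrow> vorticity_solution M u w"
proof -
  let ?E = "\<lambda>n. time_deriv_vf w n - (cov_deriv_ser M w u n - cov_deriv_ser M u w n)"
  let ?D = "elt_diff M (elt_exp M vorticity_elt)"
  have "homotopy M vorticity_elt \<longleftrightarrow> (\<forall>S n. ?D S n = 0)"
    by (simp add: homotopy_def degree_zero_vorticity_elt fun_eq_iff)
  also have "\<dots> \<longleftrightarrow> (\<forall>n. ?D {} n = 0 \<and> ?D {Dt} n = 0 \<and> ?D {Eps} n = 0 \<and> ?D {Dt, Eps} n = 0)"
    using odd_params_induct[of "\<lambda>S. \<forall>n. ?D S n = 0"] by blast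
  also have "\<dots> \<longleftrightarrow> (\<forall>n. divergence M (u n) = 0) \<and> (\<forall>n. ?D {Dt, Eps} n = 0)"
    unfolding elt_diff_empty elt_diff_Dt elt_diff_Eps by blast
  also have "\<dots> \<longleftrightarrow> (\<forall>n. divergence M (u n) = 0) \<and> (\<forall>n. ?E n = 0)"
  proof (rule conj_cong[OF refl], rule all_cong1)
    fix n assume div: "\<forall>n. divergence M (u n) = 0"
    have pointwise: "?D {Dt, Eps} n c x = 0 \<longleftrightarrow> ?E n c x = 0" for c x
    proof (cases "in_chart M c x")
      case True
      interpret gram "metric M c x" by (rule gram_metric[OF True])
      from True have "?D {Dt, Eps} n c x = cov1 (metric M c x *v ?E n c x)"
        using div by (intro elt_diff_top_chart) (auto simp: in_chart_def)
      then show ?thesis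
        using HG[of "?E n c x"] by (metis cov1_eq_0_iff matrix_vector_mult_0_right)
    next
      case False
      have "elt_exp M vorticity_elt {Eps} (Suc n) c x = 0"
        using vorticity_elt_outside[OF False] by (simp add: elt_exp_low elt_one_def)
      then have "?D {Dt, Eps} n c x = 0"
        by (simp add: elt_diff_def codiff_outside[OF False] form_scale_def koszul_def fun_eq_iff insert_Diff_if)
      moreover have "?E n c x = 0"
        by (simp add: time_deriv_vf_def cov_deriv_ser_def sum_fun_apply cov_deriv_def False
            vector_fieldsD(1)[OF curl_u False])
      ultimately show ?thesis by simp
    qed
    show "?D {Dt, Eps} n = 0 \<longleftrightarrow> ?E n = 0"
      using pointwise unfolding fun_eq_iff[where f = "?D {Dt, Eps} n"] fun_eq_iff[where f = "?E n"]
      by (simp add: fun_eq_iff)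
  qed
  also have "\<dots> \<longleftrightarrow> vorticity_solution M u w"
    unfolding vorticity_solution_def by (auto simp: u curl_u)
  finally show ?thesis .
qed

end

lemma density_ser_zero: "density_ser M 0 = unit_density M"
proof -
  have A: "assemble 0 0 0 0 = (0 :: 'a elt)"
    by (auto simp: assemble_def fun_eq_iff)
  have "elt_exp M (0 :: 'a elt) {} n c x vs = elt_one M {} n c x vs + (0 :: 'a elt) {} n c x vs
      + elt_mult 0 0 {} n c x vs / 2" for n c x vs
    by (rule elt_exp_nilpotent) simp_all
  moreover have "elt_mult 0 0 {} n = (0 :: 'a form)" for n
    by (rule elt_mult_degree_one) simp_all
  ultimately have "elt_exp M (assemble 0 0 0 0) {} n c x vs = elt_one M {} n c x vs" for n c x vs
    by (simp add: A)
  then show ?thesis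
    by (simp add: density_ser_def unit_density_def elt_one_def fun_eq_iff)
qed

theorem lemma5p2:
  fixes M :: "'a riemannian3"
  assumes "connected_closed_oriented_riemannian3 M"
    and "has_total_volume M 1"
  shows "(\<forall>u \<omega> f X V \<pi>.
            vorticity_solution M u \<omega> \<and>
            f = 0 \<and>
            X = (\<lambda>n. flat M (u n)) \<and>
            V = (\<lambda>n. - star M (ext_d M (X n))) \<and>
            \<pi> = (\<lambda>n. form_scale (1/2) (codiff M (wedge_ser X (\<lambda>m. star M (X m)) n)))
            \<longrightarrow> homotopy M (assemble f X V \<pi>)) \<and>
         (\<forall>f X V \<pi>.
            homotopy M (assemble f X V \<pi>) \<and>
            f = 0 \<and>
            V = (\<lambda>n. - star M (ext_d M (X n))) \<and>
            \<pi> = (\<lambda>n. form_scale (1/2) (codiff M (wedge_ser X (\<lambda>m. star M (X m)) n)))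
            \<longrightarrow> (\<exists>u \<omega>. vorticity_solution M u \<omega> \<and>
                   u = (\<lambda>n. sharp M (X n)) \<and>
                   X = (\<lambda>n. flat M (u n)) \<and>
                   density_ser M f = unit_density M))"
proof (intro conjI allI impI; elim conjE)
  interpret oriented_riemannian3 M
    using assms(1) by unfold_locales (auto simp: connected_closed_oriented_riemannian3_def)
  {
    fix u \<omega> :: "nat \<Rightarrow> 'a vfield" and f X V \<pi> :: "nat \<Rightarrow> 'a form"
    assume sol: "vorticity_solution M u \<omega>" and eqs: "f = 0" "X = (\<lambda>n. flat M (u n))"
      "V = (\<lambda>n. - star M (ext_d M (X n)))"
      "\<pi> = (\<lambda>n. form_scale (1/2) (codiff M (wedge_ser X (\<lambda>m. star M (X m)) n)))"
    have \<omega>: "\<omega> = (\<lambda>n. curl M (u n))" using sol by (auto simp: vorticity_solution_def)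
    interpret vorticity_homotopy M u
      by unfold_locales (use sol in \<open>auto simp: vorticity_solution_def \<omega>\<close>)
    show "homotopy M (assemble f X V \<pi>)"
      using sol homotopy_iff_vorticity unfolding vorticity_elt_def eqs \<omega> by blast
  next
    fix f X V \<pi> :: "nat \<Rightarrow> 'a form"
    assume hom: "homotopy M (assemble f X V \<pi>)" and eqs: "f = 0"
      "V = (\<lambda>n. - star M (ext_d M (X n)))"
      "\<pi> = (\<lambda>n. form_scale (1/2) (codiff M (wedge_ser X (\<lambda>m. star M (X m)) n)))"
    define u where "u n = sharp M (X n)" for n
    have kf: "assemble f X V \<pi> S n \<in> kforms M (card S)" for S n
      using hom by (simp add: homotopy_def degree_zero_def)
    have X: "X n \<in> kforms M 1" for n using kf[of "{Dt}" n] by simp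
    \<comment> \<open>That \<open>V\<close> is a one-form is part of being a homotopy, and makes the curl a smooth vector field.\<close>
    have V: "V n \<in> kforms M 1" for n using kf[of "{Eps}" n] by simp
    have flat_u: "flat M (u n) = X n" for n unfolding u_def by (rule flat_sharp[OF X])
    have "star M (ext_d M (X n)) \<in> kforms M 1" for n
      using uminus_kforms[OF V[of n]] by (simp add: eqs(2))
    then have "curl M (u n) \<in> vector_fields M" for n
      unfolding curl_def flat_u by (rule sharp_vector_fields)
    then interpret vorticity_homotopy M u
      by unfold_locales (auto simp: u_def sharp_vector_fields[OF X])
    have "vorticity_elt = assemble f X V \<pi>" unfolding vorticity_elt_def eqs flat_u by simp
    then have "vorticity_solution M u w" using hom homotopy_iff_vorticity by simp
    then show "\<exists>u \<omega>. vorticity_solution M u \<omega> \<and> u = (\<lambda>n. sharp M (X n)) \<and>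
        X = (\<lambda>n. flat M (u n)) \<and> density_ser M f = unit_density M"
      using flat_u by (intro exI[of _ u] exI[of _ w]) (auto simp: u_def[abs_def] eqs(1) density_ser_zero)
  }
qed

end
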